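(* Let $\alpha$ be irrational and $Tx=x+\alpha$ on $\mathbb{T}=\mathbb{R}/\mathbb{Z}$. Let $\varphi:\mathbb{T}\to SU(2)$ be a $C^1$-cocycle over $T$ with degree $d(\varphi)\ne 0$, and let $\gamma=\gamma(\varphi):\mathbb{T}\to S^1=\{z\in\mathbb{C}:|z|=1\}$ be a measurable cocycle such that $\varphi$ is cohomologous to $\begin{pmatrix}\gamma&0\\0&\gamma^{-1}\end{pmatrix}$. Then the skew product $T_{\gamma}:\mathbb{T}\times S^1\to\mathbb{T}\times S^1$, $T_\gamma(x,z)=(Tx,z\,\gamma(x))$, is ergodic and it is mixing on the orthocomplement (in $L^2(\mathbb{T}\times S^1)$) of the space of functions depending only on the first variable.
   Context: A $C^1$-cocycle over $T$ is a $C^1$ function $\varphi:\mathbb{T}\to SU(2)$; for $n\ge 1$, $\varphi^{(n)}(x)=\varphi(x)\varphi(Tx)\cdots\varphi(T^{n-1}x)$. $D$ denotes differentiation in $x$, and $D\varphi^{(n)}(x)\,\varphi^{(n)}(x)^{-1}$ lies in the Lie algebra $\mathfrak{su}(2)$ of traceless skew-Hermitian $2\times 2$ matrices, normed by $\|A\|=\sqrt{\det A}$. The sequence $\frac1n D\varphi^{(n)}(\varphi^{(n)})^{-1}$ converges in $L^2(\mathbb{T},\mathfrak{su}(2))$ and a.e. to some $\psi$ with $\|\psi(x)\|$ a.e. constant; the degree $d(\varphi)$ is this constant. Two measurable cocycles $\varphi,\delta:\mathbb{T}\to SU(2)$ are cohomologous if there is a measurable $p:\mathbb{T}\to SU(2)$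 with $\varphi(x)=p(x)^{-1}\delta(x)p(Tx)$ a.e. When $d(\varphi)\neq0$, a $\gamma$ as in the claim exists. $\mathbb{T}\times S^1$ carries the product of the normalized Haar measures. A unitary operator $U$ on a Hilbert space $\mathcal H$ is mixing if $\langle U^nf,f\rangle\to0$ as $n\to\infty$ for every $f\in\mathcal H$; $T_\gamma$ is mixing on an invariant subspace if its Koopman operator $f\mapsto f\circ T_\gamma$ restricted to that subspace is mixing. *)

theory Defs
  imports "HOL-Analysis.Analysis" "HOL-Library.Periodic_Fun"
begin

text \<open>
  A function on the circle \<open>\<real>/\<int>\<close> is a function on \<open>real\<close> of period 1 (the
  locale predicate \<open>periodic_fun_simple'\<close>), so that \<open>f (T x)\<close> is \<open>f (x + \<alpha>)\<close>.
  As a measure space the circle is the fundamental domain \<open>{0..<1}\<close>, on which the rotation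
  becomes \<open>x \<mapsto> frac (x + \<alpha>)\<close>.
\<close>

definition torus :: "real measure" where
  "torus = restrict_space lborel {0..<1}"

definition rotation :: "real \<Rightarrow> real \<Rightarrow> real" where
  "rotation \<alpha> x = frac (x + \<alpha>)"

text \<open>Normalized Haar measure on the unit circle of the complex plane.\<close>

definition circle_measure :: "complex measure" where
  "circle_measure =
     distr torus (restrict_space borel (sphere 0 1)) (\<lambda>t. cis (2 * pi * t))"


subsection \<open>Cocycles\<close>

definition conj_transpose :: "complex^2^2 \<Rightarrow> complex^2^2" where
  "conj_transpose A = (\<chi> i j. cnj (A $ j $ i))"

definition SU2 :: "(complex^2^2) set" where
  "SU2 = {A. A ** conj_transpose A = mat 1 \<and> det A = 1}"

definition su2 :: "(complex^2^2) set" where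
  "su2 = {A. conj_transpose A = - A \<and> trace A = 0}"

text \<open>On \<open>su2\<close> the determinant is a nonnegative real number, so \<open>Re\<close> loses nothing.\<close>

definition su2_norm :: "complex^2^2 \<Rightarrow> real" where
  "su2_norm A = sqrt (Re (det A))"

definition C1_cocycle :: "(real \<Rightarrow> complex^2^2) \<Rightarrow> bool" where
  "C1_cocycle \<phi> \<longleftrightarrow>
     periodic_fun_simple' \<phi> \<and> (\<forall>x. \<phi> x \<in> SU2) \<and> \<phi> C1_differentiable_on UNIV"

definition measurable_cocycle ::
    "'a::topological_space set \<Rightarrow> (real \<Rightarrow> 'a) \<Rightarrow> bool" where
  "measurable_cocycle K f \<longleftrightarrow>
     periodic_fun_simple' f \<and> f \<in> borel_measurable borel \<and> (\<forall>x. f x \<in> K)"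

definition cohomologous ::
    "real \<Rightarrow> (real \<Rightarrow> complex^2^2) \<Rightarrow> (real \<Rightarrow> complex^2^2) \<Rightarrow> bool" where
  "cohomologous \<alpha> \<phi> \<delta> \<longleftrightarrow>
     (\<exists>p. measurable_cocycle SU2 p \<and>
          (AE x in torus. \<phi> x = matrix_inv (p x) ** \<delta> x ** p (x + \<alpha>)))"

definition diag_cocycle :: "(real \<Rightarrow> complex) \<Rightarrow> real \<Rightarrow> complex^2^2" where
  "diag_cocycle \<gamma> x = vector [vector [\<gamma> x, 0], vector [0, inverse (\<gamma> x)]]"


subsection \<open>Degree\<close>

primrec cocycle_iter ::
    "real \<Rightarrow> (real \<Rightarrow> complex^2^2) \<Rightarrow> nat \<Rightarrow> real \<Rightarrow> complex^2^2" where
  "cocycle_iter \<alpha> \<phi> 0 x = mat 1"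
| "cocycle_iter \<alpha> \<phi> (Suc n) x = cocycle_iter \<alpha> \<phi> n x ** \<phi> (x + real n * \<alpha>)"

definition log_deriv_avg ::
    "real \<Rightarrow> (real \<Rightarrow> complex^2^2) \<Rightarrow> nat \<Rightarrow> real \<Rightarrow> complex^2^2" where
  "log_deriv_avg \<alpha> \<phi> n x =
     (1 / real n) *\<^sub>R
       (vector_derivative (cocycle_iter \<alpha> \<phi> n) (at x) ** matrix_inv (cocycle_iter \<alpha> \<phi> n x))"

definition has_degree :: "real \<Rightarrow> (real \<Rightarrow> complex^2^2) \<Rightarrow> real \<Rightarrow> bool" where
  "has_degree \<alpha> \<phi> d \<longleftrightarrow>
     (\<exists>\<psi> \<in> borel_measurable torus.
        (\<forall>x. \<psi> x \<in> su2) \<and>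
        ((\<lambda>n. \<integral>\<^sup>+x. ennreal ((su2_norm (log_deriv_avg \<alpha> \<phi> n x - \<psi> x))\<^sup>2) \<partial>torus)
           \<longlonglongrightarrow> 0) \<and>
        (AE x in torus. (\<lambda>n. log_deriv_avg \<alpha> \<phi> n x) \<longlonglongrightarrow> \<psi> x) \<and>
        (AE x in torus. su2_norm (\<psi> x) = d))"

lemma has_degree_unique:
  assumes "has_degree \<alpha> \<phi> d" "has_degree \<alpha> \<phi> e"
  shows "d = e"
proof -
  obtain \<psi> where p: "AE x in torus. (\<lambda>n. log_deriv_avg \<alpha> \<phi> n x) \<longlonglongrightarrow> \<psi> x"
      "AE x in torus. su2_norm (\<psi> x) = d"
    using assms(1) unfolding has_degree_def by blast
  obtain \<xi> where q: "AE x in torus. (\<lambda>n. log_deriv_avg \<alpha> \<phi> n x) \<longlonglongrightarrow> \<xi> x"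
      "AE x in torus. su2_norm (\<xi> x) = e"
    using assms(2) unfolding has_degree_def by blast
  have "AE x in torus. d = e"
    using p q by eventually_elim (metis LIMSEQ_unique)
  moreover have "emeasure torus (space torus) = 1"
    by (simp add: torus_def space_restrict_space emeasure_restrict_space)
  ultimately show ?thesis
    using AE_iff_null_sets[of "space torus" torus]
    by (cases "d = e")
      (auto simp: eventually_ae_filter null_sets_def dest: emeasure_eq_0)
qed

text \<open>
  For an irrational \<open>\<alpha>\<close> and a \<open>C\<^sup>1\<close>-cocycle the limit exists; the value 0 in the other case
  only makes the function total.
\<close>

definition degree_cocycle :: "real \<Rightarrow> (real \<Rightarrow> complex^2^2) \<Rightarrow> real" where
  "degree_cocycle \<alpha> \<phi> =
     (if \<exists>d. has_degree \<alpha> \<phi> d then THE d. has_degree \<alpha> \<phi> d else 0)"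

lemma degree_cocycle_eq: "has_degree \<alpha> \<phi> d \<Longrightarrow> degree_cocycle \<alpha> \<phi> = d"
  unfolding degree_cocycle_def by (auto intro: the_equality has_degree_unique)


subsection \<open>Skew products, ergodicity and mixing\<close>

definition skew_space :: "(real \<times> complex) measure" where
  "skew_space = torus \<Otimes>\<^sub>M circle_measure"

definition skew_product ::
    "real \<Rightarrow> (real \<Rightarrow> complex) \<Rightarrow> real \<times> complex \<Rightarrow> real \<times> complex" where
  "skew_product \<alpha> \<gamma> = (\<lambda>(x, z). (rotation \<alpha> x, z * \<gamma> x))"

definition ergodic :: "'a measure \<Rightarrow> ('a \<Rightarrow> 'a) \<Rightarrow> bool" where
  "ergodic M S \<longleftrightarrow>
     S \<in> measurable M M \<and> distr M M S = M \<and>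
     (\<forall>A\<in>sets M. S -` A \<inter> space M = A \<longrightarrow>
        emeasure M A = 0 \<or> emeasure M (space M - A) = 0)"

text \<open>
  Elements of \<open>L\<^sup>2\<close> are represented by functions; the sets below are closed under
  almost everywhere equality.
\<close>

definition L2_fun :: "'a measure \<Rightarrow> ('a \<Rightarrow> complex) set" where
  "L2_fun M = {f \<in> borel_measurable M. integrable M (\<lambda>w. (cmod (f w))\<^sup>2)}"

definition L2_inner :: "'a measure \<Rightarrow> ('a \<Rightarrow> complex) \<Rightarrow> ('a \<Rightarrow> complex) \<Rightarrow> complex" where
  "L2_inner M f g = (\<integral>w. f w * cnj (g w) \<partial>M)"

definition L2_orthocomplement ::
    "'a measure \<Rightarrow> ('a \<Rightarrow> complex) set \<Rightarrow> ('a \<Rightarrow> complex) set" where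
  "L2_orthocomplement M W = {f \<in> L2_fun M. \<forall>g\<in>W. L2_inner M f g = 0}"

definition first_variable_functions :: "(real \<times> complex \<Rightarrow> complex) set" where
  "first_variable_functions =
     {f \<in> L2_fun skew_space.
        \<exists>g \<in> borel_measurable torus. AE w in skew_space. f w = g (fst w)}"

definition koopman_unitary_on ::
    "'a measure \<Rightarrow> ('a \<Rightarrow> 'a) \<Rightarrow> ('a \<Rightarrow> complex) set \<Rightarrow> bool" where
  "koopman_unitary_on M S V \<longleftrightarrow>
     (\<forall>f\<in>V. f \<circ> S \<in> V) \<and>
     (\<forall>f\<in>V. \<forall>g\<in>V. L2_inner M (f \<circ> S) (g \<circ> S) = L2_inner M f g) \<and>
     (\<forall>f\<in>V. \<exists>g\<in>V. AE w in M. (g \<circ> S) w = f w)"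

definition mixing_on ::
    "'a measure \<Rightarrow> ('a \<Rightarrow> 'a) \<Rightarrow> ('a \<Rightarrow> complex) set \<Rightarrow> bool" where
  "mixing_on M S V \<longleftrightarrow>
     koopman_unitary_on M S V \<and>
     (\<forall>f\<in>V. (\<lambda>n. L2_inner M (f \<circ> (S ^^ n)) f) \<longlonglongrightarrow> 0)"

end

theory Submission
  imports Defs "HOL-Probability.Probability_Measure"
begin

text \<open>
  Write \<open>\<Phi>\<^sub>n\<close> for the iterated cocycle and \<open>p\<close> for the transfer map, so that
  \<open>p(x) \<Phi>\<^sub>n(x) p(x + n\<alpha>)\<^sup>* = diag(\<gamma>\<^sub>n, \<gamma>\<^sub>n\<^sup>-\<^sup>1)\<close>. Since \<open>\<Phi>\<^sub>n' = n (\<psi> + o(1)) \<Phi>\<^sub>n\<close>, a smooth expression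
  \<open>G(\<lambda>(x), \<Phi>\<^sub>n(x), \<rho>(x + n\<alpha>))\<close> has derivative \<open>n D\<^sub>2G(\<psi> \<Phi>\<^sub>n) + o(n)\<close> in \<open>x\<close>; integrating over the circle and
  dividing by \<open>n\<close> shows \<open>\<integral> D\<^sub>2G(\<psi> \<Phi>\<^sub>n) \<rightarrow> 0\<close>, first for smooth and then, by approximation, for bounded
  measurable \<open>\<lambda>\<close> and \<open>\<rho>\<close>. A first choice of \<open>G\<close> shows that \<open>q = p \<psi> p\<^sup>*\<close> is diagonal, hence
  \<open>|q\<^sub>1\<^sub>1| = d(\<phi>) \<noteq> 0\<close>; taking for \<open>G\<close> the \<open>m\<close>-th power of the upper left entry of \<open>p \<Phi>\<^sub>n p\<^sup>*\<close> then yields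
  \<open>\<integral> b(x) \<gamma>\<^sub>n(x)\<^sup>m a(x + n\<alpha>) dx \<rightarrow> 0\<close> for all \<open>m \<ge> 1\<close>. These integrals are the correlations of functions
  \<open>a(x) z\<^sup>k\<close> with \<open>k \<noteq> 0\<close>, which gives mixing. If \<open>A\<close> is invariant, then \<open>1\<^sub>A\<close> minus its fibre average is an
  invariant vector in the mixing part, so it vanishes, and the fibre average is constant because
  the rotation is ergodic.
\<close>

subsection \<open>Rotations of the circle\<close>

text \<open>The transfer map \<open>p\<close> is only measurable, so
  \<open>p \<Phi>\<^sub>n p\<^sup>*\<close> cannot be differentiated in \<open>x\<close>. Its two
  copies are therefore parameters of \<open>G\<close>: smooth periodic substitutes for them have
  derivatives bounded independently of \<open>n\<close> (the right one is merely evaluated at a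
  shifted point), whereas \<open>\<Phi>\<^sub>n\<close> contributes order \<open>n\<close>. After
  division by \<open>n\<close> only the middle slot survives, no derivative of the parameters is
  left in the statement, and \<open>p\<close> can be put back. The degree enters through a division:
  along the diagonal cocycle the derivative of the \<open>m\<close>-th power in direction
  \<open>\<psi> \<Phi>\<^sub>n\<close> is \<open>m q\<^sub>1\<^sub>1\<close> times that power, and
  the weight \<open>b / (m q\<^sub>1\<^sub>1)\<close> is bounded because the modulus of
  \<open>q\<^sub>1\<^sub>1\<close> is a nonzero constant. Negative fibre frequencies follow by
  complex conjugation. In the passage to mixing, approximants of a function orthogonal to the first
  variable need not be orthogonal themselves, so the two slots of a correlation are approximated one
  at a time.\<close>

lemma space_torus [simp]: "space torus = {0..<1}"
  by (simp add: torus_def space_restrict_space)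

lemma sets_torus: "sets torus = sets (restrict_space borel {0..<1})"
  unfolding torus_def by (rule sets_restrict_space_cong) simp

lemma prob_space_torus: "prob_space torus"
  by (rule prob_spaceI) (simp add: torus_def space_restrict_space emeasure_restrict_space)

lemma borel_imp_torus: "f \<in> borel_measurable borel \<Longrightarrow> f \<in> borel_measurable torus"
  by (simp add: torus_def measurable_restrict_space1)

lemma frac_measurable_torus [measurable]: "frac \<in> borel \<rightarrow>\<^sub>M torus"
proof -
  have "(frac :: real \<Rightarrow> real) \<in> borel_measurable borel" 
    unfolding frac_def by measurable
  then show ?thesis
    by (subst measurable_cong_sets[OF refl sets_torus])
       (auto intro!: measurable_restrict_space2 simp: frac_lt_1)
qed

lemma id_torus_measurable: "(\<lambda>x. x) \<in> torus \<rightarrow>\<^sub>M borel"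
  by (rule borel_imp_torus) simp

lemma rotation_measurable [measurable]: "rotation a \<in> torus \<rightarrow>\<^sub>M torus"
proof -
  have "(\<lambda>x. frac (x + a)) \<in> borel \<rightarrow>\<^sub>M torus" by measurable
  then have "(\<lambda>x. frac (x + a)) \<in> restrict_space borel {0..<1} \<rightarrow>\<^sub>M torus"
    by (rule measurable_restrict_space1)
  then show ?thesis
    unfolding rotation_def by (simp cong: measurable_cong_sets add: sets_torus)
qed

lemma rotation_in [simp]: "rotation a x \<in> {0..<1}" "0 \<le> rotation a x" "rotation a x < 1"
  by (auto simp: rotation_def frac_lt_1)

lemma frac_cong_int:
  fixes x y :: real
  assumes "x - y \<in> \<int>"
  shows "frac x = frac y"
proof -
  have "frac y - y \<in> \<int>" "0 \<le> frac y" "frac y < 1" by (simp_all add: frac_lt_1) (simp add: frac_def)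
  moreover have "(x - y) - (frac y - y) \<in> \<int>"
    using assms calculation(1) by (rule Ints_diff)
  ultimately show ?thesis by (subst frac_unique_iff) (auto simp del: frac_ge_0)
qed

lemma frac_add_frac: "frac (frac x + y) = frac (x + y)" for x y :: real
  by (rule frac_cong_int) (simp add: frac_def)

lemma rotation_rotation: "rotation a (rotation b x) = rotation (a + b) x"
  by (simp add: rotation_def frac_add_frac algebra_simps)

lemma rotation_0 [simp]: "x \<in> {0..<1} \<Longrightarrow> rotation 0 x = x"
  by (auto simp: rotation_def frac_eq)

text \<open>On the fundamental domain the rotation is an exchange of two intervals. This is the form
  in which its invariance reduces to translations of the line.\<close>

lemma rotation_eq:
  assumes "x \<in> {0..<1}"
  shows "rotation a x = (if x < 1 - frac a then x + frac a else x + frac a - 1)"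
proof -
  have "0 \<le> frac a" "frac a < 1" "a - frac a \<in> \<int>" "a + (1 - frac a) \<in> \<int>"
    by (simp_all add: frac_lt_1) (simp_all add: frac_def)
  then show ?thesis
    using assms unfolding rotation_def by (auto simp: frac_unique_iff algebra_simps)
qed

lemma nn_integral_torus:
  "(\<integral>\<^sup>+x. f x \<partial>torus) = (\<integral>\<^sup>+x. f x * indicator {0..<1} x \<partial>lborel)"
  unfolding torus_def by (rule nn_integral_restrict_space) simp

text \<open>The branches of the rotation carry \<open>{0..<1-c}\<close> onto \<open>{c..<1}\<close>
  and \<open>{1-c..<1}\<close> onto \<open>{0..<c}\<close>, each by a translation, and Lebesgue
  measure is translation invariant. The periodic extension \<open>g\<close> gives the translated
  integrands a meaning on the whole line.\<close>

lemma nn_integral_rotation: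
  assumes [measurable]: "f \<in> borel_measurable torus"
  shows "(\<integral>\<^sup>+x. f (rotation a x) \<partial>torus) = (\<integral>\<^sup>+x. f x \<partial>torus)"
proof -
  define c where "c = frac a"
  have c: "0 \<le> c" "c < 1" by (auto simp: c_def frac_lt_1)
  define g where "g = (\<lambda>x. f (frac x))"
  have [measurable]: "g \<in> borel_measurable borel"
    unfolding g_def by measurable
  have "(\<integral>\<^sup>+x. f (rotation a x) \<partial>torus)
      = (\<integral>\<^sup>+x. f (rotation a x) * indicator {0..<1} x \<partial>lborel)"
    by (rule nn_integral_torus)
  also have "\<dots> = (\<integral>\<^sup>+x. g (x + c) * indicator {0..<1-c} x + g (x + (c - 1)) * indicator {1-c..<1} x \<partial>lborel)"
    by (intro nn_integral_cong)
       (use c in \<open>auto simp: rotation_eq g_def c_def[symmetric] frac_eq indicator_def frac_unique_iff algebra_simps\<close>)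
  also have "\<dots> = (\<integral>\<^sup>+x. g (x + c) * indicator {0..<1-c} x \<partial>lborel)
      + (\<integral>\<^sup>+x. g (x + (c - 1)) * indicator {1-c..<1} x \<partial>lborel)"
    by (rule nn_integral_add) measurable
  also have "(\<integral>\<^sup>+x. g (x + c) * indicator {0..<1-c} x \<partial>lborel)
      = (\<integral>\<^sup>+x. g x * indicator {c..<1} x \<partial>lborel)"
    by (subst nn_integral_real_affine[where c=1 and t=c and f = "\<lambda>x. g x * indicator {c..<1} x"])
       (auto intro!: nn_integral_cong simp: indicator_def algebra_simps)
  also have "(\<integral>\<^sup>+x. g (x + (c-1)) * indicator {1-c..<1} x \<partial>lborel)
      = (\<integral>\<^sup>+x. g x * indicator {0..<c} x \<partial>lborel)"
    by (subst nn_integral_real_affine[where c=1 and t="c-1" and f = "\<lambda>x. g x * indicator {0..<c} x"])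
       (auto intro!: nn_integral_cong simp: indicator_def algebra_simps)
  also have "(\<integral>\<^sup>+x. g x * indicator {c..<1} x \<partial>lborel) + (\<integral>\<^sup>+x. g x * indicator {0..<c} x \<partial>lborel)
     = (\<integral>\<^sup>+x. g x * indicator {c..<1} x + g x * indicator {0..<c} x \<partial>lborel)"
    by (rule nn_integral_add[symmetric]) measurable
  also have "\<dots> = (\<integral>\<^sup>+x. f x * indicator {0..<1} x \<partial>lborel)"
    by (intro nn_integral_cong) (use c in \<open>auto simp: g_def frac_eq indicator_def\<close>)
  finally show ?thesis by (simp add: nn_integral_torus)
qed

lemma distr_rotation: "distr torus torus (rotation a) = torus"
proof (rule measure_eqI)
  fix A assume "A \<in> sets (distr torus torus (rotation a))"
  then have [measurable]: "A \<in> sets torus" by simp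
  have "emeasure (distr torus torus (rotation a)) A = (\<integral>\<^sup>+x. indicator A x \<partial>distr torus torus (rotation a))"
    by simp
  also have "\<dots> = (\<integral>\<^sup>+x. indicator A (rotation a x) \<partial>torus)"
    by (subst nn_integral_distr) auto
  also have "\<dots> = emeasure torus A"
    by (subst nn_integral_rotation) auto
  finally show "emeasure (distr torus torus (rotation a)) A = emeasure torus A" .
qed simp

lemma AE_rotation:
  assumes "AE x in torus. P x"
  shows "AE x in torus. P (rotation a x)"
proof (rule AE_distrD[where P=P and M=torus])
  show "rotation a \<in> torus \<rightarrow>\<^sub>M torus" by measurable
  show "AE x in distr torus torus (rotation a). P x"
    by (subst distr_rotation) (rule assms)
qed

lemma integral_rotation:
  fixes f :: "real \<Rightarrow> 'b::{banach, second_countable_topology}"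
  assumes "f \<in> borel_measurable torus"
  shows "(\<integral>x. f (rotation a x) \<partial>torus) = (\<integral>x. f x \<partial>torus)"
  using integral_distr[of "rotation a" torus torus f] assms by (simp add: distr_rotation)

lemma integrable_torus_bounded:
  fixes f :: "real \<Rightarrow> 'b::{banach, second_countable_topology}"
  assumes "f \<in> borel_measurable torus" "\<And>x. x \<in> {0..<1} \<Longrightarrow> norm (f x) \<le> B"
  shows "integrable torus f"
proof -
  interpret prob_space torus by (rule prob_space_torus)
  show ?thesis by (rule integrable_const_bound[where B=B]) (use assms in auto)
qed

lemma integral_torus_bound:
  fixes f :: "real \<Rightarrow> 'b::{banach, second_countable_topology}"
  assumes "f \<in> borel_measurable torus" "\<And>x. x \<in> {0..<1} \<Longrightarrow> norm (f x) \<le> B"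
  shows "norm (\<integral>x. f x \<partial>torus) \<le> B"
proof -
  interpret prob_space torus by (rule prob_space_torus)
  have "norm (\<integral>x. f x \<partial>torus) \<le> (\<integral>x. norm (f x) \<partial>torus)"
    by (rule integral_norm_bound)
  also have "\<dots> \<le> (\<integral>x. B \<partial>torus)"
    by (rule integral_mono) (use assms in \<open>auto intro: integrable_torus_bounded[where B=B]\<close>)
  also have "\<dots> = B" using prob_space by simp
  finally show ?thesis .
qed

text \<open>The torus integral and the integral over the closed interval differ by a null set.
  \<open>F\<close> is not assumed periodic: in \<open>oscillation\<close> the boundary terms are
  only bounded independently of \<open>n\<close>, which suffices after division by
  \<open>n\<close>.\<close>

lemma integral_torus_FTC:
  fixes F :: "real \<Rightarrow> 'b::euclidean_space"
  assumes "\<And>x. (F has_vector_derivative f x) (at x)" "continuous_on UNIV f"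
  shows "(\<integral>x. f x \<partial>torus) = F 1 - F 0"
proof -
  have [measurable]: "f \<in> borel_measurable borel"
    using assms(2) by (rule borel_measurable_continuous_onI)
  have "(\<integral>x. f x \<partial>torus) = (\<integral>x. indicator {0..<1} x *\<^sub>R f x \<partial>lborel)"
    unfolding torus_def by (subst integral_restrict_space) auto
  also have "\<dots> = (\<integral>x. indicator {0..1} x *\<^sub>R f x \<partial>lborel)"
  proof (rule integral_cong_AE)
    have "AE x in lborel. x \<noteq> (1::real)" by (rule AE_lborel_singleton)
    then show "AE x in lborel. indicator {0..<1} x *\<^sub>R f x = indicator {0..1} x *\<^sub>R f x"
      by eventually_elim (auto simp: indicator_def)
  qed measurable
  also have "\<dots> = F 1 - F 0"
    by (rule integral_FTC_Icc)
       (use assms in \<open>auto intro: has_vector_derivative_at_within continuous_on_subset\<close>)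
  finally show ?thesis .
qed

subsection \<open>Smooth approximation\<close>

text \<open>Regularity of finite Borel measures squeezes \<open>A\<close> between a compact
  \<open>K\<close> and an open \<open>U\<close> with \<open>U - K\<close> of measure below
  \<open>e\<close>; a Urysohn function for this pair differs from the indicator only on
  \<open>U - K\<close>.\<close>

lemma continuous_dense_indicator:
  fixes N :: "'a::euclidean_space measure"
  assumes fin: "finite_measure N" and sets [simp]: "sets N = sets borel" and A: "A \<in> sets borel" and e: "0 < e"
  obtains g :: "'a \<Rightarrow> real" where "continuous_on UNIV g" "\<And>x. 0 \<le> g x \<and> g x \<le> 1"
    "(\<integral>x. \<bar>g x - indicator A x\<bar> \<partial>N) < e"
proof -
  interpret finite_measure N by fact
  have [simp]: "space N = UNIV" using sets_eq_imp_space_eq[OF sets] by simp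
  note [measurable_cong] = sets
  have [measurable]: "A \<in> sets N" using A by simp
  obtain K where K: "K \<subseteq> A" "compact K" "measure N A < measure N K + e/2"
  \<comment> \<open>For a small set the empty compact set serves. Otherwise
    \<open>measure N A - e/2\<close> is nonnegative, so its conversion to \<open>ennreal\<close> is
    faithful.\<close>
  proof (cases "measure N A < e/2")
    case True
    then show ?thesis using that[of "{}"] by simp
  next
    case False
    have "emeasure N A = (SUP K \<in> {K. K \<subseteq> A \<and> compact K}. emeasure N K)"
      by (rule inner_regular) (use A in auto)
    moreover have "ennreal (measure N A - e/2) < emeasure N A"
      using e False by (simp add: emeasure_eq_measure ennreal_less_iff)
    ultimately obtain K where "K \<subseteq> A" "compact K" "ennreal (measure N A - e/2) < emeasure N K"
      by (auto simp: less_SUP_iff)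
    then show ?thesis
      using False that[of K] by (simp add: emeasure_eq_measure ennreal_less_iff)
  qed
  obtain U where U: "A \<subseteq> U" "open U" "measure N U < measure N A + e/2"
  proof -
    have "emeasure N A = (INF U \<in> {U. A \<subseteq> U \<and> open U}. emeasure N U)"
      by (rule outer_regular) (use A in auto)
    moreover have "emeasure N A < ennreal (measure N A + e/2)"
      using e by (simp add: emeasure_eq_measure ennreal_less_iff)
    ultimately obtain U where "A \<subseteq> U" "open U" "emeasure N U < ennreal (measure N A + e/2)"
      by (auto simp: INF_less_iff)
    then show ?thesis
      using that[of U] by (simp add: emeasure_eq_measure ennreal_less_iff)
  qed
  have "closed K" "closed (-U)" "K \<inter> (-U) = {}" using K U by (auto simp: compact_imp_closed)
  then obtain g :: "'a \<Rightarrow> real" where g: "continuous_on UNIV g" "\<And>x. g x \<in> closed_segment 1 0"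
      "\<And>x. x \<in> K \<Longrightarrow> g x = 1" "\<And>x. x \<in> -U \<Longrightarrow> g x = 0"
    by (rule Urysohn[of K "-U" 1 0]) auto
  have g01: "0 \<le> g x \<and> g x \<le> 1" for x
    using g(2)[of x] by (auto simp: closed_segment_eq_real_ivl)
  have [measurable]: "g \<in> borel_measurable borel"
    using g(1) by (rule borel_measurable_continuous_onI)
  have [measurable]: "K \<in> sets N" "U \<in> sets N" using K U by (auto simp: compact_imp_closed)
  have "(\<integral>x. \<bar>g x - indicator A x\<bar> \<partial>N) \<le> (\<integral>x. indicator (U - K) x \<partial>N)"
  proof (rule integral_mono)
    show "integrable N (\<lambda>x. \<bar>g x - indicator A x\<bar>)"
    proof (rule integrable_const_bound[where B=1])
      show "AE x in N. norm \<bar>g x - indicator A x\<bar> \<le> 1"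
      proof (rule AE_I2)
        fix x
        show "norm \<bar>g x - indicator A x\<bar> \<le> 1"
          using g01[of x] by (cases "x \<in> A") auto
      qed
    qed simp
    show "\<bar>g x - indicator A x\<bar> \<le> indicator (U - K) x" for x
      using g01[of x] g(3)[of x] g(4)[of x] K(1) U(1) by (auto simp: indicator_def abs_if)
    show "integrable N (indicat_real (U - K))"
      by (intro integrable_real_indicator) (use K U in \<open>auto simp: emeasure_eq_measure compact_imp_closed intro!: sets.Diff\<close>)
  qed
  also have "\<dots> = measure N (U - K)" by simp
  also have "\<dots> = measure N U - measure N K"
    by (rule finite_measure_Diff) (use K U in \<open>auto simp: compact_imp_closed\<close>)
  also have "\<dots> < e" using K U by simp
  finally show ?thesis using that g(1) g01 by blast
qed

lemma continuous_dense_L1: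
  fixes N :: "'a::euclidean_space measure" and f :: "'a \<Rightarrow> 'b::euclidean_space"
  assumes fin: "finite_measure N" and sets [simp]: "sets N = sets borel" and f: "integrable N f" and e: "0 < e"
  shows "\<exists>g. continuous_on UNIV g \<and> integrable N g \<and> (\<integral>x. norm (g x - f x) \<partial>N) < e"
  using f e
proof (induction arbitrary: e rule: integrable_induct)
  case (base A c)
  interpret finite_measure N by fact
  have A: "A \<in> sets borel" using base by simp
  \<comment> \<open>The summand 1 covers \<open>c = 0\<close>.\<close>
  have "0 < e / (norm c + 1)" using base by (simp add: add_nonneg_pos)
  from continuous_dense_indicator[OF fin sets A this]
  obtain g :: "'a \<Rightarrow> real" where g: "continuous_on UNIV g" "\<And>x. 0 \<le> g x \<and> g x \<le> 1"
    "(\<integral>x. \<bar>g x - indicator A x\<bar> \<partial>N) < e / (norm c + 1)" by metis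
  have [measurable]: "g \<in> borel_measurable N" 
    using borel_measurable_continuous_onI[OF g(1)] by (simp cong: measurable_cong_sets)
  have "integrable N g"
    by (rule integrable_const_bound[where B=1]) (use g(2) in auto)
  moreover have "(\<integral>x. norm (g x *\<^sub>R c - indicat_real A x *\<^sub>R c) \<partial>N) = (\<integral>x. \<bar>g x - indicator A x\<bar> * norm c \<partial>N)"
    by (simp flip: scaleR_diff_left)
  moreover have "\<dots> = (\<integral>x. \<bar>g x - indicator A x\<bar> \<partial>N) * norm c" by simp
  moreover have "\<dots> \<le> (\<integral>x. \<bar>g x - indicator A x\<bar> \<partial>N) * (norm c + 1)"
    by (rule mult_left_mono) auto
  moreover have "\<dots> < e" using g(3) by (simp add: pos_less_divide_eq add_nonneg_pos)
  ultimately show ?case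
    by (intro exI[of _ "\<lambda>x. g x *\<^sub>R c"]) (auto intro!: continuous_intros g(1))
next
  case (add f g)
  from add(3)[of "e/2"] add(4)[of "e/2"] add(5)
  obtain f' g' where f': "continuous_on UNIV f'" "integrable N f'" "(\<integral>x. norm (f' x - f x) \<partial>N) < e/2"
    and g': "continuous_on UNIV g'" "integrable N g'" "(\<integral>x. norm (g' x - g x) \<partial>N) < e/2"
    by auto
  have "(\<integral>x. norm ((f' x + g' x) - (f x + g x)) \<partial>N) \<le> (\<integral>x. norm (f' x - f x) + norm (g' x - g x) \<partial>N)"
    by (rule integral_mono) (use add f' g' in \<open>auto intro!: norm_diff_triangle_ineq\<close>)
  also have "\<dots> = (\<integral>x. norm (f' x - f x) \<partial>N) + (\<integral>x. norm (g' x - g x) \<partial>N)"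
    by (rule Bochner_Integration.integral_add) (use add f' g' in auto)
  also have "\<dots> < e" using f'(3) g'(3) by simp
  finally show ?case using f' g' by (intro exI[of _ "\<lambda>x. f' x + g' x"]) (auto intro!: continuous_intros)
next
  case (lim f s)
  have [measurable]: "f \<in> borel_measurable N" "\<And>i. s i \<in> borel_measurable N"
    using lim by auto
  have "(\<lambda>i. \<integral>x. norm (s i x - f x) \<partial>N) \<longlonglongrightarrow> (\<integral>x. 0 \<partial>N)"
  \<comment> \<open>The induction rule supplies simple functions with \<open>norm (s i x)\<close> at
    most \<open>2 * norm (f x)\<close>, whence the factor 3 for the difference.\<close>
  proof (rule integral_dominated_convergence[where w="\<lambda>x. 3 * norm (f x)"])
    show "AE x in N. (\<lambda>i. norm (s i x - f x)) \<longlonglongrightarrow> 0"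
    proof (rule AE_I2)
      fix x assume "x \<in> space N"
      then have "(\<lambda>i. s i x) \<longlonglongrightarrow> f x" using lim by auto
      then show "(\<lambda>i. norm (s i x - f x)) \<longlonglongrightarrow> 0"
        by (simp add: LIM_zero tendsto_norm_zero)
    qed
    show "AE x in N. norm (norm (s i x - f x)) \<le> 3 * norm (f x)" for i
    proof (rule AE_I2)
      fix x assume "x \<in> space N"
      then have "norm (s i x) \<le> 2 * norm (f x)" using lim by auto
      then show "norm (norm (s i x - f x)) \<le> 3 * norm (f x)"
        using norm_triangle_ineq4[of "s i x" "f x"] by simp
    qed
  qed (use lim in auto)
  then have "\<forall>\<^sub>F i in sequentially. (\<integral>x. norm (s i x - f x) \<partial>N) < e/2"
    using lim(6) by (intro order_tendstoD) auto
  then obtain i where i: "(\<integral>x. norm (s i x - f x) \<partial>N) < e/2" 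
    by (auto simp: eventually_sequentially)
  obtain g where g: "continuous_on UNIV g" "integrable N g" "(\<integral>x. norm (g x - s i x) \<partial>N) < e/2"
    using lim.IH[of "e/2"] lim.prems by auto
  have "(\<integral>x. norm (g x - f x) \<partial>N) \<le> (\<integral>x. norm (g x - s i x) + norm (s i x - f x) \<partial>N)"
    by (rule integral_mono) (use lim g in \<open>auto intro!: norm_diff_triangle_le\<close>)
  also have "\<dots> = (\<integral>x. norm (g x - s i x) \<partial>N) + (\<integral>x. norm (s i x - f x) \<partial>N)"
    by (rule Bochner_Integration.integral_add) (use lim g in auto)
  also have "\<dots> < e" using g i by simp
  finally show ?case using g by auto
qed

text \<open>Working under the law of \<open>X\<close> reduces the claim to density of continuous
  functions and Stone-Weierstrass on \<open>S\<close>. The point of the statement is the uniform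
  bound \<open>K + 1\<close>, which does not depend on \<open>e\<close>: later constants are fixed
  from this bound before the accuracy is chosen.\<close>

lemma polynomial_dense_L1:
  fixes M :: "'c measure" and X :: "'c \<Rightarrow> 'a::euclidean_space" and f :: "'a \<Rightarrow> 'b::euclidean_space"
  assumes fin: "finite_measure M" and X[measurable]: "X \<in> borel_measurable M"
    and S: "compact S" "\<And>w. w \<in> space M \<Longrightarrow> X w \<in> S"
    and f[measurable]: "f \<in> borel_measurable borel" and K: "\<And>x. norm (f x) \<le> K" and e: "0 < e"
  obtains P where "polynomial_function P" "\<And>x. x \<in> S \<Longrightarrow> norm (P x) \<le> K + 1"
    "(\<integral>w. norm (P (X w) - f (X w)) \<partial>M) < e"
proof -
  interpret M: finite_measure M by fact
  define N where "N = distr M borel X"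
  have finN: "finite_measure N" unfolding N_def by (rule M.finite_measure_distr) simp
  interpret N: finite_measure N by fact
  have [simp, measurable_cong]: "sets N = sets borel" by (simp add: N_def)
  have K0: "0 \<le> K" using K[of 0] norm_ge_zero order_trans by blast
  have intf: "integrable N f" by (rule N.integrable_const_bound[where B=K]) (use K in auto)
  obtain g where g: "continuous_on UNIV g" "integrable N g" "(\<integral>x. norm (g x - f x) \<partial>N) < e/2"
    using continuous_dense_L1[OF finN _ intf, of "e/2"] e by auto
  \<comment> \<open>The nearest-point projection onto the ball of radius \<open>K\<close> is
    1-Lipschitz and fixes the values of \<open>f\<close>, so this truncation does not increase the
    error.\<close>
  define h where "h = (\<lambda>x. closest_point (cball 0 K) (g x))"
  have h: "continuous_on UNIV h" unfolding h_def
    by (rule continuous_on_compose2[OF continuous_on_closest_point g(1)]) (use K0 in auto)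
  have hK: "norm (h x) \<le> K" for x
    using closest_point_in_set[of "cball 0 K" "g x"] K0 by (auto simp: h_def)
  have hf: "norm (h x - f x) \<le> norm (g x - f x)" for x
  proof -
    have "closest_point (cball 0 K) (f x) = f x" by (rule closest_point_self) (use K in auto)
    then show ?thesis
      using closest_point_lipschitz[of "cball 0 K" "g x" "f x"] K0 by (auto simp: h_def dist_norm)
  qed
  \<comment> \<open>The bound 1 yields the sup bound \<open>K + 1\<close>; the other term keeps the
    uniform error, integrated over \<open>M\<close>, below \<open>e/2\<close>.\<close>
  define d where "d = min 1 (e / (2 * (measure M (space M) + 1)))"
  have m0: "0 < measure M (space M) + 1" by (simp add: add_nonneg_pos)
  have d: "0 < d" "d \<le> 1" "d * measure M (space M) < e/2"
  proof -
    show "0 < d" "d \<le> 1" using e m0 by (auto simp: d_def)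
    have "d * measure M (space M) < d * (measure M (space M) + 1)" using \<open>0 < d\<close> by simp
    also have "\<dots> \<le> e / (2 * (measure M (space M) + 1)) * (measure M (space M) + 1)"
      by (rule mult_right_mono) (use m0 in \<open>auto simp: d_def\<close>)
    also have "\<dots> = e/2" using m0 by (simp add: divide_simps)
    finally show "d * measure M (space M) < e/2" .
  qed
  obtain P where P: "polynomial_function P" "\<And>x. x \<in> S \<Longrightarrow> norm (h x - P x) < d"
    using Stone_Weierstrass_polynomial_function[OF S(1) continuous_on_subset[OF h] d(1)] by auto
  have PK: "norm (P x) \<le> K + 1" if "x \<in> S" for x
    using P(2)[OF that] hK[of x] d(2) norm_triangle_ineq3[of "P x" "h x"] norm_minus_commute[of "P x" "h x"] by linarith
  have [measurable]: "P \<in> borel_measurable borel" "h \<in> borel_measurable borel" "g \<in> borel_measurable borel"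
    using P(1) h g(1) by (auto intro!: borel_measurable_continuous_onI continuous_on_polymonial_function)
  have "(\<integral>w. norm (P (X w) - f (X w)) \<partial>M) \<le> (\<integral>w. d + norm (g (X w) - f (X w)) \<partial>M)"
  proof (rule integral_mono)
    show "integrable M (\<lambda>w. norm (P (X w) - f (X w)))"
    proof (rule M.integrable_const_bound[where B="K + 1 + K"], rule AE_I2)
      fix w assume "w \<in> space M"
      then show "norm (norm (P (X w) - f (X w))) \<le> K + 1 + K"
        using PK[OF S(2)] K[of "X w"] norm_triangle_ineq4[of "P (X w)" "f (X w)"] by fastforce
    qed simp
    have "integrable N (\<lambda>x. norm (g x - f x))" using g(2) intf by auto
    then show "integrable M (\<lambda>w. d + norm (g (X w) - f (X w)))"
      by (subst (asm) N_def, subst (asm) integrable_distr_eq) auto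
    fix w assume "w \<in> space M"
    then have "norm (P (X w) - h (X w)) < d" using P S by (auto simp: norm_minus_commute)
    then show "norm (P (X w) - f (X w)) \<le> d + norm (g (X w) - f (X w))"
      using hf[of "X w"] norm_diff_triangle_ineq[of "P (X w)" "h (X w)" "h (X w)" "f (X w)"]
      by (simp add: norm_diff_triangle_le)
  qed
  also have "\<dots> = d * measure M (space M) + (\<integral>w. norm (g (X w) - f (X w)) \<partial>M)"
  proof (subst Bochner_Integration.integral_add)
    have "integrable N (\<lambda>x. norm (g x - f x))" using g(2) intf by auto
    then show "integrable M (\<lambda>w. norm (g (X w) - f (X w)))"
      by (subst (asm) N_def, subst (asm) integrable_distr_eq) auto
  qed auto
  also have "(\<integral>w. norm (g (X w) - f (X w)) \<partial>M) = (\<integral>x. norm (g x - f x) \<partial>N)"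
    unfolding N_def by (subst integral_distr) auto
  also have "d * measure M (space M) + \<dots> < e" using d g by simp
  finally show ?thesis using that P PK by blast
qed

text \<open>Restricted to the circle, polynomials become trigonometric polynomials of the angle.
  Boundedness of the derivative is carried along because it will be evaluated at the points
  \<open>x + n * \<alpha>\<close> for all \<open>n\<close> at once.\<close>

lemma real_polynomial_cis:
  assumes "real_polynomial_function (h :: complex \<Rightarrow> real)"
  shows "\<exists>v'. (\<forall>x. ((\<lambda>x. h (cis (2 * pi * x))) has_vector_derivative v' x) (at x)) \<and>
      continuous_on UNIV v' \<and> bounded (range v')"
  using assms
proof induction
  case (linear h)
  let ?v = "\<lambda>x. h (2 * pi * \<i> * cis (2 * pi * x))"
  have "((\<lambda>x. h (cis (2 * pi * x))) has_vector_derivative ?v x) (at x)" for x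
  proof (rule bounded_linear.has_vector_derivative[OF linear])
    show "((\<lambda>x. cis (2 * pi * x)) has_vector_derivative 2 * pi * \<i> * cis (2 * pi * x)) (at x)"
      unfolding cis_conv_exp
      by (auto intro!: derivative_eq_intros has_vector_derivative_real_field)
  qed
  moreover have "continuous_on UNIV ?v"
    by (intro bounded_linear.continuous_on[OF linear] continuous_intros)
  moreover have "bounded (range ?v)"
  proof -
    have "range ?v = h ` (range (\<lambda>x. 2 * pi * \<i> * cis (2 * pi * x)))" by auto
    moreover have "bounded (range (\<lambda>x. 2 * pi * \<i> * cis (2 * pi * x)))"
      by (rule boundedI[where B="2*pi"]) (auto simp: norm_mult)
    ultimately show ?thesis using bounded_linear_image linear by metis
  qed
  ultimately show ?case by (intro exI[of _ ?v]) auto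
next
  case (const c)
  show ?case by (intro exI[of _ "\<lambda>x. 0"]) auto
next
  case (add f g)
  then obtain f' g' where fg: "\<And>x. ((\<lambda>x. f (cis (2 * pi * x))) has_vector_derivative f' x) (at x)"
    "continuous_on UNIV f'" "bounded (range f')" "\<And>x. ((\<lambda>x. g (cis (2 * pi * x))) has_vector_derivative g' x) (at x)"
    "continuous_on UNIV g'" "bounded (range g')" by auto
  then have "bounded (range (\<lambda>x. f' x + g' x))"
    by (intro bounded_plus_comp)
  with fg show ?case
    by (intro exI[of _ "\<lambda>x. f' x + g' x"]) (auto intro!: derivative_intros continuous_intros)
next
  case (mult f g)
  then obtain f' g' where fg: "\<And>x. ((\<lambda>x. f (cis (2 * pi * x))) has_vector_derivative f' x) (at x)"
    "continuous_on UNIV f'" "bounded (range f')" "\<And>x. ((\<lambda>x. g (cis (2 * pi * x))) has_vector_derivative g' x) (at x)"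
    "continuous_on UNIV g'" "bounded (range g')" by auto
  \<comment> \<open>The product rule involves the factors themselves; they are bounded because the
    circle is compact.\<close>
  have bd: "bounded (range (\<lambda>x. h (cis (2 * pi * x))))" if "real_polynomial_function h" for h :: "complex \<Rightarrow> real"
  proof (rule bounded_subset)
    show "bounded (h ` sphere 0 1)"
      using that by (intro compact_imp_bounded compact_continuous_image continuous_on_polymonial_function)
        (auto simp: real_polynomial_function_eq)
  qed auto
  have cont: "continuous_on UNIV (\<lambda>x. h (cis (2 * pi * x)))" if "real_polynomial_function h" for h :: "complex \<Rightarrow> real"
    by (rule continuous_on_compose2[OF continuous_on_polymonial_function[of h UNIV]])
       (use that in \<open>auto simp: real_polynomial_function_eq intro!: continuous_intros\<close>)
  have bm: "bounded (range (\<lambda>x. a x * b x))" if ab: "bounded (range a)" "bounded (range b)" for a b :: "real \<Rightarrow> real"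
  proof -
    obtain A B where "\<And>x. norm (a x) \<le> A" "\<And>x. norm (b x) \<le> B"
      using ab unfolding bounded_iff by auto
    then have "norm (a x * b x) \<le> A * B" for x
      unfolding norm_mult by (meson mult_mono norm_ge_zero order_trans)
    then show ?thesis by (intro boundedI[where B="A * B"]) auto
  qed
  let ?d = "\<lambda>x. f (cis (2 * pi * x)) * g' x + f' x * g (cis (2 * pi * x))"
  have "bounded (range ?d)"
    using fg bd mult by (intro bounded_plus_comp bm) auto
  moreover have "continuous_on UNIV ?d"
    using fg cont mult by (intro continuous_intros) auto
  moreover have "\<forall>x. ((\<lambda>x. f (cis (2 * pi * x)) * g (cis (2 * pi * x))) has_vector_derivative ?d x) (at x)"
    using fg has_vector_derivative_mult by blast
  ultimately show ?case by (intro exI[of _ ?d]) auto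
qed

lemma polynomial_cis:
  fixes P :: "complex \<Rightarrow> 'b::euclidean_space"
  assumes "polynomial_function P"
  obtains v' where "\<And>x. ((\<lambda>x. P (cis (2 * pi * x))) has_vector_derivative v' x) (at x)"
    "continuous_on UNIV v'" "bounded (range v')"
proof -
  have "real_polynomial_function (\<lambda>z. P z \<bullet> b)" for b
    using assms unfolding polynomial_function_def o_def
    by (auto intro: bounded_linear_inner_left)
  from real_polynomial_cis[OF this]
  obtain d where d: "\<And>b x. ((\<lambda>x. P (cis (2 * pi * x)) \<bullet> b) has_vector_derivative d b x) (at x)"
    "\<And>b. continuous_on UNIV (d b)" "\<And>b. bounded (range (d b))" by metis
  let ?v = "\<lambda>x. \<Sum>b\<in>Basis. d b x *\<^sub>R b"
  have "((\<lambda>x. \<Sum>b\<in>Basis. (P (cis (2 * pi * x)) \<bullet> b) *\<^sub>R b) has_vector_derivative ?v x) (at x)" for x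
    by (intro has_vector_derivative_sum bounded_linear.has_vector_derivative[OF bounded_linear_scaleR_left] d)
  moreover have "continuous_on UNIV ?v" by (intro continuous_intros d)
  moreover have "bounded (range ?v)"
  proof -
    obtain B where B: "\<And>b x. norm (d b x) \<le> B b"
      using d(3) unfolding bounded_iff by (metis rangeI)
    show ?thesis
      by (rule boundedI[where B="\<Sum>b\<in>Basis. B b"])
         (use B in \<open>auto intro!: sum_norm_le\<close>)
  qed
  ultimately show ?thesis
    by (intro that[of ?v]) (simp_all only: euclidean_representation)
qed

text \<open>A Borel left inverse of the parametrization, total on the plane: it turns a function on
  the fundamental domain into a Borel function of a complex variable, to which polynomial
  approximation applies.\<close>

lemma borel_circle_coordinate:
  obtains t :: "complex \<Rightarrow> real" where "t \<in> borel_measurable borel" "\<And>z. t z \<in> {0..<1}"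
    "\<And>x. x \<in> {0..<1} \<Longrightarrow> t (cis (2 * pi * x)) = x"
proof -
  \<comment> \<open>Clamping the real part makes the arc cosine continuous on the whole plane. The
    later \<open>frac\<close> returns the value 1, which can occur off the circle in the lower half
    plane, to \<open>{0..<1}\<close>.\<close>
  define r where "r z = arccos (max (-1) (min 1 (Re z))) / (2 * pi)" for z
  have "continuous_on UNIV r" unfolding r_def 
    by (intro continuous_intros) (auto simp: max_def min_def)
  then have r[measurable]: "r \<in> borel_measurable borel" by (rule borel_measurable_continuous_onI)
  define t where "t z = frac (if Im z \<ge> 0 then r z else 1 - r z)" for z
  have "t \<in> borel_measurable borel" unfolding t_def frac_def by measurable
  moreover have "t z \<in> {0..<1}" for z by (simp add: t_def frac_lt_1)
  moreover have "t (cis (2 * pi * x)) = x" if x: "x \<in> {0..<1}" for x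
  proof (cases "x \<le> 1/2")
    case True
    then have "0 \<le> sin (2 * pi * x)" using x by (intro sin_ge_zero) auto
    moreover have "arccos (cos (2 * pi * x)) = 2 * pi * x" using x True by (intro arccos_cos) auto
    ultimately show ?thesis using x by (simp add: t_def r_def frac_eq)
  next
    case False
    have "sin (2 * pi * x) = - sin (2 * pi * (1 - x))" 
      by (simp add: algebra_simps sin_diff)
    moreover have "0 < sin (2 * pi * (1 - x))" using x False by (intro sin_gt_zero) auto
    moreover have "cos (2 * pi * x) = cos (2 * pi * (1 - x))" 
      by (simp add: algebra_simps cos_diff)
    moreover have "arccos (cos (2 * pi * (1 - x))) = 2 * pi * (1 - x)" using x False by (intro arccos_cos) auto
    ultimately show ?thesis using x by (simp add: t_def r_def frac_eq)
  qed
  ultimately show ?thesis by (rule that)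
qed

text \<open>Approximating on the circle rather than on the interval makes the approximant periodic:
  it is a polynomial composed with \<open>cis (2 * pi * x)\<close>. Periodicity allows
  \<open>v\<close> at \<open>x + n * \<alpha>\<close> to be read as \<open>v\<close> at the rotated
  point.\<close>

lemma smooth_approx_torus:
  fixes u :: "real \<Rightarrow> 'b::euclidean_space"
  assumes u: "u \<in> borel_measurable torus" "\<And>x. x \<in> {0..<1} \<Longrightarrow> norm (u x) \<le> K" and e: "0 < e"
  obtains v v' where "\<And>x. (v has_vector_derivative v' x) (at x)" "continuous_on UNIV v'" "bounded (range v')"
    "\<And>x. v (frac x) = v x" "\<And>x. norm (v x) \<le> K + 1" "(\<integral>x. norm (v x - u x) \<partial>torus) < e"
proof -
  interpret prob_space torus by (rule prob_space_torus)
  obtain t where t: "t \<in> borel_measurable borel" "\<And>z. t z \<in> {0..<1}"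
    "\<And>x. x \<in> {0..<1} \<Longrightarrow> t (cis (2 * pi * x)) = x"
    using borel_circle_coordinate by metis
  have "t \<in> borel \<rightarrow>\<^sub>M torus"
    using t by (subst measurable_cong_sets[OF refl sets_torus]) (auto intro!: measurable_restrict_space2)
  with u have f: "(\<lambda>z. u (t z)) \<in> borel_measurable borel" by measurable
  have X: "(\<lambda>x. cis (2 * pi * x)) \<in> borel_measurable torus"
    by (intro borel_imp_torus borel_measurable_continuous_onI continuous_intros)
  obtain P where P: "polynomial_function P" "\<And>z. z \<in> sphere 0 1 \<Longrightarrow> norm (P z) \<le> K + 1"
     "(\<integral>x. norm (P (cis (2 * pi * x)) - u (t (cis (2 * pi * x)))) \<partial>torus) < e"
    using polynomial_dense_L1[OF finite_measure_axioms X, of "sphere 0 1" "\<lambda>z. u (t z)" K e] f u t e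
    by auto
  obtain v' where v': "\<And>x. ((\<lambda>x. P (cis (2 * pi * x))) has_vector_derivative v' x) (at x)"
    "continuous_on UNIV v'" "bounded (range v')" using polynomial_cis[OF P(1)] by blast
  have "cis (2 * pi * frac x) = cis (2 * pi * x)" for x
  proof -
    have "cis (2 * pi * x) = cis (2 * pi * frac x) * cis (2 * pi * of_int \<lfloor>x\<rfloor>)"
      by (simp add: cis_mult frac_def algebra_simps)
    also have "cis (2 * pi * of_int \<lfloor>x\<rfloor>) = 1" by (rule cis_multiple_2pi) auto
    finally show ?thesis by simp
  qed
  moreover have "(\<integral>x. norm (P (cis (2 * pi * x)) - u (t (cis (2 * pi * x)))) \<partial>torus)
     = (\<integral>x. norm (P (cis (2 * pi * x)) - u x) \<partial>torus)"
    by (rule Bochner_Integration.integral_cong) (use t in auto)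
  ultimately show ?thesis
    using that[OF v'] P by auto
qed

subsection \<open>The oscillation principle\<close>

text \<open>Uniform continuity in a form that can be integrated: \<open>L1\<close>-closeness of the
  arguments then gives closeness of the integrals of \<open>k\<close>. When the arguments are at
  least \<open>d\<close> apart, the trivial bound \<open>2 * B\<close> is absorbed by the linear
  term.\<close>

lemma continuous_modulus:
  fixes k :: "'a::euclidean_space \<Rightarrow> 'b::real_normed_vector"
  assumes k: "continuous_on UNIV k" and e: "0 < e"
  obtains C where "0 \<le> C" "\<And>x y. norm x \<le> L \<Longrightarrow> norm y \<le> L \<Longrightarrow> norm (k x - k y) \<le> e + C * norm (x - y)"
proof -
  have "compact (cball (0::'a) L)" by simp
  moreover have kc: "continuous_on (cball 0 L) k" using k continuous_on_subset by blast
  ultimately have "uniformly_continuous_on (cball 0 L) k" by (intro compact_uniformly_continuous)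
  then obtain d where d: "0 < d" "\<And>x y. norm x \<le> L \<Longrightarrow> norm y \<le> L \<Longrightarrow> dist y x < d \<Longrightarrow> dist (k y) (k x) < e"
    unfolding uniformly_continuous_on_def using e by (metis mem_cball_0)
  have "bounded (k ` cball 0 L)" using kc by (intro compact_imp_bounded compact_continuous_image) auto
  then obtain B where B: "0 < B" "\<And>x. norm x \<le> L \<Longrightarrow> norm (k x) \<le> B"
    unfolding bounded_pos by (metis imageI mem_cball_0)
  show ?thesis
  proof (rule that[of "2 * B / d"])
    show "0 \<le> 2 * B / d" using B d by simp
    fix x y :: 'a assume xy: "norm x \<le> L" "norm y \<le> L"
    show "norm (k x - k y) \<le> e + 2 * B / d * norm (x - y)"
    proof (cases "norm (x - y) < d")
      case True
      then have "norm (k x - k y) < e" using d xy by (simp add: dist_norm)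
      moreover have "0 \<le> 2 * B / d * norm (x - y)" using B d by simp
      ultimately show ?thesis by linarith
    next
      case False
      have "norm (k x - k y) \<le> 2 * B" using norm_triangle_ineq4[of "k x" "k y"] B(2)[OF xy(1)] B(2)[OF xy(2)] by linarith
      also have "\<dots> \<le> 2 * B / d * norm (x - y)" using False B d by (simp add: field_simps)
      finally show ?thesis using e by simp
    qed
  qed
qed


text \<open>\<open>Y n\<close> approximates the normalized derivative of \<open>\<Phi> n\<close>;
  neither sequence has to converge, only their difference tends to 0. The order of choices is
  essential: \<open>L\<close> depends on \<open>B\<close> alone, \<open>C\<close> on
  \<open>L\<close> and \<open>e\<close>, the accuracy \<open>e'\<close> on \<open>C\<close>, and
  only then come the smooth \<open>l\<close> and \<open>r\<close>. Their derivatives may be huge,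
  but the resulting constants do not depend on \<open>n\<close>.\<close>

lemma oscillation:
  fixes \<Phi> \<Phi>' Y :: "nat \<Rightarrow> real \<Rightarrow> 'm::euclidean_space" and \<alpha> B :: real
    and u :: "real \<Rightarrow> 'e::euclidean_space" and \<rho> :: "real \<Rightarrow> 'f::euclidean_space"
    and G :: "'e \<times> 'm \<times> 'f \<Rightarrow> complex"
  assumes \<Phi>: "\<And>n x. (\<Phi> n has_vector_derivative \<Phi>' n x) (at x)" "\<And>n. continuous_on UNIV (\<Phi>' n)"
      "\<And>n x. norm (\<Phi> n x) \<le> B" "\<And>n x. norm (\<Phi>' n x) \<le> real n * B"
    and Y[measurable]: "\<And>n. Y n \<in> borel_measurable torus"
    and YB: "\<And>n x. x \<in> {0..<1} \<Longrightarrow> norm (Y n x) \<le> B"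
    and lim: "AE x in torus. (\<lambda>n. (1 / real n) *\<^sub>R \<Phi>' n x - Y n x) \<longlonglongrightarrow> 0"
    and u[measurable]: "u \<in> borel_measurable torus" and uB: "\<And>x. x \<in> {0..<1} \<Longrightarrow> norm (u x) \<le> B"
    and \<rho>[measurable]: "\<rho> \<in> borel_measurable torus" and \<rho>B: "\<And>x. x \<in> {0..<1} \<Longrightarrow> norm (\<rho> x) \<le> B"
    and G: "\<And>\<xi>. (G has_derivative G' \<xi>) (at \<xi>)" "continuous_on UNIV (\<lambda>(\<xi>, \<eta>). G' \<xi> \<eta>)"
  shows "(\<lambda>n. \<integral>x. G' (u x, \<Phi> n x, \<rho> (rotation (real n * \<alpha>) x)) (0, Y n x, 0) \<partial>torus) \<longlonglongrightarrow> 0"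
    (is "(\<lambda>n. \<integral>x. ?T n x \<partial>torus) \<longlonglongrightarrow> 0")
proof -
  interpret prob_space torus by (rule prob_space_torus)
  define H where "H n x = (1 / real n) *\<^sub>R \<Phi>' n x" for n x
  define K where "K = (\<lambda>(\<xi>, \<eta>). G' \<xi> \<eta>)"
  have K: "continuous_on UNIV K" using G(2) by (simp add: K_def)
  have [measurable]: "K \<in> borel_measurable borel" using K by (rule borel_measurable_continuous_onI)
  have B0: "0 \<le> B" using \<Phi>(3)[of 0 0] norm_ge_zero order_trans by blast
  have \<Phi>c: "continuous_on UNIV (\<Phi> n)" for n
    using \<Phi>(1) by (meson continuous_at_imp_continuous_on has_vector_derivative_continuous)
  have [measurable]: "\<Phi> n \<in> borel_measurable torus" "\<Phi>' n \<in> borel_measurable torus" "H n \<in> borel_measurable torus" for n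
    unfolding H_def using \<Phi>(2) \<Phi>c
    by (auto intro!: borel_imp_torus borel_measurable_continuous_onI continuous_intros)
  have HB: "norm (H n x) \<le> B" for n x
    using \<Phi>(4)[of n x] B0 by (cases "n = 0") (auto simp: H_def divide_simps mult.commute)
  \<comment> \<open>The smooth triple has norm at most \<open>(B + 1) + B + (B + 1)\<close> and the
    direction at most \<open>B\<close>, so \<open>K\<close> is compared only inside the ball of
    radius \<open>L\<close>.\<close>
  define L where "L = 4 * B + 2"
  define J where "J n = (\<integral>x. norm (H n x - Y n x) \<partial>torus)" for n
  have J: "J \<longlonglongrightarrow> 0"
  proof -
    have "(\<lambda>n. \<integral>x. norm (H n x - Y n x) \<partial>torus) \<longlonglongrightarrow> (\<integral>x. 0 \<partial>torus)"
    proof (rule integral_dominated_convergence[where w="\<lambda>_. 2 * B"])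
      show "AE x in torus. (\<lambda>n. norm (H n x - Y n x)) \<longlonglongrightarrow> 0"
        using lim unfolding H_def by eventually_elim (rule tendsto_norm_zero)
      show "AE x in torus. norm (norm (H n x - Y n x)) \<le> 2 * B" for n
      proof (rule AE_I2)
        fix x assume "x \<in> space torus"
        then show "norm (norm (H n x - Y n x)) \<le> 2 * B"
          using HB[of n x] YB[of x n] norm_triangle_ineq4[of "H n x" "Y n x"] by simp
      qed
    qed auto
    then show ?thesis by (simp add: J_def[abs_def])
  qed
  have n3: "norm (a, b, c) \<le> norm a + norm b + norm c" for a :: 'e and b :: 'm and c :: 'f
    using norm_Pair_le[of a "(b, c)"] norm_Pair_le[of b c] by linarith
  have n2: "norm ((0::'e), b, (0::'f)) = norm b" for b :: 'm by (simp add: norm_Pair)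
  have main: "\<forall>\<^sub>F n in sequentially. norm (\<integral>x. ?T n x \<partial>torus) < e" if e: "0 < e" for e
  proof -
    obtain C where C: "0 \<le> C" "\<And>x y. norm x \<le> L \<Longrightarrow> norm y \<le> L \<Longrightarrow> norm (K x - K y) \<le> e/5 + C * norm (x - y)"
      using continuous_modulus[OF K, of "e/5" L] e by auto
    \<comment> \<open>Replacing \<open>l\<close> by \<open>u\<close> and \<open>r\<close> by
      \<open>\<rho>\<close> costs at most \<open>C * e'\<close> each; with the \<open>e/5\<close> of
      the modulus this leaves a fixed error of \<open>3 * e/5\<close>, and all other errors vanish
      as \<open>n\<close> grows.\<close>
    define e' where "e' = e / (5 * (C + 1))"
    have e': "0 < e'" "C * e' \<le> e/5"
      using e C(1) by (auto simp: e'_def divide_simps algebra_simps)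
    obtain l l' where l: "\<And>x. (l has_vector_derivative l' x) (at x)" "continuous_on UNIV l'" "bounded (range l')"
        "\<And>x. l (frac x) = l x" "\<And>x. norm (l x) \<le> B + 1" "(\<integral>x. norm (l x - u x) \<partial>torus) < e'"
      using smooth_approx_torus[OF u uB e'(1)] by blast
    obtain r r' where r: "\<And>x. (r has_vector_derivative r' x) (at x)" "continuous_on UNIV r'" "bounded (range r')"
        "\<And>x. r (frac x) = r x" "\<And>x. norm (r x) \<le> B + 1" "(\<integral>x. norm (r x - \<rho> x) \<partial>torus) < e'"
      using smooth_approx_torus[OF \<rho> \<rho>B e'(1)] by blast
    have lc: "continuous_on UNIV l" and rc: "continuous_on UNIV r"
      using l(1) r(1) by (meson continuous_at_imp_continuous_on has_vector_derivative_continuous)+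
    have [measurable]: "l \<in> borel_measurable torus" "r \<in> borel_measurable torus"
      using lc rc by (auto intro!: borel_imp_torus borel_measurable_continuous_onI)
    obtain D where D: "\<And>x. norm (l' x) \<le> D" "\<And>x. norm (r' x) \<le> D"
    proof -
      from l(3) r(3) obtain a b where "\<And>x. norm (l' x) \<le> a" "\<And>x. norm (r' x) \<le> b"
        unfolding bounded_iff by auto
      then show ?thesis using that[of "max a b"] by (meson max.coboundedI1 max.coboundedI2)
    qed
    have D0: "0 \<le> D" using D(1)[of 0] norm_ge_zero order_trans by blast
    have "bounded (G ` cball 0 L)" 
      by (intro compact_imp_bounded compact_continuous_image has_derivative_continuous_on[where f'=G'])
        (rule has_derivative_at_withinI, rule G(1), rule compact_cball)
    then obtain M1 where M1: "\<And>\<xi>. norm \<xi> \<le> L \<Longrightarrow> norm (G \<xi>) \<le> M1"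
      unfolding bounded_iff by (metis imageI mem_cball_0)
    have "bounded (K ` cball 0 (L + 2 * D))" 
      using K by (intro compact_imp_bounded compact_continuous_image) (auto intro: continuous_on_subset)
    then obtain M2 where M2: "\<And>\<xi>. norm \<xi> \<le> L + 2 * D \<Longrightarrow> norm (K \<xi>) \<le> M2"
      unfolding bounded_iff by (metis imageI mem_cball_0)
    define \<xi> where "\<xi> n x = (l x, \<Phi> n x, r (x + real n * \<alpha>))" for n x
    have \<xi>B: "norm (\<xi> n x) \<le> 3 * B + 2" for n x
      using n3[of "l x" "\<Phi> n x" "r (x + real n * \<alpha>)"] l(5)[of x] \<Phi>(3)[of n x] r(5)[of "x + real n * \<alpha>"]
      by (simp add: \<xi>_def)
    have \<xi>d: "(\<xi> n has_vector_derivative (l' x, \<Phi>' n x, r' (x + real n * \<alpha>))) (at x)" for n x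
    proof -
      have "((\<lambda>x. r (x + real n * \<alpha>)) has_vector_derivative r' (x + real n * \<alpha>)) (at x)"
        using vector_diff_chain_at[of "\<lambda>x. x + real n * \<alpha>" 1 x r "r' (x + real n * \<alpha>)"] r(1)
        by (auto simp: o_def has_vector_derivative_add_const)
      then show ?thesis unfolding \<xi>_def using l(1) \<Phi>(1) 
        unfolding has_vector_derivative_def by (auto intro!: derivative_eq_intros)
    qed
    have \<xi>c: "continuous_on UNIV (\<xi> n)" for n
      using \<xi>d by (meson continuous_at_imp_continuous_on has_vector_derivative_continuous)
    \<comment> \<open>The chain rule, split by linearity of \<open>G'\<close>: \<open>A\<close>
      carries the direction of order \<open>n\<close>, normalized, and \<open>R\<close> the
      directions of the parameters, which stay bounded as \<open>n\<close> grows.\<close>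
    define A where "A n x = K (\<xi> n x, (0, H n x, 0))" for n x
    define R where "R n x = K (\<xi> n x, (l' x, 0, r' (x + real n * \<alpha>)))" for n x
    have nK: "norm (a, b) \<le> norm a + norm b" for a b :: "'e \<times> 'm \<times> 'f" by (rule norm_Pair_le)
    have Ac: "continuous_on UNIV (A n)" for n unfolding A_def H_def
      by (rule continuous_on_compose2[OF K]) (auto intro!: continuous_intros \<xi>c \<Phi>(2))
    have Rc: "continuous_on UNIV (R n)" for n unfolding R_def 
      by (rule continuous_on_compose2[OF K])
         (auto intro!: continuous_intros \<xi>c l(2) continuous_on_compose2[OF r(2)])
    have [measurable]: "A n \<in> borel_measurable torus" "R n \<in> borel_measurable torus" for n
      using Ac Rc by (auto intro!: borel_imp_torus borel_measurable_continuous_onI)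
    have AB: "norm (A n x) \<le> M2" for n x unfolding A_def
    proof (rule M2, rule order_trans[OF nK])
      show "norm (\<xi> n x) + norm (0::'e, H n x, 0::'f) \<le> L + 2 * D"
        using \<xi>B[of n x] HB[of n x] D0 by (simp add: n2 L_def)
    qed
    have RB: "norm (R n x) \<le> M2" for n x unfolding R_def
    proof (rule M2, rule order_trans[OF nK])
      show "norm (\<xi> n x) + norm (l' x, 0::'m, r' (x + real n * \<alpha>)) \<le> L + 2 * D"
        using \<xi>B[of n x] n3[of "l' x" 0 "r' (x + real n * \<alpha>)"] D(1)[of x] D(2)[of "x + real n * \<alpha>"] B0
        by (simp add: L_def)
    qed
    have iA: "integrable torus (A n)" and iR: "integrable torus (R n)" for n
      using AB RB by (auto intro!: integrable_torus_bounded)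
    have bound: "norm (\<integral>x. A n x \<partial>torus) \<le> (2 * M1 + M2) / real n" if n: "0 < n" for n
    proof -
      have "((\<lambda>x. G (\<xi> n x)) has_vector_derivative real n *\<^sub>R A n x + R n x) (at x)" for x
      proof -
        have "((G \<circ> \<xi> n) has_vector_derivative G' (\<xi> n x) (l' x, \<Phi>' n x, r' (x + real n * \<alpha>))) (at x)"
          by (rule vector_derivative_diff_chain_within[OF \<xi>d]) (rule has_derivative_at_withinI, rule G(1))
        moreover have "linear (G' (\<xi> n x))" using G(1) has_derivative_linear by blast
        moreover have "(l' x, \<Phi>' n x, r' (x + real n * \<alpha>)) = real n *\<^sub>R (0, H n x, 0) + (l' x, 0, r' (x + real n * \<alpha>))"
          using n by (simp add: H_def)
        ultimately show ?thesis
          by (simp only: o_def A_def R_def K_def linear_add linear_scale split)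
      qed
      then have "(\<integral>x. real n *\<^sub>R A n x + R n x \<partial>torus) = G (\<xi> n 1) - G (\<xi> n 0)"
        by (rule integral_torus_FTC) (intro continuous_intros Ac Rc)
      also have "(\<integral>x. real n *\<^sub>R A n x + R n x \<partial>torus) = real n *\<^sub>R (\<integral>x. A n x \<partial>torus) + (\<integral>x. R n x \<partial>torus)"
        using iA iR by simp
      finally have "real n *\<^sub>R (\<integral>x. A n x \<partial>torus) = G (\<xi> n 1) - G (\<xi> n 0) - (\<integral>x. R n x \<partial>torus)"
        by (simp add: algebra_simps)
      also have "norm \<dots> \<le> norm (G (\<xi> n 1)) + norm (G (\<xi> n 0)) + norm (\<integral>x. R n x \<partial>torus)"
        by (meson norm_triangle_ineq4 norm_triangle_le_diff add_mono order_refl order_trans)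
      also have "\<dots> \<le> M1 + M1 + M2"
      proof (intro add_mono M1 integral_torus_bound)
        show "norm (\<xi> n 1) \<le> L" "norm (\<xi> n 0) \<le> L"
          using \<xi>B[of n 1] \<xi>B[of n 0] B0 by (auto simp: L_def)
      qed (use RB in auto)
      finally show ?thesis using n by (simp add: field_simps)
    qed
    define \<xi>' where "\<xi>' n x = (u x, \<Phi> n x, \<rho> (rotation (real n * \<alpha>) x))" for n x
    have \<xi>'[measurable]: "\<xi>' n \<in> borel_measurable torus" for n unfolding \<xi>'_def by measurable
    have T: "?T n x = K (\<xi>' n x, (0, Y n x, 0))" for n x by (simp add: K_def \<xi>'_def)
    have diff: "norm (A n x - ?T n x) \<le> e/5 + C * (norm (l x - u x)
        + norm (r (rotation (real n * \<alpha>) x) - \<rho> (rotation (real n * \<alpha>) x)) + norm (H n x - Y n x))"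
      (is "_ \<le> _ + C * ?S") if x: "x \<in> {0..<1}" for n x
    proof -
      have "norm (A n x - ?T n x) \<le> e/5 + C * norm ((\<xi> n x, (0::'e, H n x, 0::'f)) - (\<xi>' n x, (0, Y n x, 0)))"
        unfolding T A_def
      proof (rule C(2))
        show "norm (\<xi> n x, (0::'e, H n x, 0::'f)) \<le> L"
          by (rule order_trans[OF nK]) (use \<xi>B[of n x] HB[of n x] B0 in \<open>simp add: n2 L_def\<close>)
        show "norm (\<xi>' n x, (0::'e, Y n x, 0::'f)) \<le> L"
          by (rule order_trans[OF nK])
            (use n3[of "u x" "\<Phi> n x" "\<rho> (rotation (real n * \<alpha>) x)"] YB[of x n] B0 uB[of x] \<Phi>(3)[of n x]
               \<rho>B[of "rotation (real n * \<alpha>) x"] x in \<open>simp add: n2 L_def \<xi>'_def\<close>)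
      qed
      also have "norm ((\<xi> n x, (0::'e, H n x, 0::'f)) - (\<xi>' n x, (0, Y n x, 0))) \<le> norm (\<xi> n x - \<xi>' n x) + norm (H n x - Y n x)"
        using nK[of "\<xi> n x - \<xi>' n x" "(0, H n x - Y n x, 0)"] by (simp add: n2)
      also have "norm (\<xi> n x - \<xi>' n x) \<le> norm (l x - u x) + norm (r (rotation (real n * \<alpha>) x) - \<rho> (rotation (real n * \<alpha>) x))"
        using n3[of "l x - u x" 0 "r (x + real n * \<alpha>) - \<rho> (rotation (real n * \<alpha>) x)"] r(4)[of "x + real n * \<alpha>"]
        by (simp add: \<xi>_def \<xi>'_def rotation_def)
      finally show ?thesis using C(1) by (simp add: mult_left_mono)
    qed
    have iT: "integrable torus (?T n)" for n
    proof (rule integrable_torus_bounded)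
      show "?T n \<in> borel_measurable torus" unfolding T by measurable
      fix x :: real assume x: "x \<in> {0..<1}"
      have "norm (\<xi>' n x, (0::'e, Y n x, 0::'f)) \<le> L + 2 * D"
          by (rule order_trans[OF nK])
            (use n3[of "u x" "\<Phi> n x" "\<rho> (rotation (real n * \<alpha>) x)"] YB[of x n] B0 uB[of x] \<Phi>(3)[of n x]
               \<rho>B[of "rotation (real n * \<alpha>) x"] x D0 in \<open>simp add: n2 L_def \<xi>'_def\<close>)
      then show "norm (?T n x) \<le> M2" unfolding T by (rule M2)
    qed
    have i1: "integrable torus (\<lambda>x. norm (l x - u x))"
    proof (rule integrable_torus_bounded[where B="2 * B + 1"])
      fix x :: real assume x: "x \<in> {0..<1}"
      show "norm (norm (l x - u x)) \<le> 2 * B + 1"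
        using norm_triangle_ineq4[of "l x" "u x"] l(5)[of x] uB[OF x] by simp
    qed simp
    have i2: "integrable torus (\<lambda>x. norm (r (rotation (real n * \<alpha>) x) - \<rho> (rotation (real n * \<alpha>) x)))" for n
    proof (rule integrable_torus_bounded[where B="2 * B + 1"])
      fix x :: real assume x: "x \<in> {0..<1}"
      show "norm (norm (r (rotation (real n * \<alpha>) x) - \<rho> (rotation (real n * \<alpha>) x))) \<le> 2 * B + 1"
        using norm_triangle_ineq4[of "r (rotation (real n * \<alpha>) x)" "\<rho> (rotation (real n * \<alpha>) x)"]
          r(5)[of "rotation (real n * \<alpha>) x"] \<rho>B[OF rotation_in(1)[of "real n * \<alpha>" x]] by simp
    qed measurable
    have i3: "integrable torus (\<lambda>x. norm (H n x - Y n x))" for n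
    proof (rule integrable_torus_bounded[where B="2 * B"])
      fix x :: real assume x: "x \<in> {0..<1}"
      show "norm (norm (H n x - Y n x)) \<le> 2 * B"
        using HB[of n x] YB[OF x, of n] norm_triangle_ineq4[of "H n x" "Y n x"] by simp
    qed measurable
    have near: "norm ((\<integral>x. A n x \<partial>torus) - (\<integral>x. ?T n x \<partial>torus)) \<le> 3 * e/5 + C * J n" for n
    proof -
      have "norm ((\<integral>x. A n x \<partial>torus) - (\<integral>x. ?T n x \<partial>torus)) = norm (\<integral>x. A n x - ?T n x \<partial>torus)"
        using iA iT by simp
      also have "\<dots> \<le> (\<integral>x. norm (A n x - ?T n x) \<partial>torus)" by (rule integral_norm_bound)
      also have "\<dots> \<le> (\<integral>x. e/5 + C * (norm (l x - u x)
        + norm (r (rotation (real n * \<alpha>) x) - \<rho> (rotation (real n * \<alpha>) x)) + norm (H n x - Y n x)) \<partial>torus)"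
        by (rule integral_mono) (use diff iA iT i1 i2 i3 in auto)
      also have "\<dots> = e/5 + C * ((\<integral>x. norm (l x - u x) \<partial>torus)
         + (\<integral>x. norm (r (rotation (real n * \<alpha>) x) - \<rho> (rotation (real n * \<alpha>) x)) \<partial>torus) + J n)"
        using i1 i2[of n] i3[of n] prob_space by (simp add: J_def)
      also have "(\<integral>x. norm (r (rotation (real n * \<alpha>) x) - \<rho> (rotation (real n * \<alpha>) x)) \<partial>torus)
        = (\<integral>x. norm (r x - \<rho> x) \<partial>torus)"
        by (rule integral_rotation) measurable
      also have "e/5 + C * ((\<integral>x. norm (l x - u x) \<partial>torus) + (\<integral>x. norm (r x - \<rho> x) \<partial>torus) + J n)
         \<le> e/5 + C * (e' + e' + J n)"
        using l(6) r(6) C(1) by (intro add_left_mono mult_left_mono add_mono) auto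
      also have "\<dots> \<le> 3 * e/5 + C * J n" using e'(2) by (simp add: algebra_simps)
      finally show ?thesis .
    qed
    have "(\<lambda>n. (2 * M1 + M2) / real n + (3 * e/5 + C * J n)) \<longlonglongrightarrow> 0 + (3 * e/5 + C * 0)"
      by (intro tendsto_intros J lim_const_over_n)
    then have "\<forall>\<^sub>F n in sequentially. (2 * M1 + M2) / real n + (3 * e/5 + C * J n) < e"
      by (rule order_tendstoD) (use e in simp)
    with eventually_gt_at_top[of 0] show ?thesis
    proof eventually_elim
      case (elim n)
      then show ?case
        using bound[of n] near[of n] norm_triangle_sub[of "\<integral>x. ?T n x \<partial>torus" "\<integral>x. A n x \<partial>torus"]
        by (simp add: norm_minus_commute)
    qed
  qed
  show ?thesis using main by (intro tendstoI) simp
qed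

subsection \<open>Cocycles in \<open>SU(2)\<close>\<close>

lemma mat2_eq_iff: "(A :: complex^2^2) = B \<longleftrightarrow> A$1$1 = B$1$1 \<and> A$1$2 = B$1$2 \<and> A$2$1 = B$2$1 \<and> A$2$2 = B$2$2"
  by (auto simp: vec_eq_iff forall_2)

lemma mat2_mult_nth: "((A :: complex^2^2) ** B) $ i $ j = A$i$1 * B$1$j + A$i$2 * B$2$j"
  by (simp add: matrix_matrix_mult_def sum_2)

lemma bounded_bilinear_mat2: "bounded_bilinear ((**) :: complex^2^2 \<Rightarrow> complex^2^2 \<Rightarrow> complex^2^2)"
  unfolding bilinear_conv_bounded_bilinear[symmetric] bilinear_def
  by (auto intro!: linearI simp: mat2_eq_iff mat2_mult_nth algebra_simps)

lemmas has_derivative_mat2_mult [derivative_intros] = bounded_bilinear.FDERIV[OF bounded_bilinear_mat2]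
lemmas continuous_on_mat2_mult [continuous_intros] = bounded_bilinear.continuous_on[OF bounded_bilinear_mat2]
lemmas mat2_mult_zero [simp] = bounded_bilinear.zero_left[OF bounded_bilinear_mat2] bounded_bilinear.zero_right[OF bounded_bilinear_mat2]

lemma borel_measurable_mat2_mult [measurable (raw)]:
  fixes f g :: "'a \<Rightarrow> complex^2^2"
  assumes "f \<in> borel_measurable M" "g \<in> borel_measurable M"
  shows "(\<lambda>x. f x ** g x) \<in> borel_measurable M"
  by (rule borel_measurable_continuous_Pair[OF assms]) (intro continuous_intros)

lemma borel_measurable_vec_nth [measurable (raw)]:
  fixes f :: "'a \<Rightarrow> 'b::euclidean_space^'n"
  assumes "f \<in> borel_measurable M"
  shows "(\<lambda>x. f x $ i) \<in> borel_measurable M"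
  by (rule measurable_compose[OF assms borel_measurable_continuous_onI]) (intro continuous_intros)

lemma conj_transpose_nth [simp]: "conj_transpose A $ i $ j = cnj (A $ j $ i)"
  by (simp add: conj_transpose_def)

lemma conj_transpose_mult: "conj_transpose (A ** B) = conj_transpose B ** conj_transpose A"
  by (simp add: mat2_eq_iff mat2_mult_nth algebra_simps)

lemma continuous_on_conj_transpose: "continuous_on UNIV conj_transpose"
  unfolding conj_transpose_def by (intro continuous_intros)

lemma norm_mat2: "(norm (A :: complex^2^2))\<^sup>2 = (cmod (A$1$1))\<^sup>2 + (cmod (A$1$2))\<^sup>2 + (cmod (A$2$1))\<^sup>2 + (cmod (A$2$2))\<^sup>2"
  by (simp add: norm_vec_def L2_set_def sum_2 sum_nonneg)

text \<open>The norm of \<open>complex^2^2\<close> is the Frobenius norm. Its trace form makes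
  multiplication by SU(2) from either side an isometry, the source of all bounds uniform in
  \<open>n\<close>.\<close>

lemma norm_mat2_trace: 
  "(norm (A :: complex^2^2))\<^sup>2 = Re (trace (A ** conj_transpose A))"
  "(norm (A :: complex^2^2))\<^sup>2 = Re (trace (conj_transpose A ** A))"
  unfolding norm_mat2 cmod_power2
  by (simp_all add: trace_def sum_2 mat2_mult_nth power2_eq_square)

lemma SU2_D:
  assumes "A \<in> SU2"
  shows "A ** conj_transpose A = mat 1" "conj_transpose A ** A = mat 1" "det A = 1" "matrix_inv A = conj_transpose A"
proof -
  show 1: "A ** conj_transpose A = mat 1" "det A = 1" using assms by (auto simp: SU2_def)
  then show 2: "conj_transpose A ** A = mat 1" by (simp add: matrix_left_right_inverse)
  have "invertible A" using 1 2 unfolding invertible_def by blast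
  then have "matrix_inv A ** A = mat 1"
    unfolding matrix_inv_def invertible_def by (rule someI2_ex) simp
  then have "matrix_inv A ** A ** conj_transpose A = conj_transpose A" by simp
  then show "matrix_inv A = conj_transpose A"
    by (simp add: 1 flip: matrix_mul_assoc)
qed

lemma SU2_conj_transpose: "A \<in> SU2 \<Longrightarrow> conj_transpose A \<in> SU2"
proof -
  assume A: "A \<in> SU2"
  have "conj_transpose (conj_transpose A) = A" by (simp add: mat2_eq_iff)
  moreover have "det (conj_transpose A) = cnj (det A)" by (simp add: det_2 mult.commute)
  ultimately show ?thesis using SU2_D[OF A] by (simp add: SU2_def)
qed

lemma SU2_mult: "A \<in> SU2 \<Longrightarrow> B \<in> SU2 \<Longrightarrow> A ** B \<in> SU2"
proof -
  assume AB: "A \<in> SU2" "B \<in> SU2"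
  have "A ** B ** conj_transpose (A ** B) = A ** (B ** conj_transpose B) ** conj_transpose A"
    by (simp add: conj_transpose_mult matrix_mul_assoc)
  then show ?thesis using AB by (simp add: SU2_def det_mul)
qed

lemma SU2_one: "mat 1 \<in> SU2"
proof -
  have "conj_transpose (mat 1) = mat 1" by (simp add: mat2_eq_iff mat_def)
  then show ?thesis by (simp add: SU2_def)
qed

lemma norm_mult_SU2: assumes "U \<in> SU2" shows "norm (A ** U) = norm A" "norm (U ** A) = norm A"
proof -
  have "(A ** U) ** conj_transpose (A ** U) = A ** (U ** conj_transpose U) ** conj_transpose A"
    by (simp add: conj_transpose_mult matrix_mul_assoc)
  then have "(norm (A ** U))\<^sup>2 = (norm A)\<^sup>2"
    unfolding norm_mat2_trace(1) using assms by (simp add: SU2_D)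
  then show "norm (A ** U) = norm A" by simp
  have "conj_transpose (U ** A) ** (U ** A) = conj_transpose A ** (conj_transpose U ** U) ** A"
    by (simp add: conj_transpose_mult matrix_mul_assoc)
  then have "(norm (U ** A))\<^sup>2 = (norm A)\<^sup>2"
    unfolding norm_mat2_trace(2) using assms by (simp add: SU2_D)
  then show "norm (U ** A) = norm A" by simp
qed

lemma norm_SU2: assumes "U \<in> SU2" shows "norm U \<le> 2"
proof -
  have "(norm U)\<^sup>2 = Re (trace (mat 1 :: complex^2^2))"
    unfolding norm_mat2_trace using assms by (simp add: SU2_D)
  also have "\<dots> \<le> 2\<^sup>2" by (simp add: trace_def sum_2 mat_def)
  finally show ?thesis using power2_le_imp_le[of "norm U" 2] by simp
qed

text \<open>An element of su(2) has rows \<open>(i t, - cnj h)\<close> and \<open>(h, - i t)\<close>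
  with real \<open>t\<close>, so its determinant is the sum of the squared moduli of
  \<open>t\<close> and \<open>h\<close>, and the Frobenius norm counts each of the two
  twice.\<close>

lemma su2_entries:
  assumes "A \<in> su2"
  shows "A$2$2 = - A$1$1" "A$1$2 = - cnj (A$2$1)" "cnj (A$1$1) = - A$1$1"
    and "Re (det A) = (cmod (A$1$1))\<^sup>2 + (cmod (A$2$1))\<^sup>2" "(norm A)\<^sup>2 = 2 * (su2_norm A)\<^sup>2"
proof -
  have c: "conj_transpose A = - A" "trace A = 0" using assms by (auto simp: su2_def)
  from c(1) have e: "cnj (A$j$i) = - A$i$j" for i j
  proof -
    have "conj_transpose A $ i $ j = (- A) $ i $ j" by (simp only: c(1))
    then show ?thesis by simp
  qed
  show 1: "A$2$2 = - A$1$1" using c(2) by (simp add: trace_def sum_2 eq_neg_iff_add_eq_0 add.commute)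
  show 2: "A$1$2 = - cnj (A$2$1)" "cnj (A$1$1) = - A$1$1" using e by simp_all
  have 3: "det A = A$1$1 * cnj (A$1$1) + A$2$1 * cnj (A$2$1)"
    by (simp add: det_2 1 2 algebra_simps)
  then show 4: "Re (det A) = (cmod (A$1$1))\<^sup>2 + (cmod (A$2$1))\<^sup>2"
    by (simp add: complex_mult_cnj cmod_power2)
  then show "(norm A)\<^sup>2 = 2 * (su2_norm A)\<^sup>2"
    by (simp add: norm_mat2 1 2 su2_norm_def)
qed

lemma su2_conjugate:
  assumes "A \<in> su2" "U \<in> SU2"
  shows "U ** A ** conj_transpose U \<in> su2" "det (U ** A ** conj_transpose U) = det A"
proof -
  have cc: "conj_transpose (conj_transpose U) = U" by (simp add: mat2_eq_iff)
  have "conj_transpose (U ** A ** conj_transpose U) = U ** conj_transpose A ** conj_transpose U"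
    by (simp add: conj_transpose_mult matrix_mul_assoc cc)
  also have "\<dots> = - (U ** A ** conj_transpose U)"
    using assms by (simp add: su2_def mat2_eq_iff mat2_mult_nth algebra_simps)
  finally have 1: "conj_transpose (U ** A ** conj_transpose U) = - (U ** A ** conj_transpose U)" .
  have "trace (U ** A ** conj_transpose U) = trace (conj_transpose U ** (U ** A))"
    by (rule trace_mul_sym)
  also have "\<dots> = trace A" using assms by (simp add: matrix_mul_assoc SU2_D)
  finally show "U ** A ** conj_transpose U \<in> su2" using 1 assms by (simp add: su2_def)
  show "det (U ** A ** conj_transpose U) = det A"
    using assms SU2_D(3)[OF SU2_conj_transpose[of U]] by (simp add: det_mul SU2_D)
qed

section \<open>Periodicity and the transfer to the diagonal cocycle\<close>

lemma periodic_add_int: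
  assumes "periodic_fun_simple' f"
  shows "f (x + of_int n) = f (x::real)"
proof -
  interpret periodic_fun_simple' f by fact
  show ?thesis by (rule plus_of_int)
qed

lemma periodic_frac:
  assumes "periodic_fun_simple' f"
  shows "f (frac x + c) = f (x + c :: real)" "f (frac x) = f x"
proof -
  show 1: "f (frac x + c) = f (x + c)" for c :: real
    using periodic_add_int[OF assms, of "frac x + c" "\<lfloor>x\<rfloor>"] by (simp add: frac_def add.commute)
  show "f (frac x) = f x" using 1[of 0] by simp
qed

lemma diag_cocycle_nth [simp]:
  "diag_cocycle g x $ 1 $ 1 = g x" "diag_cocycle g x $ 1 $ 2 = 0"
  "diag_cocycle g x $ 2 $ 1 = 0" "diag_cocycle g x $ 2 $ 2 = inverse (g x)"
  by (simp_all add: diag_cocycle_def)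

definition scalar_iter :: "real \<Rightarrow> (real \<Rightarrow> complex) \<Rightarrow> nat \<Rightarrow> real \<Rightarrow> complex" where
  "scalar_iter \<alpha> \<gamma> n x = (\<Prod>j<n. \<gamma> (x + real j * \<alpha>))"

text \<open>The transfer matrices at intermediate points cancel in pairs. Since the relation holds
  only almost everywhere, it is first moved along the rotations by all multiples of
  \<open>\<alpha>\<close>; countably many null sets are merged, which allows the quantifier over
  \<open>n\<close> inside the \<open>AE\<close>.\<close>

lemma cohomologous_iter:
  assumes \<phi>: "periodic_fun_simple' \<phi>" and p: "measurable_cocycle SU2 p"
    and \<gamma>: "periodic_fun_simple' \<gamma>"
    and coh: "AE x in torus. \<phi> x = matrix_inv (p x) ** diag_cocycle \<gamma> x ** p (x + \<alpha>)"
  shows "AE x in torus. \<forall>n. p x ** cocycle_iter \<alpha> \<phi> n x ** conj_transpose (p (x + real n * \<alpha>))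
            = diag_cocycle (scalar_iter \<alpha> \<gamma> n) x"
proof -
  have pp: "periodic_fun_simple' p" and pS: "\<And>x. p x \<in> SU2"
    using p by (auto simp: measurable_cocycle_def)
  have d: "diag_cocycle \<gamma> (frac x) = diag_cocycle \<gamma> x" for x
    using periodic_frac(2)[OF \<gamma>] by (simp add: diag_cocycle_def)
  have "AE x in torus. \<forall>n. \<phi> (x + real n * \<alpha>) = conj_transpose (p (x + real n * \<alpha>)) **
       diag_cocycle \<gamma> (x + real n * \<alpha>) ** p (x + real (Suc n) * \<alpha>)"
    unfolding AE_all_countable
  proof
    fix n
    have Suc_n: "x + real (Suc n) * \<alpha> = x + real n * \<alpha> + \<alpha>" for x by (simp add: algebra_simps)
    show "AE x in torus. \<phi> (x + real n * \<alpha>) = conj_transpose (p (x + real n * \<alpha>)) **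
       diag_cocycle \<gamma> (x + real n * \<alpha>) ** p (x + real (Suc n) * \<alpha>)"
      using AE_rotation[OF coh, of "real n * \<alpha>"]
      by eventually_elim
        (simp add: rotation_def periodic_frac[OF \<phi>] periodic_frac[OF pp] d SU2_D(4)[OF pS] Suc_n del: of_nat_Suc)
  qed
  then show ?thesis
  proof eventually_elim
    case (elim x)
    have "p x ** cocycle_iter \<alpha> \<phi> n x ** conj_transpose (p (x + real n * \<alpha>))
            = diag_cocycle (scalar_iter \<alpha> \<gamma> n) x" for n
    proof (induction n)
      case 0
      show ?case using SU2_D(1)[OF pS[of x]]
        by (simp add: scalar_iter_def mat2_eq_iff) (simp add: mat_def)
    next
      case (Suc n)
      let ?y = "x + real n * \<alpha>" and ?z = "x + real (Suc n) * \<alpha>"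
      have "p x ** cocycle_iter \<alpha> \<phi> (Suc n) x ** conj_transpose (p ?z)
        = p x ** cocycle_iter \<alpha> \<phi> n x ** \<phi> ?y ** conj_transpose (p ?z)"
        by (simp add: matrix_mul_assoc)
      also have "\<dots> = p x ** cocycle_iter \<alpha> \<phi> n x ** conj_transpose (p ?y) ** diag_cocycle \<gamma> ?y
          ** (p ?z ** conj_transpose (p ?z))"
        using elim[rule_format, of n] by (simp only: matrix_mul_assoc)
      also have "\<dots> = diag_cocycle (scalar_iter \<alpha> \<gamma> n) x ** diag_cocycle \<gamma> ?y"
        using Suc SU2_D(1)[OF pS] by simp
      also have "\<dots> = diag_cocycle (scalar_iter \<alpha> \<gamma> (Suc n)) x"
        by (simp add: mat2_eq_iff mat2_mult_nth scalar_iter_def)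
      finally show ?case .
    qed
    then show ?case by blast
  qed
qed

section \<open>Derivatives of the iterated cocycle\<close>

locale C1_cocycle_deriv =
  fixes \<alpha> :: real and \<phi> \<phi>' :: "real \<Rightarrow> complex^2^2"
  assumes per: "periodic_fun_simple' \<phi>" and SU2: "\<And>x. \<phi> x \<in> SU2"
    and deriv: "\<And>x. (\<phi> has_vector_derivative \<phi>' x) (at x)" and cont: "continuous_on UNIV \<phi>'"
begin

abbreviation "\<Phi> \<equiv> cocycle_iter \<alpha> \<phi>"

text \<open>The product rule as an explicit recursion, so that continuity and linear growth in
  \<open>n\<close> follow by induction.\<close>

primrec \<Phi>' :: "nat \<Rightarrow> real \<Rightarrow> complex^2^2" where
  "\<Phi>' 0 x = 0"
| "\<Phi>' (Suc n) x = \<Phi> n x ** \<phi>' (x + real n * \<alpha>) + \<Phi>' n x ** \<phi> (x + real n * \<alpha>)"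

lemma SU2_iter: "\<Phi> n x \<in> SU2"
  by (induction n) (auto intro: SU2_one SU2_mult SU2)

lemma deriv_iter: "(\<Phi> n has_vector_derivative \<Phi>' n x) (at x)"
proof (induction n)
  case 0
  have "\<Phi> 0 = (\<lambda>x. mat 1)" by (simp add: fun_eq_iff)
  then show ?case by simp
next
  case (Suc n)
  have "((\<lambda>x. \<phi> (x + real n * \<alpha>)) has_vector_derivative \<phi>' (x + real n * \<alpha>)) (at x)"
    using vector_diff_chain_at[of "\<lambda>x. x + real n * \<alpha>" 1 x \<phi> "\<phi>' (x + real n * \<alpha>)"] deriv
    by (auto simp: o_def has_vector_derivative_add_const)
  from bounded_bilinear.has_vector_derivative[OF bounded_bilinear_mat2 Suc this]
  have "((\<lambda>x. \<Phi> n x ** \<phi> (x + real n * \<alpha>)) has_vector_derivative \<Phi>' (Suc n) x) (at x)" by simp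
  moreover have "\<Phi> (Suc n) = (\<lambda>x. \<Phi> n x ** \<phi> (x + real n * \<alpha>))" by (rule ext) simp
  ultimately show ?case by simp
qed

lemma cont_iter: "continuous_on UNIV (\<Phi> n)"
  using deriv_iter by (meson continuous_at_imp_continuous_on has_vector_derivative_continuous)

lemma cont_deriv_iter: "continuous_on UNIV (\<Phi>' n)"
proof (induction n)
  case (Suc n)
  have c: "continuous_on UNIV \<phi>"
    using deriv by (meson continuous_at_imp_continuous_on has_vector_derivative_continuous)
  have s: "continuous_on UNIV (\<lambda>x. x + real n * \<alpha>)" by (intro continuous_intros)
  show ?case unfolding \<Phi>'.simps
    by (intro continuous_intros cont_iter Suc continuous_on_compose2[OF cont s] continuous_on_compose2[OF c s]) auto
next
  case 0
  have "\<Phi>' 0 = (\<lambda>x. 0)" by (rule ext) simp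
  then show ?case by simp
qed

text \<open>By uniqueness of derivatives \<open>\<phi>'\<close> inherits the period of
  \<open>\<phi>\<close>, so its maximum over a compact interval bounds it everywhere.\<close>

lemma bounded_deriv: "\<exists>B. \<forall>x. norm (\<phi>' x) \<le> B"
proof -
  have "bounded (\<phi>' ` {0..1})"
    using cont by (intro compact_imp_bounded compact_continuous_image) (auto intro: continuous_on_subset)
  then obtain B where B: "\<And>x. x \<in> {0..1} \<Longrightarrow> norm (\<phi>' x) \<le> B"
    unfolding bounded_iff by (metis image_eqI)
  have "\<phi>' x = \<phi>' (frac x)" for x
  proof -
    define c :: real where "c = of_int (- \<lfloor>x\<rfloor>)"
    have "((\<lambda>y. \<phi> (y + c)) has_vector_derivative \<phi>' (x + c)) (at x)"
      using vector_diff_chain_at[of "\<lambda>y. y + c" 1 x \<phi> "\<phi>' (x + c)"] deriv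
      by (auto simp: o_def has_vector_derivative_add_const)
    then have "(\<phi> has_vector_derivative \<phi>' (frac x)) (at x)"
      unfolding c_def periodic_add_int[OF per] by (simp add: frac_def)
    with deriv[of x] show ?thesis by (rule vector_derivative_unique_at)
  qed
  moreover have "frac x \<in> {0..1}" for x :: real using frac_lt_1[of x] by (simp add: less_imp_le)
  ultimately show ?thesis using B by metis
qed

text \<open>Each of the \<open>n\<close> terms of the product rule is one value of
  \<open>\<phi>'\<close> multiplied by matrices of SU(2), which preserve the norm.\<close>

lemma norm_deriv_iter:
  assumes "\<And>x. norm (\<phi>' x) \<le> B"
  shows "norm (\<Phi>' n x) \<le> real n * B"
proof (induction n)
  case (Suc n)
  have "norm (\<Phi>' (Suc n) x) \<le> norm (\<phi>' (x + real n * \<alpha>)) + norm (\<Phi>' n x)"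
    using norm_triangle_ineq[of "\<Phi> n x ** \<phi>' (x + real n * \<alpha>)" "\<Phi>' n x ** \<phi> (x + real n * \<alpha>)"]
    by (simp add: norm_mult_SU2 SU2_iter SU2)
  then show ?case using Suc assms[of "x + real n * \<alpha>"] by (simp add: algebra_simps)
qed simp

lemma log_deriv_avg_eq: "log_deriv_avg \<alpha> \<phi> n x = ((1 / real n) *\<^sub>R \<Phi>' n x) ** conj_transpose (\<Phi> n x)"
  using vector_derivative_at[OF deriv_iter[of n x]] SU2_D(4)[OF SU2_iter[of n x]]
  by (simp add: log_deriv_avg_def bounded_bilinear.scaleR_left[OF bounded_bilinear_mat2])

end

lemma borel_measurable_cnj [measurable (raw)]:
  assumes "f \<in> borel_measurable M"
  shows "(\<lambda>x. cnj (f x)) \<in> borel_measurable M"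
proof -
  have "cnj \<in> borel_measurable borel"
    by (intro borel_measurable_continuous_onI linear_continuous_on bounded_linear_cnj)
  then show ?thesis by (rule measurable_compose[OF assms])
qed

subsection \<open>Oscillation of the diagonal cocycle\<close>

text \<open>The product of the three matrix slots on the argument space of
  \<open>oscillation\<close>. The first components of the outer pairs are places for scalar weights,
  which the test functions \<open>G\<close> multiply in.\<close>

definition mat2_sandwich :: "('a \<times> (complex^2^2)) \<times> (complex^2^2) \<times> ('b \<times> (complex^2^2)) \<Rightarrow> complex^2^2" where
  "mat2_sandwich \<xi> = snd (fst \<xi>) ** fst (snd \<xi>) ** snd (snd (snd \<xi>))"

definition mat2_sandwich_deriv :: "('a \<times> (complex^2^2)) \<times> (complex^2^2) \<times> ('b \<times> (complex^2^2)) \<Rightarrow>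
    ('a \<times> (complex^2^2)) \<times> (complex^2^2) \<times> ('b \<times> (complex^2^2)) \<Rightarrow> complex^2^2" where
  "mat2_sandwich_deriv \<xi> \<eta> =
     (snd (fst \<eta>) ** fst (snd \<xi>) + snd (fst \<xi>) ** fst (snd \<eta>)) ** snd (snd (snd \<xi>))
      + snd (fst \<xi>) ** fst (snd \<xi>) ** snd (snd (snd \<eta>))"

lemma has_derivative_mat2_sandwich:
  "((mat2_sandwich :: ('a::euclidean_space \<times> _) \<times> _ \<times> ('b::euclidean_space \<times> _) \<Rightarrow> _)
      has_derivative mat2_sandwich_deriv \<xi>) (at \<xi>)"
  unfolding mat2_sandwich_def mat2_sandwich_deriv_def
  by (rule has_derivative_eq_rhs, (rule derivative_intros)+) (auto simp: fun_eq_iff add_ac)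

lemma has_derivative_mat2_sandwich_nth:
  "((\<lambda>\<xi> :: ('a::euclidean_space \<times> _) \<times> _ \<times> ('b::euclidean_space \<times> _). mat2_sandwich \<xi> $ i $ j)
      has_derivative (\<lambda>\<eta>. mat2_sandwich_deriv \<xi> \<eta> $ i $ j)) (at \<xi>)"
  by (intro bounded_linear.has_derivative[OF bounded_linear_vec_nth] has_derivative_mat2_sandwich)

lemma continuous_on_mat2_sandwich:
  "continuous_on S (\<lambda>z. mat2_sandwich (fst z :: ('a::euclidean_space \<times> _) \<times> _ \<times> ('b::euclidean_space \<times> _)))"
  "continuous_on S (\<lambda>z. mat2_sandwich_deriv (fst z) (snd z :: ('a::euclidean_space \<times> _) \<times> _ \<times> ('b::euclidean_space \<times> _)))"
  unfolding mat2_sandwich_def mat2_sandwich_deriv_def by (intro continuous_intros)+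

section \<open>The limit in the frame that diagonalizes the cocycle\<close>

locale diagonalized_cocycle = C1_cocycle_deriv +
  fixes \<gamma> :: "real \<Rightarrow> complex" and p \<psi> :: "real \<Rightarrow> complex^2^2" and d :: real
  assumes d: "0 < d"
    and \<psi>_meas [measurable]: "\<psi> \<in> borel_measurable torus" and \<psi>_su2: "\<And>x. \<psi> x \<in> su2"
    and \<psi>_lim: "AE x in torus. (\<lambda>n. log_deriv_avg \<alpha> \<phi> n x) \<longlonglongrightarrow> \<psi> x"
    and \<psi>_norm: "AE x in torus. su2_norm (\<psi> x) = d"
    and p: "measurable_cocycle SU2 p"
    and \<gamma>: "measurable_cocycle (sphere 0 1) \<gamma>"
    and coh: "AE x in torus. \<phi> x = matrix_inv (p x) ** diag_cocycle \<gamma> x ** p (x + \<alpha>)"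
begin

lemma p_SU2: "p x \<in> SU2" and p_per: "periodic_fun_simple' p"
  and p_meas [measurable]: "p \<in> borel_measurable torus"
proof -
  have "periodic_fun_simple' p \<and> p \<in> borel_measurable borel \<and> (\<forall>x. p x \<in> SU2)"
    using p unfolding measurable_cocycle_def .
  then show "p x \<in> SU2" "periodic_fun_simple' p" "p \<in> borel_measurable torus"
    by (blast intro: borel_imp_torus)+
qed

lemma cnj_p_meas [measurable]: "(\<lambda>x. conj_transpose (p x)) \<in> borel_measurable torus"
  by (rule measurable_compose[OF p_meas borel_measurable_continuous_onI[OF continuous_on_conj_transpose]])

text \<open>The null set where \<open>\<psi>\<close> does not have norm \<open>d\<close> is cut off to make the limit bounded.\<close>

definition \<psi>0 :: "real \<Rightarrow> complex^2^2" where
  "\<psi>0 x = (if norm (\<psi> x) = sqrt 2 * d then \<psi> x else 0)"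

text \<open>This is the origin of the factor \<open>sqrt 2\<close> in \<open>\<psi>0\<close>: the
  squared Frobenius norm is twice the determinant.\<close>

lemma norm_eq_su2_norm: "norm (\<psi> x) = sqrt 2 * su2_norm (\<psi> x)"
proof -
  have "0 \<le> Re (det (\<psi> x))" using su2_entries(4)[OF \<psi>_su2[of x]] by simp
  then have "0 \<le> su2_norm (\<psi> x)" by (simp add: su2_norm_def)
  then show ?thesis
    by - (rule power2_eq_imp_eq, simp_all add: power_mult_distrib su2_entries(5)[OF \<psi>_su2])
qed

lemma \<psi>0_meas [measurable]: "\<psi>0 \<in> borel_measurable torus"
  unfolding \<psi>0_def by measurable

lemma \<psi>0_su2: "\<psi>0 x \<in> su2"
  using \<psi>_su2[of x] by (auto simp: \<psi>0_def su2_def mat2_eq_iff trace_def)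

lemma \<psi>0_bound: "norm (\<psi>0 x) \<le> 2 * d"
proof -
  have "sqrt 2 \<le> 2" by (rule real_le_lsqrt) auto
  then have "sqrt 2 * d \<le> 2 * d" using d by (intro mult_right_mono) auto
  then show ?thesis using d by (simp add: \<psi>0_def)
qed

lemma \<psi>0_eq: "AE x in torus. \<psi>0 x = \<psi> x \<and> su2_norm (\<psi>0 x) = d"
  using \<psi>_norm by eventually_elim (simp add: \<psi>0_def norm_eq_su2_norm)

definition q :: "real \<Rightarrow> complex^2^2" where
  "q x = p x ** \<psi>0 x ** conj_transpose (p x)"

lemma q_meas [measurable]: "q \<in> borel_measurable torus"
  unfolding q_def by measurable

lemma q_su2: "q x \<in> su2"
  unfolding q_def by (intro su2_conjugate \<psi>0_su2 p_SU2)

lemma q_norm: "AE x in torus. (cmod (q x $ 1 $ 1))\<^sup>2 + (cmod (q x $ 2 $ 1))\<^sup>2 = d\<^sup>2"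
  using \<psi>0_eq
proof eventually_elim
  case (elim x)
  have "(su2_norm (\<psi>0 x))\<^sup>2 = Re (det (\<psi>0 x))"
    using su2_entries(4)[OF \<psi>0_su2[of x]] by (simp add: su2_norm_def)
  moreover have "det (q x) = det (\<psi>0 x)" unfolding q_def by (intro su2_conjugate \<psi>0_su2 p_SU2)
  ultimately show ?case using elim su2_entries(4)[OF q_su2[of x]] by auto
qed

lemma q_bound: "cmod (q x $ i $ j) \<le> 2 * d"
proof -
  have "cmod (q x $ i $ j) \<le> norm (q x $ i)" by (rule Finite_Cartesian_Product.norm_nth_le)
  also have "\<dots> \<le> norm (q x)" by (rule Finite_Cartesian_Product.norm_nth_le)
  also have "norm (q x) = norm (\<psi>0 x)"
    unfolding q_def by (simp add: norm_mult_SU2 p_SU2 SU2_conj_transpose)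
  finally show ?thesis using \<psi>0_bound[of x] by simp
qed

lemma diagonal_iter: "AE x in torus. \<forall>n. p x ** \<Phi> n x ** conj_transpose (p (rotation (real n * \<alpha>) x))
            = diag_cocycle (scalar_iter \<alpha> \<gamma> n) x"
  using cohomologous_iter[OF per p _ coh] \<gamma>
  by (simp add: measurable_cocycle_def rotation_def periodic_frac[OF p_per])

text \<open>Inserting \<open>conj_transpose (p x) ** p x\<close> shows that differentiating the
  sandwich in direction \<open>\<psi>0 ** \<Phi> n\<close> multiplies it by \<open>q\<close> from
  the left. Combined with \<open>diagonal_iter\<close>, this makes every derivative below
  explicit.\<close>

lemma sandwich_\<psi>0: "p x ** (\<psi>0 x ** A) ** S = q x ** (p x ** A ** S)"
proof -
  have "q x ** (p x ** A ** S) = p x ** \<psi>0 x ** (conj_transpose (p x) ** p x) ** A ** S"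
    by (simp add: q_def matrix_mul_assoc)
  then show ?thesis by (simp add: SU2_D(2)[OF p_SU2] matrix_mul_assoc)
qed

lemma norm_scalar_iter: "cmod (scalar_iter \<alpha> \<gamma> n x) = 1"
  using \<gamma> by (simp add: scalar_iter_def prod_norm[symmetric] measurable_cocycle_def)

lemma scalar_iter_meas [measurable]: "scalar_iter \<alpha> \<gamma> n \<in> borel_measurable torus"
proof -
  have [measurable]: "\<gamma> \<in> borel_measurable borel" using \<gamma> by (simp add: measurable_cocycle_def)
  show ?thesis unfolding scalar_iter_def by (rule borel_imp_torus) measurable
qed

text \<open>\<open>oscillation\<close> with \<open>Y n\<close> equal to
  \<open>\<psi>0 ** \<Phi> n\<close>. The functions \<open>f n\<close> stand for the integrand after
  evaluation along the diagonal cocycle, which is possible only almost everywhere.\<close>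

lemma oscillation_iter:
  fixes u :: "real \<Rightarrow> 'e::euclidean_space" and \<rho> :: "real \<Rightarrow> 'f::euclidean_space"
    and G :: "'e \<times> (complex^2^2) \<times> 'f \<Rightarrow> complex"
  assumes u: "u \<in> borel_measurable torus" "\<And>x. x \<in> {0..<1} \<Longrightarrow> norm (u x) \<le> K"
    and \<rho>: "\<rho> \<in> borel_measurable torus" "\<And>x. x \<in> {0..<1} \<Longrightarrow> norm (\<rho> x) \<le> K"
    and G: "\<And>\<xi>. (G has_derivative G' \<xi>) (at \<xi>)" "continuous_on UNIV (\<lambda>(\<xi>, \<eta>). G' \<xi> \<eta>)"
    and f: "\<And>n. f n \<in> borel_measurable torus"
      "AE x in torus. \<forall>n. G' (u x, \<Phi> n x, \<rho> (rotation (real n * \<alpha>) x)) (0, \<psi>0 x ** \<Phi> n x, 0) = f n x"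
  shows "(\<lambda>n. \<integral>x. f n x \<partial>torus) \<longlonglongrightarrow> 0"
proof -
  have [measurable]: "\<Phi> n \<in> borel_measurable torus" for n
    by (intro borel_imp_torus borel_measurable_continuous_onI cont_iter)
  note [measurable] = u(1) \<rho>(1) f(1)
  have "(\<lambda>x. (\<lambda>(\<xi>, \<eta>). G' \<xi> \<eta>) ((u x, \<Phi> n x, \<rho> (rotation (real n * \<alpha>) x)), (0, \<psi>0 x ** \<Phi> n x, 0))) \<in> borel_measurable torus" for n
    by (rule measurable_compose[OF _ borel_measurable_continuous_onI[OF G(2)]]) measurable
  then have [measurable]: "(\<lambda>x. G' (u x, \<Phi> n x, \<rho> (rotation (real n * \<alpha>) x)) (0, \<psi>0 x ** \<Phi> n x, 0)) \<in> borel_measurable torus" for n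
    by simp
  have eq: "(\<integral>x. f n x \<partial>torus) = (\<integral>x. G' (u x, \<Phi> n x, \<rho> (rotation (real n * \<alpha>) x)) (0, \<psi>0 x ** \<Phi> n x, 0) \<partial>torus)" for n
  proof (rule integral_cong_AE)
    show "AE x in torus. f n x = G' (u x, \<Phi> n x, \<rho> (rotation (real n * \<alpha>) x)) (0, \<psi>0 x ** \<Phi> n x, 0)"
      using f(2) by eventually_elim simp
  qed measurable
  obtain B where B: "\<And>x. norm (\<phi>' x) \<le> B" using bounded_deriv by blast
  define C where "C = B + 2 + 2 * d + K"
  have "0 \<le> B" using B[of 0] norm_ge_zero order_trans by blast
  moreover have "0 \<le> K" using order_trans[OF norm_ge_zero u(2)[of 0]] by simp
  ultimately have C: "B \<le> C" "2 \<le> C" "2 * d \<le> C" "K \<le> C" using d by (auto simp: C_def)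
  show ?thesis unfolding eq
  proof (rule oscillation[where u = u and \<rho> = \<rho> and \<Phi> = \<Phi> and \<Phi>' = \<Phi>' and Y = "\<lambda>n x. \<psi>0 x ** \<Phi> n x"
      and G = G and G' = G' and \<alpha> = \<alpha> and B = C])
    show "norm (\<Phi> n x) \<le> C" for n x using norm_SU2[OF SU2_iter[of n x]] C by linarith
    show "norm (\<Phi>' n x) \<le> real n * C" for n x
      using norm_deriv_iter[OF B, of n x] mult_left_mono[OF C(1), of "real n"] by linarith
    show "(\<lambda>x. \<psi>0 x ** \<Phi> n x) \<in> borel_measurable torus" for n by measurable
    show "norm (\<psi>0 x ** \<Phi> n x) \<le> C" for n x
      using \<psi>0_bound[of x] C by (simp add: norm_mult_SU2 SU2_iter)
    show "AE x in torus. (\<lambda>n. (1 / real n) *\<^sub>R \<Phi>' n x - \<psi>0 x ** \<Phi> n x) \<longlonglongrightarrow> 0"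
      using \<psi>_lim \<psi>0_eq
    proof eventually_elim
      case (elim x)
      \<comment> \<open>Right multiplication by \<open>\<Phi> n x\<close> is an isometry, so
        convergence of the logarithmic derivatives passes to this difference although
        \<open>\<Phi> n x\<close> itself does not converge.\<close>
      have "(1 / real n) *\<^sub>R \<Phi>' n x - \<psi>0 x ** \<Phi> n x = (log_deriv_avg \<alpha> \<phi> n x - \<psi> x) ** \<Phi> n x" for n
        using elim SU2_D(2)[OF SU2_iter[of n x]]
        by (simp add: log_deriv_avg_eq bounded_bilinear.diff_left[OF bounded_bilinear_mat2] flip: matrix_mul_assoc)
      then have "norm ((1 / real n) *\<^sub>R \<Phi>' n x - \<psi>0 x ** \<Phi> n x) = norm (log_deriv_avg \<alpha> \<phi> n x - \<psi> x)" for n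
        by (simp add: norm_mult_SU2 SU2_iter)
      moreover have "(\<lambda>n. norm (log_deriv_avg \<alpha> \<phi> n x - \<psi> x)) \<longlonglongrightarrow> 0"
        by (rule tendsto_norm_zero, rule LIM_zero) (use elim in blast)
      ultimately show ?case by - (rule tendsto_norm_zero_cancel, simp)
    qed
    show "norm (u x) \<le> C" "norm (\<rho> x) \<le> C" if "x \<in> {0..<1}" for x
      using u(2)[OF that] \<rho>(2)[OF that] C by linarith+
  qed (rule deriv_iter cont_deriv_iter u(1) \<rho>(1) G)+
qed

lemma data_bound:
  assumes "cmod c \<le> K" "U \<in> SU2"
  shows "norm (c, U) \<le> K + 2"
  using norm_Pair_le[of c U] assms norm_SU2[of U] by linarith

text \<open>
  The lower left entry \<open>h\<close> of \<open>q\<close> satisfies \<open>h (x) = \<gamma> (x)\<^sup>-\<^sup>2 h (x + \<alpha>)\<close>. It vanishes by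
  applying the oscillation principle to \<open>W\<^sub>2\<^sub>1 * cnj W\<^sub>1\<^sub>1\<close>, where \<open>W = p \<Phi> p\<^sup>*\<close>: this function is zero
  along the diagonal cocycle, but its derivative in the direction \<open>q W\<close> is \<open>h\<close>.
\<close>

lemma q_off_diagonal: "AE x in torus. q x $ 2 $ 1 = 0"
proof -
  interpret prob_space torus by (rule prob_space_torus)
  \<comment> \<open>The conjugate of the entry serves as weight, so that the limiting integrand is
    its squared modulus, independent of \<open>n\<close>. A constant sequence tending to 0 is
    0.\<close>
  define u where "u x = (cnj (q x $ 2 $ 1), p x)" for x
  define \<rho> where "\<rho> x = (1 :: complex, conj_transpose (p x))" for x
  define G :: "(complex \<times> (complex^2^2)) \<times> (complex^2^2) \<times> (complex \<times> (complex^2^2)) \<Rightarrow> complex"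
    where "G \<xi> = fst (fst \<xi>) * (mat2_sandwich \<xi> $ 2 $ 1 * cnj (mat2_sandwich \<xi> $ 1 $ 1))" for \<xi>
  define G' :: "(complex \<times> (complex^2^2)) \<times> (complex^2^2) \<times> (complex \<times> (complex^2^2)) \<Rightarrow> _ \<Rightarrow> complex"
    where "G' \<xi> \<eta> = fst (fst \<xi>) * (mat2_sandwich \<xi> $ 2 $ 1 * cnj (mat2_sandwich_deriv \<xi> \<eta> $ 1 $ 1)
      + mat2_sandwich_deriv \<xi> \<eta> $ 2 $ 1 * cnj (mat2_sandwich \<xi> $ 1 $ 1))
      + fst (fst \<eta>) * (mat2_sandwich \<xi> $ 2 $ 1 * cnj (mat2_sandwich \<xi> $ 1 $ 1))" for \<xi> \<eta>
  have "(\<lambda>n::nat. \<integral>x. complex_of_real ((cmod (q x $ 2 $ 1))\<^sup>2) \<partial>torus) \<longlonglongrightarrow> 0"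
  proof (rule oscillation_iter[where G = G and G' = G' and u = u and \<rho> = \<rho> and K = "2 * d + 3"])
     show "u \<in> borel_measurable torus" "\<rho> \<in> borel_measurable torus" unfolding u_def \<rho>_def by measurable
    show "norm (u x) \<le> 2 * d + 3" for x
      using data_bound[of "cnj (q x $ 2 $ 1)" "2 * d" "p x"] q_bound[of x 2 1] p_SU2 by (simp add: u_def)
    show "norm (\<rho> x) \<le> 2 * d + 3" for x
      using data_bound[of 1 1 "conj_transpose (p x)"] p_SU2 d by (simp add: \<rho>_def SU2_conj_transpose)
    show "(G has_derivative G' \<xi>) (at \<xi>)" for \<xi>
      unfolding G_def G'_def
      by (intro has_derivative_mult has_derivative_fst has_derivative_ident has_derivative_cnj has_derivative_mat2_sandwich_nth)
    show "continuous_on UNIV (\<lambda>(\<xi>, \<eta>). G' \<xi> \<eta>)"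
      unfolding G'_def case_prod_beta by (intro continuous_intros continuous_on_mat2_sandwich)
    show "(\<lambda>x. complex_of_real ((cmod (q x $ 2 $ 1))\<^sup>2)) \<in> borel_measurable torus" by measurable
    show "AE x in torus. \<forall>n. G' (u x, \<Phi> n x, \<rho> (rotation (real n * \<alpha>) x)) (0, \<psi>0 x ** \<Phi> n x, 0) = of_real ((cmod (q x $ 2 $ 1))\<^sup>2)"
      using diagonal_iter
    proof eventually_elim
      case (elim x)
      show ?case
      proof
        fix n
        note D = elim[rule_format, of n]
        have "cmod (scalar_iter \<alpha> \<gamma> n x) = 1" by (rule norm_scalar_iter)
        then have g: "scalar_iter \<alpha> \<gamma> n x * cnj (scalar_iter \<alpha> \<gamma> n x) = 1"
          by (simp flip: complex_norm_square)
        have "G' (u x, \<Phi> n x, \<rho> (rotation (real n * \<alpha>) x)) (0, \<psi>0 x ** \<Phi> n x, 0)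
          = cnj (q x $ 2 $ 1) * (q x $ 2 $ 1 * scalar_iter \<alpha> \<gamma> n x * cnj (scalar_iter \<alpha> \<gamma> n x))"
          by (simp add: G'_def u_def \<rho>_def mat2_sandwich_def mat2_sandwich_deriv_def D sandwich_\<psi>0 mat2_mult_nth)
        also have "\<dots> = (q x $ 2 $ 1 * cnj (q x $ 2 $ 1)) * (scalar_iter \<alpha> \<gamma> n x * cnj (scalar_iter \<alpha> \<gamma> n x))"
          by (simp only: mult_ac)
        finally show "G' (u x, \<Phi> n x, \<rho> (rotation (real n * \<alpha>) x)) (0, \<psi>0 x ** \<Phi> n x, 0) = of_real ((cmod (q x $ 2 $ 1))\<^sup>2)"
          by (simp only: g mult_1_right complex_norm_square)
      qed
    qed
  qed
  then have "(\<integral>x. complex_of_real ((cmod (q x $ 2 $ 1))\<^sup>2) \<partial>torus) = 0"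
    by (simp add: LIMSEQ_const_iff)
  then have "(\<integral>x. (cmod (q x $ 2 $ 1))\<^sup>2 \<partial>torus) = 0"
    by (simp only: integral_complex_of_real of_real_eq_0_iff)
  moreover have "integrable torus (\<lambda>x. (cmod (q x $ 2 $ 1))\<^sup>2)"
  proof (rule integrable_torus_bounded[where B="(2 * d)\<^sup>2"])
    show "norm ((cmod (q x $ 2 $ 1))\<^sup>2) \<le> (2 * d)\<^sup>2" for x
      using power_mono[OF q_bound norm_ge_zero, of x 2 1 2] by simp
  qed measurable
  ultimately have "AE x in torus. (cmod (q x $ 2 $ 1))\<^sup>2 = 0"
    by (subst (asm) integral_nonneg_eq_0_iff_AE) auto
  then show ?thesis by simp
qed

lemma q_diagonal: "AE x in torus. cmod (q x $ 1 $ 1) = d"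
  using q_norm q_off_diagonal
proof eventually_elim
  case (elim x)
  then have "(cmod (q x $ 1 $ 1))\<^sup>2 = d\<^sup>2" by simp
  then show ?case using d by (simp add: power2_eq_iff_nonneg)
qed

theorem scalar_iter_oscillation:
  assumes b: "b \<in> borel_measurable torus" "\<And>x. x \<in> {0..<1} \<Longrightarrow> cmod (b x) \<le> K"
    and a: "a \<in> borel_measurable torus" "\<And>x. x \<in> {0..<1} \<Longrightarrow> cmod (a x) \<le> K" and m: "0 < m"
  shows "(\<lambda>n. \<integral>x. b x * scalar_iter \<alpha> \<gamma> n x ^ m * a (rotation (real n * \<alpha>) x) \<partial>torus) \<longlonglongrightarrow> 0"
proof -
  \<comment> \<open>Along the diagonal cocycle the derivative of the \<open>m\<close>-th power
    carries the factor \<open>m * q\<^sub>1\<^sub>1\<close>; this weight removes it and leaves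
    \<open>b\<close>. Since \<open>m\<close> is at least 1, it is bounded by \<open>K / d\<close>.
    The value 0 is taken only on a null set.\<close>
  define c where "c x = (if cmod (q x $ 1 $ 1) = d then b x / (of_nat m * q x $ 1 $ 1) else 0)" for x
  define u where "u x = (c x, p x)" for x
  define \<rho> where "\<rho> x = (a x, conj_transpose (p x))" for x
  define G :: "(complex \<times> (complex^2^2)) \<times> (complex^2^2) \<times> (complex \<times> (complex^2^2)) \<Rightarrow> complex"
    where "G \<xi> = fst (fst \<xi>) * fst (snd (snd \<xi>)) * (mat2_sandwich \<xi> $ 1 $ 1) ^ m" for \<xi>
  define G' :: "(complex \<times> (complex^2^2)) \<times> (complex^2^2) \<times> (complex \<times> (complex^2^2)) \<Rightarrow> _ \<Rightarrow> complex"
    where "G' \<xi> \<eta> = fst (fst \<xi>) * fst (snd (snd \<xi>)) *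
         (of_nat m * (mat2_sandwich_deriv \<xi> \<eta> $ 1 $ 1) * (mat2_sandwich \<xi> $ 1 $ 1) ^ (m - 1))
      + (fst (fst \<xi>) * fst (snd (snd \<eta>)) + fst (fst \<eta>) * fst (snd (snd \<xi>))) * (mat2_sandwich \<xi> $ 1 $ 1) ^ m" for \<xi> \<eta>
  note [measurable] = a(1) b(1)
  have K: "0 \<le> K" using order_trans[OF norm_ge_zero a(2)[of 0]] by simp
  have cm[measurable]: "c \<in> borel_measurable torus" unfolding c_def by measurable
  show ?thesis
  proof (rule oscillation_iter[where G = G and G' = G' and u = u and \<rho> = \<rho> and K = "K / d + K + 2"])
    show "u \<in> borel_measurable torus" "\<rho> \<in> borel_measurable torus" unfolding u_def \<rho>_def by measurable
    show "norm (u x) \<le> K / d + K + 2" if x: "x \<in> {0..<1}" for x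
    proof -
      have "cmod (b x) / (real m * d) \<le> K / (1 * d)"
        using b(2)[OF x] d m K by (intro frac_le mult_right_mono) auto
      then have "cmod (c x) \<le> K / d" using K d by (auto simp: c_def norm_divide norm_mult)
      then have "norm (u x) \<le> K / d + 2" unfolding u_def by (rule data_bound) (rule p_SU2)
      then show ?thesis using K by simp
    qed
    show "norm (\<rho> x) \<le> K / d + K + 2" if x: "x \<in> {0..<1}" for x
    proof -
      have "norm (\<rho> x) \<le> K + 2" unfolding \<rho>_def
        by (rule data_bound) (use a(2)[OF x] p_SU2 SU2_conj_transpose in auto)
      moreover have "0 \<le> K / d" using K d by simp
      ultimately show ?thesis by linarith
    qed
    show "(G has_derivative G' \<xi>) (at \<xi>)" for \<xi>
      unfolding G_def G'_def
      by (intro has_derivative_mult has_derivative_power has_derivative_fst has_derivative_snd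
           has_derivative_ident has_derivative_mat2_sandwich_nth)
    show "continuous_on UNIV (\<lambda>(\<xi>, \<eta>). G' \<xi> \<eta>)"
      unfolding G'_def case_prod_beta by (intro continuous_intros continuous_on_mat2_sandwich)
    show "(\<lambda>x. b x * scalar_iter \<alpha> \<gamma> n x ^ m * a (rotation (real n * \<alpha>) x)) \<in> borel_measurable torus" for n
      by measurable
    show "AE x in torus. \<forall>n. G' (u x, \<Phi> n x, \<rho> (rotation (real n * \<alpha>) x)) (0, \<psi>0 x ** \<Phi> n x, 0)
       = b x * scalar_iter \<alpha> \<gamma> n x ^ m * a (rotation (real n * \<alpha>) x)"
      using diagonal_iter q_diagonal
    proof eventually_elim
      case (elim x)
      have q0: "q x $ 1 $ 1 \<noteq> 0" using elim(2) d by auto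
      show ?case
      proof
        fix n
        note D = elim(1)[rule_format, of n]
        have "G' (u x, \<Phi> n x, \<rho> (rotation (real n * \<alpha>) x)) (0, \<psi>0 x ** \<Phi> n x, 0)
          = c x * a (rotation (real n * \<alpha>) x) * (of_nat m * (q x $ 1 $ 1 * scalar_iter \<alpha> \<gamma> n x) * scalar_iter \<alpha> \<gamma> n x ^ (m - 1))"
          by (simp add: G'_def u_def \<rho>_def mat2_sandwich_def mat2_sandwich_deriv_def D sandwich_\<psi>0 mat2_mult_nth)
        also have "\<dots> = (c x * (of_nat m * q x $ 1 $ 1)) * a (rotation (real n * \<alpha>) x) * (scalar_iter \<alpha> \<gamma> n x * scalar_iter \<alpha> \<gamma> n x ^ (m - 1))"
          by (simp only: mult_ac)
        also have "c x * (of_nat m * q x $ 1 $ 1) = b x" using q0 elim(2) m by (simp add: c_def)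
        also have "scalar_iter \<alpha> \<gamma> n x * scalar_iter \<alpha> \<gamma> n x ^ (m - 1) = scalar_iter \<alpha> \<gamma> n x ^ m"
          using power_minus_mult[OF m, of "scalar_iter \<alpha> \<gamma> n x"] by (simp add: mult.commute)
        finally show "G' (u x, \<Phi> n x, \<rho> (rotation (real n * \<alpha>) x)) (0, \<psi>0 x ** \<Phi> n x, 0)
            = b x * scalar_iter \<alpha> \<gamma> n x ^ m * a (rotation (real n * \<alpha>) x)" by (simp add: mult_ac)
      qed
    qed
  qed
qed

end

subsection \<open>Ergodicity of irrational rotations\<close>

lemma AE_invariant_rotation_iter:
  assumes "AE x in torus. f (rotation \<alpha> x) = f x"
  shows "AE x in torus. f (rotation (real n * \<alpha>) x) = f x"
proof (induction n)
  case 0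
  have "AE x in torus. x \<in> {0..<1}" by (metis AE_space space_torus)
  then show ?case by eventually_elim simp
next
  case (Suc n)
  from AE_rotation[OF Suc, of \<alpha>] assms show ?case
    by eventually_elim (simp add: rotation_rotation algebra_simps)
qed

text \<open>A smooth \<open>v\<close> within \<open>e\<close> of \<open>f\<close> in
  \<open>L1\<close> is almost invariant under the orbit of \<open>\<alpha>\<close>, hence by density
  of the orbit under every translation, up to \<open>2 * e\<close>. Averaging over all translations
  compares \<open>v\<close> with its mean; the comparisons of \<open>f\<close> with \<open>v\<close>
  and of the two means add \<open>e\<close> each, giving \<open>4 * e\<close>.\<close>

lemma irrational_rotation_invariant_const:
  fixes f :: "real \<Rightarrow> real"
  assumes irr: "\<alpha> \<notin> \<rat>" and f: "f \<in> borel_measurable torus" "\<And>x. x \<in> {0..<1} \<Longrightarrow> \<bar>f x\<bar> \<le> K"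
    and inv: "AE x in torus. f (rotation \<alpha> x) = f x"
  shows "AE x in torus. f x = (\<integral>y. f y \<partial>torus)"
proof -
  interpret prob_space torus by (rule prob_space_torus)
  interpret TT: pair_sigma_finite torus torus ..
  interpret TT: finite_measure "torus \<Otimes>\<^sub>M torus" by (rule finite_measure_pair_measure) unfold_locales
  note [measurable] = f(1)
  have intf: "integrable torus f" by (rule integrable_torus_bounded[where B=K]) (use f in auto)
  have small: "(\<integral>x. \<bar>f x - (\<integral>y. f y \<partial>torus)\<bar> \<partial>torus) \<le> 4 * e" if e: "0 < e" for e
  proof -
    obtain v v' where v: "\<And>x. (v has_vector_derivative v' x) (at x)" "continuous_on UNIV v'" "bounded (range v')"
        "\<And>x. v (frac x) = v x" "\<And>x. norm (v x) \<le> K + 1" "(\<integral>x. norm (v x - f x) \<partial>torus) < e"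
      using smooth_approx_torus[of f K e] f e by auto
    obtain D where D: "\<And>x. norm (v' x) \<le> D" using v(3) unfolding bounded_iff by auto
    have lip: "\<bar>v x - v y\<bar> \<le> D * \<bar>x - y\<bar>" for x y
      using field_differentiable_bound[of UNIV v v' D x y] v(1) D
      by (simp add: has_real_derivative_iff_has_vector_derivative)
    have vc: "continuous_on UNIV v"
      using v(1) by (meson continuous_at_imp_continuous_on has_vector_derivative_continuous)
    have vb[measurable]: "v \<in> borel_measurable borel" using vc by (rule borel_measurable_continuous_onI)
    have vt[measurable]: "v \<in> borel_measurable torus" by (rule borel_imp_torus) measurable
    have vs[measurable]: "(\<lambda>x. v (x + t)) \<in> borel_measurable torus" for t by (rule borel_imp_torus) measurable
    have intv: "integrable torus (\<lambda>x. v (x + t))" for t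
      by (rule integrable_torus_bounded[where B="K + 1"]) (use v in auto)
    note intv0 = intv[of 0, simplified]
    have vrot: "v (rotation s x) = v (x + s)" for s x by (simp add: rotation_def v(4))
    define c where "c = (\<integral>x. v x \<partial>torus)"
    have shift: "(\<integral>x. \<bar>v (x + t) - v x\<bar> \<partial>torus) \<le> 2 * e" if t: "t \<in> {0..<1}" for t
    proof (rule field_le_epsilon)
      fix \<epsilon> :: real assume \<epsilon>: "0 < \<epsilon>"
      have D0: "0 \<le> D" using D[of 0] norm_ge_zero order_trans by blast
      \<comment> \<open>Kronecker's theorem supplies a multiple of \<open>\<alpha>\<close> close to
        \<open>t\<close> modulo 1; with the Lipschitz constant \<open>D\<close> of \<open>v\<close>
        the two translates differ uniformly by at most \<open>\<epsilon>\<close>.\<close>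
      obtain k where k: "\<bar>frac (real k * \<alpha>) - t\<bar> < \<epsilon> / (D + 1)"
        using Kronecker_approx_1_explicit[OF irr, of t "\<epsilon> / (D + 1)"] t \<epsilon> D0 by auto
      let ?s = "real k * \<alpha>"
      have close: "\<bar>v (x + t) - v (x + ?s)\<bar> \<le> \<epsilon>" for x
      proof -
        have "v (x + ?s) = v (x + frac ?s)"
          by (metis v(4) frac_add_frac add.commute)
        then have "\<bar>v (x + t) - v (x + ?s)\<bar> \<le> D * \<bar>t - frac ?s\<bar>" using lip[of "x + t" "x + frac ?s"] by simp
        also have "\<dots> \<le> D * (\<epsilon> / (D + 1))" using k D0 by (intro mult_left_mono) auto
        also have "\<dots> \<le> \<epsilon>" using D0 \<epsilon> by (simp add: field_simps)
        finally show ?thesis .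
      qed
      have i1: "integrable torus (\<lambda>x. \<bar>v (rotation ?s x) - f (rotation ?s x)\<bar>)"
      proof (rule integrable_torus_bounded[where B="K + 1 + K"])
        have "(\<lambda>x. \<bar>v x - f x\<bar>) \<in> borel_measurable torus" by measurable
        then show "(\<lambda>x. \<bar>v (rotation ?s x) - f (rotation ?s x)\<bar>) \<in> borel_measurable torus"
          by (rule measurable_compose[OF rotation_measurable])
        show "norm \<bar>v (rotation ?s x) - f (rotation ?s x)\<bar> \<le> K + 1 + K" for x
          using v(5)[of "rotation ?s x"] f(2)[of "rotation ?s x"] by (auto simp: abs_le_iff)
      qed
      have i2: "integrable torus (\<lambda>x. \<bar>v x - f x\<bar>)" using intv0 intf by auto
      have "(\<integral>x. \<bar>v (x + t) - v x\<bar> \<partial>torus) \<le> (\<integral>x. \<epsilon> + (\<bar>v (rotation ?s x) - f (rotation ?s x)\<bar> + \<bar>v x - f x\<bar>) \<partial>torus)"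
      proof (rule integral_mono_AE)
        show "AE x in torus. \<bar>v (x + t) - v x\<bar> \<le> \<epsilon> + (\<bar>v (rotation ?s x) - f (rotation ?s x)\<bar> + \<bar>v x - f x\<bar>)"
          using AE_invariant_rotation_iter[OF inv, of k]
        proof eventually_elim
          case (elim x)
          then show ?case using close[of x] vrot[of ?s x] by linarith
        qed
      qed (use intv intv0 i1 i2 in auto)
      also have "\<dots> = \<epsilon> + ((\<integral>x. \<bar>v (rotation ?s x) - f (rotation ?s x)\<bar> \<partial>torus) + (\<integral>x. \<bar>v x - f x\<bar> \<partial>torus))"
        using i1 i2 prob_space by simp
      also have "(\<integral>x. \<bar>v (rotation ?s x) - f (rotation ?s x)\<bar> \<partial>torus) = (\<integral>x. \<bar>v x - f x\<bar> \<partial>torus)"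
        by (rule integral_rotation) measurable
      finally show "(\<integral>x. \<bar>v (x + t) - v x\<bar> \<partial>torus) \<le> 2 * e + \<epsilon>" using v(6) by simp
    qed
    \<comment> \<open>By rotation invariance the mean \<open>c\<close> is also the average of
      \<open>v (x + t)\<close> over \<open>t\<close>. Fubini then turns the bound
      \<open>shift\<close>, which holds for each fixed \<open>t\<close>, into a bound for the
      distance of \<open>v\<close> from \<open>c\<close>.\<close>
    have cx: "\<bar>v x - c\<bar> \<le> (\<integral>t. \<bar>v (x + t) - v x\<bar> \<partial>torus)" for x
    proof -
      have i: "integrable torus (\<lambda>t. v (x + t))" using intv[of x] by (simp add: add.commute)
      have "c = (\<integral>t. v (rotation x t) \<partial>torus)" unfolding c_def by (rule integral_rotation[symmetric]) measurable
      also have "\<dots> = (\<integral>t. v (x + t) \<partial>torus)" by (simp add: vrot add.commute)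
      finally have "c - v x = (\<integral>t. v (x + t) - v x \<partial>torus)" using i prob_space by simp
      then have "\<bar>v x - c\<bar> = \<bar>\<integral>t. v (x + t) - v x \<partial>torus\<bar>" by linarith
      also have "\<dots> \<le> (\<integral>t. \<bar>v (x + t) - v x\<bar> \<partial>torus)" by (rule integral_abs_bound)
      finally show ?thesis .
    qed
    let ?h = "\<lambda>(x, t). \<bar>v (x + t) - v x\<bar>"
    have hb: "\<bar>v (x + t) - v x\<bar> \<le> K + 1 + (K + 1)" for x t
      using v(5)[of "x + t"] v(5)[of x] by (simp add: abs_le_iff)
    have [measurable]: "fst \<in> torus \<Otimes>\<^sub>M torus \<rightarrow>\<^sub>M borel" "snd \<in> torus \<Otimes>\<^sub>M torus \<rightarrow>\<^sub>M borel"
      by (rule measurable_compose[OF measurable_fst id_torus_measurable] measurable_compose[OF measurable_snd id_torus_measurable])+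
    have "(\<lambda>w. \<bar>v (fst w + snd w) - v (fst w)\<bar>) \<in> borel_measurable (torus \<Otimes>\<^sub>M torus)" by measurable
    then have inth: "integrable (torus \<Otimes>\<^sub>M torus) ?h"
      by (intro TT.integrable_const_bound[where B="K + 1 + (K + 1)"] AE_I2) (use hb in \<open>auto simp: case_prod_beta\<close>)
    have "(\<integral>x. \<bar>v x - c\<bar> \<partial>torus) \<le> (\<integral>x. (\<integral>t. \<bar>v (x + t) - v x\<bar> \<partial>torus) \<partial>torus)"
      by (rule integral_mono) (use cx intv0 TT.integrable_fst'[OF inth] in auto)
    also have "\<dots> = (\<integral>t. (\<integral>x. \<bar>v (x + t) - v x\<bar> \<partial>torus) \<partial>torus)"
      using TT.Fubini_integral[OF inth] by simp
    also have "\<dots> \<le> (\<integral>t. 2 * e \<partial>torus)"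
      by (rule integral_mono_AE) (use TT.integrable_snd[of "\<lambda>x t. \<bar>v (x + t) - v x\<bar>"] inth shift in auto)
    finally have vce: "(\<integral>x. \<bar>v x - c\<bar> \<partial>torus) \<le> 2 * e" using prob_space by simp
    have cf: "\<bar>c - (\<integral>y. f y \<partial>torus)\<bar> \<le> e"
    proof -
      have "c - (\<integral>y. f y \<partial>torus) = (\<integral>y. v y - f y \<partial>torus)" unfolding c_def using intv0 intf by simp
      then have "\<bar>c - (\<integral>y. f y \<partial>torus)\<bar> = \<bar>\<integral>y. v y - f y \<partial>torus\<bar>" by simp
      also have "\<dots> \<le> (\<integral>y. \<bar>v y - f y\<bar> \<partial>torus)" by (rule integral_abs_bound)
      finally show ?thesis using v(6) by simp
    qed
    have "(\<integral>x. \<bar>f x - (\<integral>y. f y \<partial>torus)\<bar> \<partial>torus) \<le> (\<integral>x. \<bar>v x - f x\<bar> + \<bar>v x - c\<bar> + e \<partial>torus)"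
    proof (rule integral_mono)
      fix x show "\<bar>f x - (\<integral>y. f y \<partial>torus)\<bar> \<le> \<bar>v x - f x\<bar> + \<bar>v x - c\<bar> + e" using cf by linarith
    qed (use intv0 intf in auto)
    also have "\<dots> = (\<integral>x. \<bar>v x - f x\<bar> \<partial>torus) + (\<integral>x. \<bar>v x - c\<bar> \<partial>torus) + e"
      using intv0 intf prob_space by simp
    also have "\<dots> \<le> 4 * e" using v(6) vce by simp
    finally show ?thesis .
  qed
  have "(\<integral>x. \<bar>f x - (\<integral>y. f y \<partial>torus)\<bar> \<partial>torus) \<le> 0"
  proof (rule field_le_epsilon)
    fix e :: real assume "0 < e"
    then show "(\<integral>x. \<bar>f x - (\<integral>y. f y \<partial>torus)\<bar> \<partial>torus) \<le> 0 + e" using small[of "e/4"] by simp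
  qed
  moreover have "0 \<le> (\<integral>x. \<bar>f x - (\<integral>y. f y \<partial>torus)\<bar> \<partial>torus)" by simp
  ultimately have "(\<integral>x. \<bar>f x - (\<integral>y. f y \<partial>torus)\<bar> \<partial>torus) = 0" by linarith
  then have "AE x in torus. \<bar>f x - (\<integral>y. f y \<partial>torus)\<bar> = 0"
    using intf by (subst (asm) integral_nonneg_eq_0_iff_AE) auto
  then show ?thesis by simp
qed

subsection \<open>Circle extensions\<close>

lemma cis_torus_measurable: "(\<lambda>t. cis (2 * pi * t)) \<in> torus \<rightarrow>\<^sub>M restrict_space borel (sphere 0 1)"
  by (intro measurable_restrict_space2 borel_imp_torus borel_measurable_continuous_onI continuous_intros) auto

lemma space_circle [simp]: "space circle_measure = sphere 0 1"
  by (simp add: circle_measure_def space_restrict_space)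

lemma sets_circle: "sets circle_measure = sets (restrict_space borel (sphere 0 1))"
  by (simp add: circle_measure_def)

lemma prob_space_circle: "prob_space circle_measure"
proof -
  interpret prob_space torus by (rule prob_space_torus)
  show ?thesis unfolding circle_measure_def by (rule prob_space_distr) (rule cis_torus_measurable)
qed

lemma id_circle_measurable: "(\<lambda>z. z) \<in> circle_measure \<rightarrow>\<^sub>M borel"
  by (subst measurable_cong_sets[OF sets_circle refl]) (simp add: measurable_restrict_space1)

lemma measurable_circleI:
  assumes "f \<in> borel_measurable M" "\<And>x. x \<in> space M \<Longrightarrow> cmod (f x) = 1"
  shows "f \<in> M \<rightarrow>\<^sub>M circle_measure"
  by (subst measurable_cong_sets[OF refl sets_circle]) (use assms in \<open>auto intro!: measurable_restrict_space2\<close>)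

text \<open>In the angle parametrization, multiplication by \<open>w\<close> is the rotation by
  \<open>Arg w / (2 * pi)\<close>, whose invariance is known.\<close>

lemma nn_integral_circle_rotate:
  assumes f[measurable]: "f \<in> borel_measurable circle_measure" and w: "cmod w = 1"
  shows "(\<integral>\<^sup>+z. f (z * w) \<partial>circle_measure) = (\<integral>\<^sup>+z. f z \<partial>circle_measure)"
proof -
  define s where "s = Arg w / (2 * pi)"
  have ws: "w = cis (2 * pi * s)" using w cis_Arg[of w] by (cases "w = 0") (auto simp: s_def sgn_div_norm)
  have X: "(\<lambda>t. cis (2 * pi * t)) \<in> torus \<rightarrow>\<^sub>M circle_measure"
    using cis_torus_measurable measurable_cong_sets[OF refl sets_circle] by blast
  have D: "circle_measure = distr torus circle_measure (\<lambda>t. cis (2 * pi * t))"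
    unfolding circle_measure_def by (rule distr_cong) auto
  have mw: "(\<lambda>z. z * w) \<in> circle_measure \<rightarrow>\<^sub>M circle_measure"
    by (rule measurable_circleI) (use id_circle_measurable w in \<open>auto simp: norm_mult\<close>)
  have e: "cis (2 * pi * t) * w = cis (2 * pi * rotation s t)" for t
  proof -
    have "cis (2 * pi * (t + s)) = cis (2 * pi * frac (t + s)) * cis (2 * pi * of_int \<lfloor>t + s\<rfloor>)"
      by (simp add: cis_mult frac_def algebra_simps)
    also have "cis (2 * pi * of_int \<lfloor>t + s\<rfloor>) = 1" by (rule cis_multiple_2pi) auto
    finally show ?thesis by (simp add: ws cis_mult rotation_def algebra_simps)
  qed
  have "(\<integral>\<^sup>+z. f (z * w) \<partial>circle_measure) = (\<integral>\<^sup>+t. f (cis (2 * pi * t) * w) \<partial>torus)"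
    by (subst D, subst nn_integral_distr[OF X]) (use measurable_compose[OF mw f] in auto)
  also have "\<dots> = (\<integral>\<^sup>+t. f (cis (2 * pi * t)) \<partial>torus)"
    unfolding e by (rule nn_integral_rotation[where f="\<lambda>t. f (cis (2 * pi * t))"]) (rule measurable_compose[OF X f])
  also have "\<dots> = (\<integral>\<^sup>+z. f z \<partial>circle_measure)"
    by (subst D, subst nn_integral_distr[OF X]) auto
  finally show ?thesis .
qed

lemma space_skew [simp]: "space skew_space = {0..<1} \<times> sphere 0 1"
  by (simp add: skew_space_def space_pair_measure)

lemma prob_space_skew: "prob_space skew_space"
proof -
  interpret pair_prob_space torus circle_measure
    by (simp add: pair_prob_space_def pair_sigma_finite_def prob_space_torus prob_space_circle
        prob_space_imp_sigma_finite)
  show ?thesis unfolding skew_space_def by unfold_locales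
qed

lemma fst_skew [measurable]: "fst \<in> skew_space \<rightarrow>\<^sub>M torus" and snd_skew [measurable]: "snd \<in> skew_space \<rightarrow>\<^sub>M circle_measure"
  by (simp_all add: skew_space_def)

lemma fst_skew_borel [measurable]: "fst \<in> borel_measurable skew_space"
  and snd_skew_borel [measurable]: "snd \<in> borel_measurable skew_space"
  by (rule measurable_compose[OF fst_skew id_torus_measurable] measurable_compose[OF snd_skew id_circle_measurable])+

locale circle_extension =
  fixes \<alpha> :: real and \<gamma> :: "real \<Rightarrow> complex"
  assumes cocycle: "measurable_cocycle (sphere 0 1) \<gamma>"
begin

lemma norm_gamma [simp]: "cmod (\<gamma> x) = 1" and per: "periodic_fun_simple' \<gamma>"
  and meas [measurable]: "\<gamma> \<in> borel_measurable borel"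
  using cocycle by (auto simp: measurable_cocycle_def)

abbreviation "S \<equiv> skew_product \<alpha> \<gamma>"

lemma skew_measurable [measurable]: "S \<in> skew_space \<rightarrow>\<^sub>M skew_space"
proof -
  have "(\<lambda>w. rotation \<alpha> (fst w)) \<in> skew_space \<rightarrow>\<^sub>M torus" by measurable
  moreover have "(\<lambda>w. snd w * \<gamma> (fst w)) \<in> skew_space \<rightarrow>\<^sub>M circle_measure"
    by (rule measurable_circleI) (auto simp: norm_mult)
  ultimately have "(\<lambda>w. (rotation \<alpha> (fst w), snd w * \<gamma> (fst w))) \<in> skew_space \<rightarrow>\<^sub>M torus \<Otimes>\<^sub>M circle_measure"
    by (rule measurable_Pair)
  then show ?thesis by (simp add: skew_product_def case_prod_beta skew_space_def)
qed

text \<open>By Fubini: on each fibre the map is multiplication by a unit number, and afterwards only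
  the rotation of the base remains.\<close>

lemma nn_integral_skew:
  assumes f[measurable]: "f \<in> borel_measurable skew_space"
  shows "(\<integral>\<^sup>+w. f (S w) \<partial>skew_space) = (\<integral>\<^sup>+w. f w \<partial>skew_space)"
proof -
  interpret C: prob_space circle_measure by (rule prob_space_circle)
  have f': "f \<in> borel_measurable (torus \<Otimes>\<^sub>M circle_measure)" using f by (simp add: skew_space_def)
  have fS: "(\<lambda>w. f (S w)) \<in> borel_measurable (torus \<Otimes>\<^sub>M circle_measure)"
    using measurable_compose[OF skew_measurable f] by (simp add: skew_space_def)
  have "(\<integral>\<^sup>+w. f (S w) \<partial>skew_space) = (\<integral>\<^sup>+x. \<integral>\<^sup>+z. f (rotation \<alpha> x, z * \<gamma> x) \<partial>circle_measure \<partial>torus)"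
    unfolding skew_space_def by (subst C.nn_integral_fst[symmetric, OF fS]) (simp add: skew_product_def)
  also have "\<dots> = (\<integral>\<^sup>+x. \<integral>\<^sup>+z. f (rotation \<alpha> x, z) \<partial>circle_measure \<partial>torus)"
  proof (rule nn_integral_cong)
    fix x assume "x \<in> space torus"
    have "(\<lambda>z. f (rotation \<alpha> x, z)) \<in> borel_measurable circle_measure"
      by (rule measurable_compose[OF measurable_Pair1' f']) auto
    then show "(\<integral>\<^sup>+z. f (rotation \<alpha> x, z * \<gamma> x) \<partial>circle_measure) = (\<integral>\<^sup>+z. f (rotation \<alpha> x, z) \<partial>circle_measure)"
      by (rule nn_integral_circle_rotate) simp
  qed
  also have "\<dots> = (\<integral>\<^sup>+x. \<integral>\<^sup>+z. f (x, z) \<partial>circle_measure \<partial>torus)"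
    by (rule nn_integral_rotation[where f="\<lambda>x. \<integral>\<^sup>+z. f (x, z) \<partial>circle_measure"]) (rule C.borel_measurable_nn_integral_fst[OF f'])
  also have "\<dots> = (\<integral>\<^sup>+w. f w \<partial>skew_space)"
    unfolding skew_space_def by (rule C.nn_integral_fst[OF f'])
  finally show ?thesis .
qed

lemma distr_skew: "distr skew_space skew_space S = skew_space"
proof (rule measure_eqI)
  fix A assume "A \<in> sets (distr skew_space skew_space S)"
  then have [measurable]: "A \<in> sets skew_space" by simp
  have "emeasure (distr skew_space skew_space S) A = (\<integral>\<^sup>+x. indicator A x \<partial>distr skew_space skew_space S)"
    by simp
  also have "\<dots> = (\<integral>\<^sup>+x. indicator A (S x) \<partial>skew_space)"
    by (subst nn_integral_distr) auto
  also have "\<dots> = emeasure skew_space A"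
    by (subst nn_integral_skew) auto
  finally show "emeasure (distr skew_space skew_space S) A = emeasure skew_space A" .
qed simp

lemma AE_skew:
  assumes "AE w in skew_space. P w"
  shows "AE w in skew_space. P (S w)"
proof (rule AE_distrD[where P=P and M=skew_space])
  show "S \<in> skew_space \<rightarrow>\<^sub>M skew_space" by measurable
  show "AE x in distr skew_space skew_space S. P x"
    by (subst distr_skew) (rule assms)
qed

text \<open>The restriction on \<open>x\<close> matters for \<open>n = 0\<close>:
  \<open>rotation 0\<close> is the identity only on the fundamental domain.\<close>

lemma skew_iter:
  assumes "x \<in> {0..<1}"
  shows "(S ^^ n) (x, z) = (rotation (real n * \<alpha>) x, z * scalar_iter \<alpha> \<gamma> n x)"
proof (induction n)
  case 0
  then show ?case using assms by (simp add: scalar_iter_def)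
next
  case (Suc n)
  then show ?case
    by (simp add: skew_product_def rotation_rotation scalar_iter_def)
       (simp add: rotation_def periodic_frac[OF per] algebra_simps)
qed

lemma skew_iter_measurable [measurable]: "(S ^^ n) \<in> skew_space \<rightarrow>\<^sub>M skew_space"
  by (induction n) (auto intro: measurable_comp[OF _ skew_measurable] simp: measurable_ident id_def[symmetric])

text \<open>The inverse of the skew product is again a skew product, over the rotation by
  \<open>-\<alpha>\<close> with this cocycle. The locale therefore applies to the inverse as well,
  which gives surjectivity of the Koopman operator.\<close>

definition inv_gamma :: "real \<Rightarrow> complex" where "inv_gamma x = cnj (\<gamma> (x - \<alpha>))"

lemma inv_gamma_cocycle: "measurable_cocycle (sphere 0 1) inv_gamma"
proof -
  have "periodic_fun_simple' inv_gamma"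
    by unfold_locales (use periodic_add_int[OF per, of "x - \<alpha>" 1 for x] in \<open>simp add: inv_gamma_def algebra_simps\<close>)
  moreover have "inv_gamma \<in> borel_measurable borel" unfolding inv_gamma_def by measurable
  ultimately show ?thesis by (simp add: measurable_cocycle_def inv_gamma_def)
qed

lemma skew_inverse:
  assumes "w \<in> space skew_space"
  shows "skew_product (-\<alpha>) inv_gamma (S w) = w" "S (skew_product (-\<alpha>) inv_gamma w) = w"
proof -
  obtain x z where w: "w = (x, z)" "x \<in> {0..<1}" using assms by (cases w) auto
  have g: "\<gamma> y * cnj (\<gamma> y) = 1" "cnj (\<gamma> y) * \<gamma> y = 1" for y
    by (simp_all flip: complex_norm_square add: mult.commute[of "cnj _"])
  show "skew_product (-\<alpha>) inv_gamma (S w) = w"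
    using w(2) g periodic_frac(1)[OF per, of "x + \<alpha>" "-\<alpha>"]
    by (simp add: w(1) skew_product_def rotation_rotation inv_gamma_def mult.assoc) (simp add: rotation_def g)
  show "S (skew_product (-\<alpha>) inv_gamma w) = w"
    using w(2) g periodic_frac(2)[OF per, of "x - \<alpha>"]
    by (simp add: w(1) skew_product_def rotation_rotation inv_gamma_def mult.assoc) (simp add: rotation_def g)
qed

end

subsection \<open>Density of fibre polynomials\<close>

lemma L2_funD:
  assumes "f \<in> L2_fun M"
  shows "f \<in> borel_measurable M" "integrable M (\<lambda>w. (cmod (f w))\<^sup>2)"
  using assms by (auto simp: L2_fun_def)

lemma cmod_diff_square: "(cmod (a - b))\<^sup>2 \<le> 2 * (cmod a)\<^sup>2 + 2 * (cmod b)\<^sup>2"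
proof -
  have "(cmod (a - b))\<^sup>2 \<le> (cmod a + cmod b)\<^sup>2" by (intro power_mono norm_triangle_ineq4) auto
  also have "\<dots> \<le> 2 * (cmod a)\<^sup>2 + 2 * (cmod b)\<^sup>2"
    using zero_le_power2[of "cmod a - cmod b"] by (simp add: power2_eq_square algebra_simps)
  finally show ?thesis .
qed

lemma L2_fun_diff:
  assumes "f \<in> L2_fun M" "g \<in> L2_fun M"
  shows "(\<lambda>w. f w - g w) \<in> L2_fun M"
proof -
  note [measurable] = assms[THEN L2_funD(1)]
  have "integrable M (\<lambda>w. (cmod (f w - g w))\<^sup>2)"
  proof (rule Bochner_Integration.integrable_bound)
    show "integrable M (\<lambda>w. 2 * (cmod (f w))\<^sup>2 + 2 * (cmod (g w))\<^sup>2)"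
      using assms[THEN L2_funD(2)] by auto
    show "AE w in M. norm ((cmod (f w - g w))\<^sup>2) \<le> norm (2 * (cmod (f w))\<^sup>2 + 2 * (cmod (g w))\<^sup>2)"
      using cmod_diff_square by (intro AE_I2) auto
  qed measurable
  then show ?thesis by (simp add: L2_fun_def)
qed

lemma L2_fun_cnj: "f \<in> L2_fun M \<Longrightarrow> (\<lambda>w. cnj (f w)) \<in> L2_fun M"
  by (auto simp: L2_fun_def intro: borel_measurable_cnj)

lemma L2_fun_mult_integrable:
  assumes "f \<in> L2_fun M" "g \<in> L2_fun M"
  shows "integrable M (\<lambda>w. f w * g w)"
proof (rule Bochner_Integration.integrable_bound)
  note [measurable] = assms[THEN L2_funD(1)]
  show "integrable M (\<lambda>w. (cmod (f w))\<^sup>2 + (cmod (g w))\<^sup>2)"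
    using assms[THEN L2_funD(2)] by auto
  show "(\<lambda>w. f w * g w) \<in> borel_measurable M" by measurable
  show "AE w in M. norm (f w * g w) \<le> norm ((cmod (f w))\<^sup>2 + (cmod (g w))\<^sup>2)"
  proof (rule AE_I2)
    fix w
    have "cmod (f w) * cmod (g w) \<le> 2 * (cmod (f w) * cmod (g w))" by simp
    also have "\<dots> \<le> (cmod (f w))\<^sup>2 + (cmod (g w))\<^sup>2"
      using sum_squares_bound[of "cmod (f w)" "cmod (g w)"] by simp
    finally show "norm (f w * g w) \<le> norm ((cmod (f w))\<^sup>2 + (cmod (g w))\<^sup>2)"
      by (simp add: norm_mult)
  qed
qed

lemma L2_fun_bounded:
  assumes "finite_measure M" "f \<in> borel_measurable M" "\<And>w. w \<in> space M \<Longrightarrow> cmod (f w) \<le> K"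
  shows "f \<in> L2_fun M"
proof -
  interpret finite_measure M by fact
  note [measurable] = assms(2)
  have "integrable M (\<lambda>w. (cmod (f w))\<^sup>2)"
    by (rule integrable_const_bound[where B="K\<^sup>2"]) (use assms(3) in \<open>auto intro!: power_mono\<close>)
  then show ?thesis using assms(2) by (simp add: L2_fun_def)
qed

lemma L2_fun_compose:
  assumes T: "T \<in> M \<rightarrow>\<^sub>M M" "distr M M T = M" and f: "f \<in> L2_fun M"
  shows "(\<lambda>w. f (T w)) \<in> L2_fun M"
    and "(\<integral>w. (cmod (f (T w)))\<^sup>2 \<partial>M) = (\<integral>w. (cmod (f w))\<^sup>2 \<partial>M)"
proof -
  note [measurable] = T(1) L2_funD(1)[OF f]
  have "integrable (distr M M T) (\<lambda>w. (cmod (f w))\<^sup>2)" using L2_funD(2)[OF f] T(2) by simp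
  then have "integrable M (\<lambda>w. (cmod (f (T w)))\<^sup>2)" by (rule integrable_distr[OF T(1)])
  moreover have "(\<lambda>w. f (T w)) \<in> borel_measurable M" by measurable
  ultimately show "(\<lambda>w. f (T w)) \<in> L2_fun M" by (simp add: L2_fun_def)
  have "(\<integral>w. (cmod (f w))\<^sup>2 \<partial>distr M M T) = (\<integral>w. (cmod (f (T w)))\<^sup>2 \<partial>M)"
    by (rule integral_distr) measurable
  then show "(\<integral>w. (cmod (f (T w)))\<^sup>2 \<partial>M) = (\<integral>w. (cmod (f w))\<^sup>2 \<partial>M)" using T(2) by simp
qed

lemma L2_inner_compose:
  assumes T: "T \<in> M \<rightarrow>\<^sub>M M" "distr M M T = M" and f: "f \<in> borel_measurable M" and g: "g \<in> borel_measurable M"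
  shows "L2_inner M (f \<circ> T) (g \<circ> T) = L2_inner M f g"
proof -
  note [measurable] = T(1) f g
  have "(\<integral>w. f w * cnj (g w) \<partial>distr M M T) = (\<integral>w. f (T w) * cnj (g (T w)) \<partial>M)"
    by (rule integral_distr) measurable
  then show ?thesis using T(2) by (simp add: L2_inner_def)
qed

text \<open>Cauchy--Schwarz in the form \<open>2 |ab| \<le> t |a|\<^sup>2 + |b|\<^sup>2 / t\<close>, uniformly in \<open>n\<close>.\<close>

lemma L2_approx_tendsto:
  fixes u h :: "nat \<Rightarrow> 'a \<Rightarrow> complex"
  assumes h: "\<And>n. h n \<in> L2_fun M" "\<And>n. (\<integral>w. (cmod (h n w))\<^sup>2 \<partial>M) \<le> C"
    and u: "\<And>n. u n \<in> L2_fun M"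
    and approx: "\<And>e. 0 < e \<Longrightarrow> \<exists>v. (\<forall>n. v n \<in> L2_fun M \<and> (\<integral>w. (cmod (u n w - v n w))\<^sup>2 \<partial>M) \<le> e)
        \<and> (\<lambda>n. \<integral>w. v n w * h n w \<partial>M) \<longlonglongrightarrow> 0"
  shows "(\<lambda>n. \<integral>w. u n w * h n w \<partial>M) \<longlonglongrightarrow> 0"
proof (rule tendstoI)
  fix \<epsilon> :: real assume \<epsilon>: "0 < \<epsilon>"
  have C: "0 \<le> C" using h(2)[of 0] by (rule order_trans[rotated]) simp
  \<comment> \<open>The two terms of the estimate are at most \<open>t * C\<close> and
    \<open>(t * (\<epsilon> / 2)) / t\<close>, each at most \<open>\<epsilon> / 2\<close>, and are
    halved at the end. \<open>C + 1\<close> covers \<open>C = 0\<close>.\<close>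
  define t where "t = \<epsilon> / (2 * (C + 1))"
  have t: "0 < t" "t * C \<le> \<epsilon> / 2" using \<epsilon> C by (auto simp: t_def field_simps)
  obtain v where v: "\<And>n. v n \<in> L2_fun M" "\<And>n. (\<integral>w. (cmod (u n w - v n w))\<^sup>2 \<partial>M) \<le> t * (\<epsilon> / 2)"
      "(\<lambda>n. \<integral>w. v n w * h n w \<partial>M) \<longlonglongrightarrow> 0"
    using approx[of "t * (\<epsilon> / 2)"] t(1) \<epsilon> by auto
  have near: "cmod ((\<integral>w. u n w * h n w \<partial>M) - (\<integral>w. v n w * h n w \<partial>M)) \<le> \<epsilon> / 2" for n
  proof -
    let ?d = "\<lambda>w. u n w - v n w"
    have d: "?d \<in> L2_fun M" by (rule L2_fun_diff[OF u v(1)])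
    have i: "integrable M (\<lambda>w. u n w * h n w)" "integrable M (\<lambda>w. v n w * h n w)" "integrable M (\<lambda>w. ?d w * h n w)"
      by (rule L2_fun_mult_integrable[OF u h(1)] L2_fun_mult_integrable[OF v(1) h(1)] L2_fun_mult_integrable[OF d h(1)])+
    have "(\<integral>w. u n w * h n w \<partial>M) - (\<integral>w. v n w * h n w \<partial>M) = (\<integral>w. ?d w * h n w \<partial>M)"
      using i by (simp add: algebra_simps)
    also have "cmod \<dots> \<le> (\<integral>w. cmod (?d w * h n w) \<partial>M)" by (rule integral_norm_bound)
    also have "\<dots> \<le> (\<integral>w. (t * (cmod (h n w))\<^sup>2 + (cmod (?d w))\<^sup>2 / t) / 2 \<partial>M)"
    proof (rule integral_mono)
      show "integrable M (\<lambda>w. cmod (?d w * h n w))" using i(3) by (rule integrable_norm)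
      show "integrable M (\<lambda>w. (t * (cmod (h n w))\<^sup>2 + (cmod (?d w))\<^sup>2 / t) / 2)"
        using L2_funD(2)[OF h(1)] L2_funD(2)[OF d] by auto
      fix w
      have "0 \<le> (t * cmod (h n w) - cmod (?d w))\<^sup>2 / t" using t(1) by simp
      also have "\<dots> = t * (cmod (h n w))\<^sup>2 + (cmod (?d w))\<^sup>2 / t - 2 * (cmod (?d w) * cmod (h n w))"
        using t(1) by (simp add: power2_eq_square field_simps)
      finally show "cmod (?d w * h n w) \<le> (t * (cmod (h n w))\<^sup>2 + (cmod (?d w))\<^sup>2 / t) / 2"
        by (simp add: norm_mult)
    qed
    also have "\<dots> = (t * (\<integral>w. (cmod (h n w))\<^sup>2 \<partial>M) + (\<integral>w. (cmod (?d w))\<^sup>2 \<partial>M) / t) / 2"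
      using L2_funD(2)[OF h(1)[of n]] L2_funD(2)[OF d] by simp
    also have "\<dots> \<le> (t * C + (t * (\<epsilon> / 2)) / t) / 2"
      using t(1) by (intro divide_right_mono add_mono mult_left_mono h(2) v(2)) auto
    also have "\<dots> \<le> \<epsilon> / 2" using t by simp
    finally show ?thesis .
  qed
  have "\<forall>\<^sub>F n in sequentially. dist (\<integral>w. v n w * h n w \<partial>M) 0 < \<epsilon> / 2"
    using v(3) \<epsilon> by (intro tendstoD) auto
  then show "\<forall>\<^sub>F n in sequentially. dist (\<integral>w. u n w * h n w \<partial>M) 0 < \<epsilon>"
  proof eventually_elim
    case (elim n)
    then show ?case
      using near[of n] norm_triangle_sub[of "\<integral>w. u n w * h n w \<partial>M" "\<integral>w. v n w * h n w \<partial>M"] by simp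
  qed
qed

text \<open>Keeping \<open>z\<close> and \<open>cnj z\<close> as independent powers gives closure
  under products by adding exponents. On the unit circle the monomial has fibre frequency
  \<open>k - l\<close>.\<close>

inductive fibre_polynomial :: "(real \<times> complex \<Rightarrow> complex) \<Rightarrow> bool" where
  monomial: "continuous_on UNIV a \<Longrightarrow> fibre_polynomial (\<lambda>w. a (fst w) * (snd w ^ k * cnj (snd w) ^ l))"
| add: "fibre_polynomial f \<Longrightarrow> fibre_polynomial g \<Longrightarrow> fibre_polynomial (\<lambda>w. f w + g w)"

lemma fibre_polynomial_const: "fibre_polynomial (\<lambda>w. c)"
  using monomial[of "\<lambda>_. c" 0 0] by simp

lemma fibre_polynomial_mult:
  assumes "fibre_polynomial f" "fibre_polynomial g"
  shows "fibre_polynomial (\<lambda>w. f w * g w)"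
  using assms
proof (induction f)
  case (monomial a k l)
  from monomial(2,1) show ?case
  proof (induction g)
    case (monomial b k' l')
    have "fibre_polynomial (\<lambda>w. (a (fst w) * b (fst w)) * (snd w ^ (k + k') * cnj (snd w) ^ (l + l')))"
      by (rule fibre_polynomial.monomial) (intro continuous_intros monomial)
    then show ?case by (simp add: power_add mult_ac)
  next
    case (add f g)
    then have "fibre_polynomial (\<lambda>w. a (fst w) * (snd w ^ k * cnj (snd w) ^ l) * f w + a (fst w) * (snd w ^ k * cnj (snd w) ^ l) * g w)"
      by (intro fibre_polynomial.add) auto
    then show ?case by (simp add: algebra_simps)
  qed
next
  case (add f1 f2)
  then have "fibre_polynomial (\<lambda>w. f1 w * g w + f2 w * g w)" by (intro fibre_polynomial.add) auto
  then show ?case by (simp add: algebra_simps)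
qed

lemma real_polynomial_imp_fibre_polynomial:
  assumes "real_polynomial_function (h :: real \<times> complex \<Rightarrow> real)"
  shows "fibre_polynomial (\<lambda>w. complex_of_real (h w))"
  using assms
proof induction
  case (linear h)
  have h: "h w = fst w * h (1, 0) + Re (snd w) * h (0, 1) + Im (snd w) * h (0, \<i>)" for w
  proof -
    have "w = fst w *\<^sub>R (1, 0) + Re (snd w) *\<^sub>R (0, 1) + Im (snd w) *\<^sub>R (0, \<i>)"
      by (auto simp: prod_eq_iff complex_eq_iff)
    then have "h w = h (fst w *\<^sub>R (1, 0) + Re (snd w) *\<^sub>R (0, 1) + Im (snd w) *\<^sub>R (0, \<i>))" by (rule arg_cong)
    also have "\<dots> = fst w * h (1, 0) + Re (snd w) * h (0, 1) + Im (snd w) * h (0, \<i>)"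
      using bounded_linear.linear[OF linear] by (simp only: linear_add linear_scale real_scaleR_def)
    finally show ?thesis .
  qed
  \<comment> \<open>The coefficients come from writing the real and imaginary parts as
    \<open>(z + cnj z) / 2\<close> and \<open>(z - cnj z) / (2 * \<i>)\<close>.\<close>
  let ?b = "complex_of_real (h (0, 1)) / 2" and ?c = "- \<i> * complex_of_real (h (0, \<i>)) / 2"
  have e: "complex_of_real (h w) = of_real (fst w * h (1, 0)) + ((?b + ?c) * snd w + (?b - ?c) * cnj (snd w))" for w
  proof -
    have "(?b + ?c) * snd w + (?b - ?c) * cnj (snd w) = of_real (Re (snd w) * h (0, 1) + Im (snd w) * h (0, \<i>))"
    proof -
      have "(?b + ?c) * snd w + (?b - ?c) * cnj (snd w) = ?b * (snd w + cnj (snd w)) + ?c * (snd w - cnj (snd w))"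
        by (simp only: ring_distribs) simp
      then show ?thesis by (simp only: complex_add_cnj complex_diff_cnj) (simp add: complex_eq_iff)
    qed
    then show ?thesis by (subst h) (simp add: add.assoc)
  qed
  have "fibre_polynomial (\<lambda>w. of_real (fst w * h (1, 0)) * (snd w ^ 0 * cnj (snd w) ^ 0)
      + ((?b + ?c) * (snd w ^ 1 * cnj (snd w) ^ 0) + (?b - ?c) * (snd w ^ 0 * cnj (snd w) ^ 1)))"
    by (intro fibre_polynomial.intros continuous_intros
         monomial[where a="\<lambda>x. of_real (x * h (1, 0))"] monomial[where a="\<lambda>x. ?b + ?c"] monomial[where a="\<lambda>x. ?b - ?c"])
  then show ?case by (rule back_subst[where P=fibre_polynomial]) (rule ext, subst e, simp)
next
  case (const c)
  show ?case by (rule fibre_polynomial_const)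
next
  case (add f g)
  then show ?case using fibre_polynomial.add by simp
next
  case (mult f g)
  then show ?case using fibre_polynomial_mult by simp
qed

lemma polynomial_imp_fibre_polynomial:
  assumes "polynomial_function (P :: real \<times> complex \<Rightarrow> complex)"
  shows "fibre_polynomial P"
proof -
  have "real_polynomial_function (Re \<circ> P)" "real_polynomial_function (Im \<circ> P)"
    using assms by (auto simp: polynomial_function_def bounded_linear_Re bounded_linear_Im)
  then have "fibre_polynomial (\<lambda>w. of_real (Re (P w)) + \<i> * of_real (Im (P w)))"
    using real_polynomial_imp_fibre_polynomial
    by (intro fibre_polynomial.add fibre_polynomial_mult fibre_polynomial_const) (auto simp: o_def)
  then show ?thesis by (simp flip: complex_eq)
qed

lemma fibre_polynomial_continuous: "fibre_polynomial f \<Longrightarrow> continuous_on UNIV f"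
proof (induction rule: fibre_polynomial.induct)
  case (monomial a k l)
  then show ?case by (intro continuous_intros continuous_on_compose2[OF monomial]) auto
qed (intro continuous_intros)

lemma finite_measure_skew: "finite_measure skew_space"
proof -
  interpret prob_space skew_space by (rule prob_space_skew)
  show ?thesis by unfold_locales
qed

lemma id_skew_measurable: "(\<lambda>w. w) \<in> borel_measurable skew_space"
proof -
  have "(\<lambda>w. (fst w, snd w)) \<in> borel_measurable skew_space" by measurable
  then show ?thesis by simp
qed

lemma continuous_L2_skew:
  assumes "continuous_on UNIV f"
  shows "f \<in> L2_fun skew_space"
proof -
  have "bounded (f ` ({0..1} \<times> sphere 0 1))"
    using assms by (intro compact_imp_bounded compact_continuous_image compact_Times) (auto intro: continuous_on_subset)
  then obtain K where "\<And>w. w \<in> {0..1} \<times> sphere 0 1 \<Longrightarrow> cmod (f w) \<le> K" unfolding bounded_iff by blast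
  moreover have "f \<in> borel_measurable skew_space"
    using measurable_compose[OF id_skew_measurable borel_measurable_continuous_onI[OF assms]] .
  ultimately show ?thesis by (intro L2_fun_bounded[OF finite_measure_skew, where K=K]) auto
qed

lemma fibre_polynomial_dense_bounded:
  assumes f[measurable]: "f \<in> borel_measurable skew_space" and K: "\<And>w. cmod (f w) \<le> K" and e: "0 < e"
  obtains P where "fibre_polynomial P" "(\<integral>w. (cmod (f w - P w))\<^sup>2 \<partial>skew_space) < e"
proof -
  interpret finite_measure skew_space by (rule finite_measure_skew)
  have K0: "0 \<le> K" using order_trans[OF norm_ge_zero K] .
  \<comment> \<open>A Borel retraction of the plane product onto the skew space. Composing with it
    extends \<open>f\<close> to a bounded Borel function without changing it on the space; the value
    at 0 is arbitrary.\<close>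
  define \<theta> where "\<theta> w = (frac (fst w), if snd w = 0 then 1 else sgn (snd w))" for w :: "real \<times> complex"
  have "\<theta> \<in> borel \<Otimes>\<^sub>M borel \<rightarrow>\<^sub>M torus \<Otimes>\<^sub>M circle_measure"
    unfolding \<theta>_def
  proof (rule measurable_Pair)
    show "(\<lambda>w. frac (fst w)) \<in> borel \<Otimes>\<^sub>M borel \<rightarrow>\<^sub>M torus" by measurable
    have "(\<lambda>w :: real \<times> complex. if snd w = 0 then 1 else sgn (snd w)) \<in> borel_measurable (borel \<Otimes>\<^sub>M borel)"
      unfolding sgn_div_norm by measurable
    then show "(\<lambda>w :: real \<times> complex. if snd w = 0 then 1 else sgn (snd w)) \<in> borel \<Otimes>\<^sub>M borel \<rightarrow>\<^sub>M circle_measure"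
      by (rule measurable_circleI) (auto simp: norm_sgn)
  qed
  then have \<theta>: "\<theta> \<in> borel \<rightarrow>\<^sub>M skew_space" by (simp add: skew_space_def borel_prod)
  have \<theta>_id: "\<theta> w = w" if "w \<in> space skew_space" for w
    using that by (cases w) (auto simp: \<theta>_def frac_eq sgn_div_norm)
  \<comment> \<open>Since \<open>f - P\<close> is bounded by \<open>2 * K + 1\<close> on the space,
    its squared modulus is at most this constant times its modulus, so \<open>L1\<close>-closeness
    becomes \<open>L2\<close>-closeness.\<close>
  define e' where "e' = e / (2 * K + 1)"
  have e': "0 < e'" "(2 * K + 1) * e' = e" using e K0 by (auto simp: e'_def)
  obtain P where P: "polynomial_function P" "\<And>w. w \<in> {0..1} \<times> sphere 0 1 \<Longrightarrow> norm (P w) \<le> K + 1"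
    "(\<integral>w. norm (P w - f (\<theta> w)) \<partial>skew_space) < e'"
  proof (rule polynomial_dense_L1[OF finite_measure_axioms id_skew_measurable, of "{0..1} \<times> sphere 0 1" "\<lambda>w. f (\<theta> w)" K e'])
    show "compact ({0..1::real} \<times> sphere (0::complex) 1)" by (intro compact_Times) auto
    show "w \<in> space skew_space \<Longrightarrow> w \<in> {0..1} \<times> sphere 0 1" for w by (cases w) auto
    show "(\<lambda>w. f (\<theta> w)) \<in> borel_measurable borel" by (rule measurable_compose[OF \<theta> f])
    show "norm (f (\<theta> w)) \<le> K" for w by (rule K)
  qed (use e' in auto)
  have L2P: "P \<in> L2_fun skew_space"
    using P(1) by (intro continuous_L2_skew continuous_on_polymonial_function)
  note [measurable] = L2_funD(1)[OF L2P]
  have P_bound: "cmod (P w) \<le> K + 1" if "w \<in> space skew_space" for w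
    by (rule P(2)) (use that in \<open>cases w; auto\<close>)
  have "(\<integral>w. (cmod (f w - P w))\<^sup>2 \<partial>skew_space) \<le> (\<integral>w. (2 * K + 1) * norm (P w - f (\<theta> w)) \<partial>skew_space)"
  proof (rule integral_mono)
    show "integrable skew_space (\<lambda>w. (cmod (f w - P w))\<^sup>2)"
      by (intro L2_funD L2_fun_diff L2P L2_fun_bounded[OF finite_measure_axioms f K])
    have "integrable skew_space (\<lambda>w. norm (P w - f w))"
    proof (rule integrable_const_bound[where B="K + 1 + K"], rule AE_I2)
      fix w assume "w \<in> space skew_space"
      then show "norm (norm (P w - f w)) \<le> K + 1 + K"
        using P_bound[of w] K[of w] norm_triangle_ineq4[of "P w" "f w"] by simp
    qed measurable
    then show "integrable skew_space (\<lambda>w. (2 * K + 1) * norm (P w - f (\<theta> w)))"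
      by (subst Bochner_Integration.integrable_cong[OF refl, where g="\<lambda>w. (2 * K + 1) * norm (P w - f w)"]) (auto simp: \<theta>_id)
    fix w assume w: "w \<in> space skew_space"
    have "cmod (f w - P w) \<le> 2 * K + 1"
      using P_bound[OF w] K[of w] norm_triangle_ineq4[of "f w" "P w"] by simp
    then have "(cmod (f w - P w))\<^sup>2 \<le> (2 * K + 1) * cmod (f w - P w)"
      unfolding power2_eq_square by (intro mult_right_mono) auto
    then show "(cmod (f w - P w))\<^sup>2 \<le> (2 * K + 1) * norm (P w - f (\<theta> w))"
      by (simp add: \<theta>_id[OF w] norm_minus_commute)
  qed
  also have "\<dots> = (2 * K + 1) * (\<integral>w. norm (P w - f (\<theta> w)) \<partial>skew_space)" by simp
  also have "\<dots> < (2 * K + 1) * e'" using P(3) K0 by (intro mult_strict_left_mono) auto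
  finally show ?thesis using that polynomial_imp_fibre_polynomial[OF P(1)] e'(2) by simp
qed

lemma fibre_polynomial_dense:
  assumes f: "f \<in> L2_fun skew_space" and e: "0 < e"
  obtains P where "fibre_polynomial P" "(\<integral>w. (cmod (f w - P w))\<^sup>2 \<partial>skew_space) < e"
proof -
  interpret finite_measure skew_space by (rule finite_measure_skew)
  note [measurable] = L2_funD(1)[OF f]
  define g where "g k w = (if cmod (f w) \<le> real k then f w else 0)" for k w
  have gm[measurable]: "g k \<in> borel_measurable skew_space" for k unfolding g_def by measurable
  have gK: "cmod (g k w) \<le> real k" for k w by (simp add: g_def)
  have "(\<lambda>k. \<integral>w. (cmod (f w - g k w))\<^sup>2 \<partial>skew_space) \<longlonglongrightarrow> (\<integral>w. 0 \<partial>skew_space)"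
  proof (rule integral_dominated_convergence[where w="\<lambda>w. (cmod (f w))\<^sup>2"])
    show "integrable skew_space (\<lambda>w. (cmod (f w))\<^sup>2)" by (rule L2_funD(2)[OF f])
    show "AE w in skew_space. (\<lambda>k. (cmod (f w - g k w))\<^sup>2) \<longlonglongrightarrow> 0"
    proof (rule AE_I2)
      fix w
      obtain N where N: "cmod (f w) \<le> real N" using real_arch_simple by blast
      have "\<forall>\<^sub>F k in sequentially. (cmod (f w - g k w))\<^sup>2 = 0"
        using eventually_ge_at_top[of N] by eventually_elim (use N in \<open>auto simp: g_def\<close>)
      then show "(\<lambda>k. (cmod (f w - g k w))\<^sup>2) \<longlonglongrightarrow> 0" by (rule tendsto_eventually)
    qed
    show "AE w in skew_space. norm ((cmod (f w - g k w))\<^sup>2) \<le> (cmod (f w))\<^sup>2" for k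
      by (rule AE_I2) (simp add: g_def)
  qed measurable
  then have "\<forall>\<^sub>F k in sequentially. (\<integral>w. (cmod (f w - g k w))\<^sup>2 \<partial>skew_space) < e / 4"
    using e by (intro order_tendstoD) auto
  then obtain k where k: "(\<integral>w. (cmod (f w - g k w))\<^sup>2 \<partial>skew_space) < e / 4" by (auto simp: eventually_sequentially)
  obtain P where P: "fibre_polynomial P" "(\<integral>w. (cmod (g k w - P w))\<^sup>2 \<partial>skew_space) < e / 4"
    using fibre_polynomial_dense_bounded[OF gm gK, of "e/4"] e by auto
  have gL2: "g k \<in> L2_fun skew_space" by (rule L2_fun_bounded[OF finite_measure_axioms gm gK])
  have PL2: "P \<in> L2_fun skew_space" by (intro continuous_L2_skew fibre_polynomial_continuous P)
  note i = L2_funD(2)[OF L2_fun_diff[OF f gL2]] L2_funD(2)[OF L2_fun_diff[OF gL2 PL2]] L2_funD(2)[OF L2_fun_diff[OF f PL2]]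
  have "(\<integral>w. (cmod (f w - P w))\<^sup>2 \<partial>skew_space) \<le> (\<integral>w. 2 * (cmod (f w - g k w))\<^sup>2 + 2 * (cmod (g k w - P w))\<^sup>2 \<partial>skew_space)"
  proof (rule integral_mono)
    fix w
    show "(cmod (f w - P w))\<^sup>2 \<le> 2 * (cmod (f w - g k w))\<^sup>2 + 2 * (cmod (g k w - P w))\<^sup>2"
      using cmod_diff_square[of "f w - g k w" "P w - g k w"] by (simp add: norm_minus_commute)
  qed (use i in auto)
  also have "\<dots> = 2 * (\<integral>w. (cmod (f w - g k w))\<^sup>2 \<partial>skew_space) + 2 * (\<integral>w. (cmod (g k w - P w))\<^sup>2 \<partial>skew_space)"
    using i by simp
  also have "\<dots> < e" using k P(2) by simp
  finally show ?thesis using that P(1) by blast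
qed

subsection \<open>Mixing and ergodicity\<close>

text \<open>Invariance of the measure moves \<open>T\<close> to the other side of the inner product
  as composition with its inverse, under which \<open>W\<close> is stable.\<close>

lemma L2_orthocomplement_compose:
  assumes T: "T \<in> M \<rightarrow>\<^sub>M M" "distr M M T = M" and T': "T' \<in> M \<rightarrow>\<^sub>M M"
    and inverse: "\<And>w. w \<in> space M \<Longrightarrow> T' (T w) = w"
    and W: "\<And>g. g \<in> W \<Longrightarrow> g \<in> L2_fun M \<and> g \<circ> T' \<in> W"
    and f: "f \<in> L2_orthocomplement M W"
  shows "f \<circ> T \<in> L2_orthocomplement M W"
proof -
  have fL: "f \<in> L2_fun M" and fW: "\<And>g. g \<in> W \<Longrightarrow> L2_inner M f g = 0"
    using f by (auto simp: L2_orthocomplement_def)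
  have "L2_inner M (f \<circ> T) g = 0" if g: "g \<in> W" for g
  proof -
    have [measurable]: "g \<in> borel_measurable M" using W[OF g] L2_funD(1) by blast
    have "L2_inner M (f \<circ> T) g = L2_inner M (f \<circ> T) ((g \<circ> T') \<circ> T)"
      unfolding L2_inner_def by (rule Bochner_Integration.integral_cong) (auto simp: inverse)
    also have "\<dots> = L2_inner M f (g \<circ> T')"
      by (rule L2_inner_compose[OF T L2_funD(1)[OF fL]]) (rule measurable_comp[OF T'], measurable)
    finally show ?thesis using fW W[OF g] by simp
  qed
  moreover have "f \<circ> T \<in> L2_fun M" using L2_fun_compose(1)[OF T fL] by (simp add: comp_def)
  ultimately show ?thesis by (simp add: L2_orthocomplement_def)
qed

context circle_extension
begin

lemma L2_skew_iter:
  assumes "f \<in> L2_fun skew_space"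
  shows "(\<lambda>w. f ((S ^^ n) w)) \<in> L2_fun skew_space"
    "(\<integral>w. (cmod (f ((S ^^ n) w)))\<^sup>2 \<partial>skew_space) = (\<integral>w. (cmod (f w))\<^sup>2 \<partial>skew_space)"
proof -
  have "distr skew_space skew_space (S ^^ n) = skew_space"
  proof (induction n)
    case 0
    show ?case by (simp add: id_def distr_id)
  next
    case (Suc n)
    have "distr skew_space skew_space (S ^^ Suc n) = distr (distr skew_space skew_space (S ^^ n)) skew_space S"
      by (subst distr_distr) (simp_all add: skew_iter_measurable skew_measurable)
    then show ?case by (simp only: Suc distr_skew)
  qed
  then show "(\<lambda>w. f ((S ^^ n) w)) \<in> L2_fun skew_space"
    "(\<integral>w. (cmod (f ((S ^^ n) w)))\<^sup>2 \<partial>skew_space) = (\<integral>w. (cmod (f w))\<^sup>2 \<partial>skew_space)"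
    using L2_fun_compose[OF skew_iter_measurable _ assms] by auto
qed

lemma first_variable_functions_skew:
  assumes "g \<in> first_variable_functions"
  shows "g \<in> L2_fun skew_space \<and> g \<circ> S \<in> first_variable_functions"
proof -
  obtain g0 where g: "g \<in> L2_fun skew_space" "g0 \<in> borel_measurable torus" "AE w in skew_space. g w = g0 (fst w)"
    using assms by (auto simp: first_variable_functions_def)
  have "g \<circ> S \<in> L2_fun skew_space"
    using L2_fun_compose(1)[OF skew_measurable distr_skew g(1)] by (simp add: comp_def)
  moreover have "(\<lambda>x. g0 (rotation \<alpha> x)) \<in> borel_measurable torus"
    by (rule measurable_compose[OF rotation_measurable g(2)])
  moreover have "AE w in skew_space. (g \<circ> S) w = g0 (rotation \<alpha> (fst w))"
    using AE_skew[OF g(3)] by (simp add: skew_product_def case_prod_beta)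
  ultimately show ?thesis using g(1) unfolding first_variable_functions_def
    by (auto intro!: bexI[where x="\<lambda>x. g0 (rotation \<alpha> x)"])
qed

abbreviation "V \<equiv> L2_orthocomplement skew_space first_variable_functions"

lemma koopman_unitary: "koopman_unitary_on skew_space S V"
proof -
  interpret I: circle_extension "-\<alpha>" inv_gamma by unfold_locales (rule inv_gamma_cocycle)
  have "f \<circ> S \<in> V" if "f \<in> V" for f
    by (rule L2_orthocomplement_compose[OF skew_measurable distr_skew I.skew_measurable skew_inverse(1)
        I.first_variable_functions_skew that])
  moreover have "L2_inner skew_space (f \<circ> S) (g \<circ> S) = L2_inner skew_space f g" if "f \<in> V" "g \<in> V" for f g
    by (rule L2_inner_compose[OF skew_measurable distr_skew])
       (use that in \<open>auto simp: L2_orthocomplement_def dest: L2_funD(1)\<close>)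
  moreover have "\<exists>g\<in>V. AE w in skew_space. (g \<circ> S) w = f w" if "f \<in> V" for f
  proof
    show "f \<circ> I.S \<in> V"
      by (rule L2_orthocomplement_compose[OF I.skew_measurable I.distr_skew skew_measurable skew_inverse(2)
          first_variable_functions_skew that])
    show "AE w in skew_space. ((f \<circ> I.S) \<circ> S) w = f w"
      by (rule AE_I2) (simp only: comp_def skew_inverse)
  qed
  ultimately show ?thesis unfolding koopman_unitary_on_def by blast
qed

end

text \<open>The assumption is the conclusion of \<open>scalar_iter_oscillation\<close>; from here on
  the matrix cocycle no longer appears.\<close>

locale oscillating_extension = circle_extension +
  assumes oscillating: "\<And>a b K m. \<lbrakk>b \<in> borel_measurable torus; \<And>x. x \<in> {0..<1} \<Longrightarrow> cmod (b x) \<le> K;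
      a \<in> borel_measurable torus; \<And>x. x \<in> {0..<1} \<Longrightarrow> cmod (a x) \<le> K; 0 < m\<rbrakk> \<Longrightarrow>
      (\<lambda>n. \<integral>x. b x * scalar_iter \<alpha> \<gamma> n x ^ m * a (rotation (real n * \<alpha>) x) \<partial>torus) \<longlonglongrightarrow> 0"
begin

lemma norm_iter: "cmod (scalar_iter \<alpha> \<gamma> n x) = 1"
  by (simp add: scalar_iter_def prod_norm[symmetric])

lemma iter_unit: "scalar_iter \<alpha> \<gamma> n x * cnj (scalar_iter \<alpha> \<gamma> n x) = 1"
  by (simp add: norm_iter flip: complex_norm_square)

text \<open>On the unit circle the monomial is a positive power or the conjugate of one. In the
  second case \<open>oscillating\<close> is applied to the conjugates of \<open>a\<close> and
  \<open>b\<close>.\<close>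

lemma oscillating_monomial:
  assumes b: "b \<in> borel_measurable torus" "\<And>x. x \<in> {0..<1} \<Longrightarrow> cmod (b x) \<le> K"
    and a: "a \<in> borel_measurable torus" "\<And>x. x \<in> {0..<1} \<Longrightarrow> cmod (a x) \<le> K" and kl: "k \<noteq> l"
  shows "(\<lambda>n. \<integral>x. b x * (scalar_iter \<alpha> \<gamma> n x ^ k * cnj (scalar_iter \<alpha> \<gamma> n x) ^ l) * a (rotation (real n * \<alpha>) x) \<partial>torus) \<longlonglongrightarrow> 0"
proof (cases "l < k")
  case True
  have "z ^ k * cnj z ^ l = z ^ (k - l)" if "z * cnj z = 1" for z
  proof -
    have "z ^ k * cnj z ^ l = z ^ (k - l) * (z * cnj z) ^ l"
      using True by (simp add: power_mult_distrib flip: power_add mult.assoc)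
    then show ?thesis using that by simp
  qed
  then show ?thesis using oscillating[OF b a, of "k - l"] True iter_unit by simp
next
  case False
  then have lk: "k < l" using kl by simp
  have e: "z ^ k * cnj z ^ l = cnj (z ^ (l - k))" if "z * cnj z = 1" for z
  proof -
    have "z ^ k * cnj z ^ l = cnj z ^ (l - k) * (z * cnj z) ^ k"
      using lk by (simp add: power_mult_distrib mult_ac flip: power_add)
    then show ?thesis using that by simp
  qed
  have "(\<lambda>n. \<integral>x. cnj (b x) * scalar_iter \<alpha> \<gamma> n x ^ (l - k) * cnj (a (rotation (real n * \<alpha>) x)) \<partial>torus) \<longlonglongrightarrow> 0"
    by (rule oscillating[where a = "\<lambda>x. cnj (a x)" and b = "\<lambda>x. cnj (b x)" and K = K])
       (use a b lk in \<open>auto intro: borel_measurable_cnj\<close>)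
  then have "(\<lambda>n. cnj (\<integral>x. cnj (b x) * scalar_iter \<alpha> \<gamma> n x ^ (l - k) * cnj (a (rotation (real n * \<alpha>) x)) \<partial>torus)) \<longlonglongrightarrow> cnj 0"
    by (rule tendsto_cnj)
  moreover have "cnj (\<integral>x. cnj (b x) * scalar_iter \<alpha> \<gamma> n x ^ (l - k) * cnj (a (rotation (real n * \<alpha>) x)) \<partial>torus)
      = (\<integral>x. b x * (scalar_iter \<alpha> \<gamma> n x ^ k * cnj (scalar_iter \<alpha> \<gamma> n x) ^ l) * a (rotation (real n * \<alpha>) x) \<partial>torus)" for n
    unfolding e[OF iter_unit] by (subst Bochner_Integration.integral_cnj[symmetric]) simp
  ultimately show ?thesis by simp
qed

text \<open>The iterate multiplies \<open>z\<close> by the scalar cocycle, so the fibre variable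
  splits off into the constant \<open>?c\<close>, whatever its value, and an oscillating base
  integral remains.\<close>

lemma monomial_correlation:
  assumes a: "continuous_on UNIV a" and b: "continuous_on UNIV b" and kl: "k \<noteq> l"
  defines "M \<equiv> \<lambda>w. a (fst w) * (snd w ^ k * cnj (snd w) ^ l)"
  shows "(\<lambda>n. \<integral>w. cnj (b (fst w) * (snd w ^ k' * cnj (snd w) ^ l')) * M ((S ^^ n) w) \<partial>skew_space) \<longlonglongrightarrow> 0"
proof -
  interpret C: prob_space circle_measure by (rule prob_space_circle)
  interpret T: prob_space torus by (rule prob_space_torus)
  interpret TC: pair_sigma_finite torus circle_measure ..
  let ?c = "\<integral>z. cnj (z ^ k' * cnj z ^ l') * (z ^ k * cnj z ^ l) \<partial>circle_measure"
  let ?f = "\<lambda>n x. cnj (b x) * (scalar_iter \<alpha> \<gamma> n x ^ k * cnj (scalar_iter \<alpha> \<gamma> n x) ^ l) * a (rotation (real n * \<alpha>) x)"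
  let ?F = "\<lambda>n w. cnj (b (fst w) * (snd w ^ k' * cnj (snd w) ^ l')) * M ((S ^^ n) w)"
  have am: "a \<in> borel_measurable torus" and bm: "(\<lambda>x. cnj (b x)) \<in> borel_measurable torus"
    by (intro borel_imp_torus borel_measurable_continuous_onI a continuous_intros b)+
  have "bounded (a ` {0..1} \<union> b ` {0..1})"
    using a b by (intro compact_imp_bounded compact_Un compact_continuous_image) (auto intro: continuous_on_subset)
  then obtain K where "\<forall>y \<in> a ` {0..1} \<union> b ` {0..1}. cmod y \<le> K" unfolding bounded_iff by blast
  then have K: "cmod (a x) \<le> K" "cmod (b x) \<le> K" if "x \<in> {0..<1}" for x using that by auto
  have eq: "(\<integral>w. ?F n w \<partial>skew_space) = (\<integral>x. ?f n x \<partial>torus) * ?c" for n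
  proof -
    have Mc: "continuous_on UNIV M" unfolding M_def
      by (intro continuous_intros continuous_on_compose2[OF a]) auto
    have "continuous_on UNIV (\<lambda>w :: real \<times> complex. cnj (b (fst w) * (snd w ^ k' * cnj (snd w) ^ l')))"
      by (intro continuous_intros continuous_on_compose2[OF b]) auto
    then have int: "integrable skew_space (?F n)"
      by (rule L2_fun_mult_integrable[OF continuous_L2_skew L2_skew_iter(1)[OF continuous_L2_skew[OF Mc]]])
    then have "(\<integral>w. ?F n w \<partial>skew_space) = (\<integral>x. \<integral>z. ?F n (x, z) \<partial>circle_measure \<partial>torus)"
      unfolding skew_space_def by (rule TC.integral_fst'[symmetric])
    also have "\<dots> = (\<integral>x. ?f n x * ?c \<partial>torus)"
    proof (rule Bochner_Integration.integral_cong[OF refl])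
      fix x assume "x \<in> space torus"
      then have x: "x \<in> {0..<1}" by simp
      have "?F n (x, z) = ?f n x * (cnj (z ^ k' * cnj z ^ l') * (z ^ k * cnj z ^ l))" for z
        by (simp add: skew_iter[OF x] M_def power_mult_distrib mult_ac)
      then show "(\<integral>z. ?F n (x, z) \<partial>circle_measure) = ?f n x * ?c"
        by (simp only: integral_mult_right_zero)
    qed
    also have "\<dots> = (\<integral>x. ?f n x \<partial>torus) * ?c" by (rule integral_mult_left_zero)
    finally show ?thesis .
  qed
  have "(\<lambda>n. (\<integral>x. ?f n x \<partial>torus) * ?c) \<longlonglongrightarrow> 0 * ?c"
    by (intro tendsto_mult tendsto_const oscillating_monomial[OF bm _ am _ kl, of K]) (use K in auto)
  then show ?thesis unfolding eq by simp
qed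

text \<open>Orthogonality is used while \<open>f\<close> is still exact: monomials with
  \<open>k = l\<close> and their iterates depend on the first variable alone. For
  \<open>k \<noteq> l\<close> the function \<open>f\<close> may be replaced by an arbitrary fibre
  polynomial, since \<open>monomial_correlation\<close> restricts the exponents in one slot
  only.\<close>

lemma fibre_polynomial_correlation:
  assumes P: "fibre_polynomial P" and f: "f \<in> V"
  shows "(\<lambda>n. \<integral>w. cnj (f w) * P ((S ^^ n) w) \<partial>skew_space) \<longlonglongrightarrow> 0"
  using P
proof induction
  case (add P Q)
  have fL: "f \<in> L2_fun skew_space" using f by (simp add: L2_orthocomplement_def)
  have i: "integrable skew_space (\<lambda>w. cnj (f w) * P ((S ^^ n) w))" if "fibre_polynomial P" for P n
    by (intro L2_fun_mult_integrable L2_fun_cnj fL L2_skew_iter continuous_L2_skew fibre_polynomial_continuous that)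
  have "(\<lambda>n. (\<integral>w. cnj (f w) * P ((S ^^ n) w) \<partial>skew_space) + (\<integral>w. cnj (f w) * Q ((S ^^ n) w) \<partial>skew_space)) \<longlonglongrightarrow> 0"
    by (rule tendsto_add_zero) (fact add.IH)+
  then show ?case using i[OF add.hyps(1)] i[OF add.hyps(2)] by (simp add: distrib_left)
next
  case (monomial a k l)
  let ?M = "\<lambda>w. a (fst w) * (snd w ^ k * cnj (snd w) ^ l)"
  have fL: "f \<in> L2_fun skew_space" using f by (simp add: L2_orthocomplement_def)
  have M_L2: "?M \<in> L2_fun skew_space"
    by (intro continuous_L2_skew fibre_polynomial_continuous fibre_polynomial.monomial monomial)
  note MS = L2_skew_iter[OF M_L2]
  show ?case
  proof (cases "k = l")
    case True
    have "(\<integral>w. cnj (f w) * ?M ((S ^^ n) w) \<partial>skew_space) = 0" for n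
    proof -
      let ?g = "\<lambda>w. ?M ((S ^^ n) w)"
      have "(\<lambda>x. a (rotation (real n * \<alpha>) x)) \<in> borel_measurable torus"
        by (rule measurable_compose[OF rotation_measurable]) (intro borel_imp_torus borel_measurable_continuous_onI monomial)
      moreover have "AE w in skew_space. ?g w = a (rotation (real n * \<alpha>) (fst w))"
      proof (rule AE_I2)
        fix w assume "w \<in> space skew_space"
        then obtain x z where w: "w = (x, z)" "x \<in> {0..<1}" "cmod z = 1" by (cases w) auto
        let ?z = "z * scalar_iter \<alpha> \<gamma> n x"
        have "cmod ?z = 1" using w by (simp add: norm_mult norm_iter)
        then have "?z * cnj ?z = 1" using complex_norm_square[of ?z] by (simp only: power_one of_real_1)
        then have "?z ^ k * cnj ?z ^ k = 1" by (simp flip: power_mult_distrib)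
        then show "?g w = a (rotation (real n * \<alpha>) (fst w))"
          by (simp only: w(1) skew_iter[OF w(2)] True fst_conv snd_conv mult_1_right)
      qed
      ultimately have "?g \<in> first_variable_functions"
        unfolding first_variable_functions_def using MS(1)[of n]
        by (intro CollectI conjI bexI[where x="\<lambda>x. a (rotation (real n * \<alpha>) x)"])
      then have "L2_inner skew_space f ?g = 0" using f by (simp add: L2_orthocomplement_def)
      moreover have "(\<integral>w. cnj (f w) * ?g w \<partial>skew_space) = cnj (L2_inner skew_space f ?g)"
        unfolding L2_inner_def by (subst Bochner_Integration.integral_cnj[symmetric]) simp
      ultimately show ?thesis by simp
    qed
    then show ?thesis by simp
  next
    case False
    show ?thesis
    proof (rule L2_approx_tendsto[where C="\<integral>w. (cmod (?M w))\<^sup>2 \<partial>skew_space" and u="\<lambda>n w. cnj (f w)"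
          and h="\<lambda>n w. ?M ((S ^^ n) w)"])
      fix e :: real assume "0 < e"
      then obtain Q where Q: "fibre_polynomial Q" "(\<integral>w. (cmod (f w - Q w))\<^sup>2 \<partial>skew_space) < e"
        using fibre_polynomial_dense[OF fL] by blast
      have QL: "Q \<in> L2_fun skew_space" by (intro continuous_L2_skew fibre_polynomial_continuous Q)
      have "cmod (cnj (f w) - cnj (Q w)) = cmod (f w - Q w)" for w
        by (metis complex_cnj_diff complex_mod_cnj)
      then have "(\<integral>w. (cmod (cnj (f w) - cnj (Q w)))\<^sup>2 \<partial>skew_space) \<le> e" using Q(2) by simp
      moreover have "(\<lambda>n. \<integral>w. cnj (Q w) * ?M ((S ^^ n) w) \<partial>skew_space) \<longlonglongrightarrow> 0"
        using Q(1)
      proof induction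
        case (monomial b k' l')
        show ?case by (rule monomial_correlation[OF \<open>continuous_on UNIV a\<close> monomial False])
      next
        case (add P Q)
        have i: "integrable skew_space (\<lambda>w. cnj (P w) * ?M ((S ^^ n) w))" if "fibre_polynomial P" for P n
          by (intro L2_fun_mult_integrable L2_fun_cnj MS continuous_L2_skew fibre_polynomial_continuous that)
        have "(\<lambda>n. (\<integral>w. cnj (P w) * ?M ((S ^^ n) w) \<partial>skew_space) + (\<integral>w. cnj (Q w) * ?M ((S ^^ n) w) \<partial>skew_space)) \<longlonglongrightarrow> 0"
          by (rule tendsto_add_zero) (fact add.IH)+
        then show ?case using i[OF add.hyps(1)] i[OF add.hyps(2)] by (simp add: distrib_right)
      qed
      ultimately show "\<exists>v. (\<forall>n. v n \<in> L2_fun skew_space \<and> (\<integral>w. (cmod (cnj (f w) - v n w))\<^sup>2 \<partial>skew_space) \<le> e)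
          \<and> (\<lambda>n. \<integral>w. v n w * ?M ((S ^^ n) w) \<partial>skew_space) \<longlonglongrightarrow> 0"
        using L2_fun_cnj[OF QL] by (intro exI[of _ "\<lambda>n w. cnj (Q w)"]) auto
    qed (use MS L2_fun_cnj[OF fL] in auto)
  qed
qed

lemma mixing: "mixing_on skew_space S V"
proof -
  have "(\<lambda>n. L2_inner skew_space (f \<circ> (S ^^ n)) f) \<longlonglongrightarrow> 0" if f: "f \<in> V" for f
  proof -
    have fL: "f \<in> L2_fun skew_space" using f by (simp add: L2_orthocomplement_def)
    have "(\<lambda>n. \<integral>w. f ((S ^^ n) w) * cnj (f w) \<partial>skew_space) \<longlonglongrightarrow> 0"
    proof (rule L2_approx_tendsto[where C="\<integral>w. (cmod (f w))\<^sup>2 \<partial>skew_space" and u="\<lambda>n w. f ((S ^^ n) w)"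
          and h="\<lambda>n w. cnj (f w)"])
      fix e :: real assume "0 < e"
      then obtain Q where Q: "fibre_polynomial Q" "(\<integral>w. (cmod (f w - Q w))\<^sup>2 \<partial>skew_space) < e"
        using fibre_polynomial_dense[OF fL] by blast
      have QL: "Q \<in> L2_fun skew_space" by (intro continuous_L2_skew fibre_polynomial_continuous Q)
      \<comment> \<open>Invariance of the measure makes one approximant of \<open>f\<close> good for
        all iterates simultaneously.\<close>
      have "(\<integral>w. (cmod (f ((S ^^ n) w) - Q ((S ^^ n) w)))\<^sup>2 \<partial>skew_space) \<le> e" for n
        using L2_skew_iter(2)[OF L2_fun_diff[OF fL QL], of n] Q(2) by simp
      moreover have "(\<lambda>n. \<integral>w. Q ((S ^^ n) w) * cnj (f w) \<partial>skew_space) \<longlonglongrightarrow> 0"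
        using fibre_polynomial_correlation[OF Q(1) f] by (simp add: mult.commute)
      ultimately show "\<exists>v. (\<forall>n. v n \<in> L2_fun skew_space \<and> (\<integral>w. (cmod (f ((S ^^ n) w) - v n w))\<^sup>2 \<partial>skew_space) \<le> e)
          \<and> (\<lambda>n. \<integral>w. v n w * cnj (f w) \<partial>skew_space) \<longlonglongrightarrow> 0"
        using L2_skew_iter(1)[OF QL] by (intro exI[of _ "\<lambda>n w. Q ((S ^^ n) w)"]) auto
    qed (use L2_skew_iter[OF fL] L2_fun_cnj[OF fL] in auto)
    then show ?thesis by (simp add: L2_inner_def)
  qed
  then show ?thesis using koopman_unitary by (simp add: mixing_on_def)
qed

lemma ergodic_skew:
  assumes irr: "\<alpha> \<notin> \<rat>"
  shows "ergodic skew_space S"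
proof -
  interpret C: prob_space circle_measure by (rule prob_space_circle)
  interpret T: prob_space torus by (rule prob_space_torus)
  interpret TC: pair_sigma_finite torus circle_measure ..
  interpret P: prob_space skew_space by (rule prob_space_skew)
  have "emeasure skew_space A = 0 \<or> emeasure skew_space (space skew_space - A) = 0"
    if A[measurable]: "A \<in> sets skew_space" and inv: "S -` A \<inter> space skew_space = A" for A
  proof -
    define f0 :: "real \<Rightarrow> real" where "f0 x = (\<integral>z. indicator A (x, z) \<partial>circle_measure)" for x
    have A': "A \<in> sets (torus \<Otimes>\<^sub>M circle_measure)" using A by (simp add: skew_space_def)
    have slice[measurable]: "(\<lambda>z. indicat_real A (x, z)) \<in> borel_measurable circle_measure" if "x \<in> {0..<1}" for x
      by (rule measurable_compose[OF measurable_Pair1' borel_measurable_indicator[OF A']]) (use that in auto)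
    have f0m[measurable]: "f0 \<in> borel_measurable torus"
      unfolding f0_def using A' by (intro C.borel_measurable_lebesgue_integral) (auto simp: case_prod_beta)
    have f0_bound: "\<bar>f0 x\<bar> \<le> 1" for x
    proof (cases "integrable circle_measure (\<lambda>z. indicat_real A (x, z))")
      case True
      then have "\<bar>f0 x\<bar> \<le> (\<integral>z. 1 \<partial>circle_measure)" unfolding f0_def
        by (intro order_trans[OF integral_abs_bound] integral_mono) (auto simp: indicator_def)
      then show ?thesis using C.prob_space by simp
    qed (simp add: f0_def not_integrable_integral_eq)
    have indA: "indicat_real A (S w) = indicator A w" if "w \<in> space skew_space" for w
      using inv that by (auto simp: indicator_def)
    \<comment> \<open>The invariance of \<open>A\<close> is exact, so this holds at every point of
      the domain. Nonnegative integrals are used because the invariance of the circle measure is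
      available for them.\<close>
    have f0_inv: "f0 (rotation \<alpha> x) = f0 x" if x: "x \<in> {0..<1}" for x
    proof -
      have nn: "f0 y = enn2real (\<integral>\<^sup>+z. indicator A (y, z) \<partial>circle_measure)" if "y \<in> {0..<1}" for y
        unfolding f0_def using slice[OF that] by (subst integral_eq_nn_integral) (auto simp: ennreal_indicator)
      have "(\<integral>\<^sup>+z. indicator A (rotation \<alpha> x, z) \<partial>circle_measure)
          = (\<integral>\<^sup>+z. indicator A (rotation \<alpha> x, z * \<gamma> x) \<partial>circle_measure)"
        by (rule nn_integral_circle_rotate[symmetric, where f="\<lambda>z. indicator A (rotation \<alpha> x, z)"])
           (auto intro!: measurable_compose[OF measurable_Pair1' borel_measurable_indicator[OF A']])
      also have "\<dots> = (\<integral>\<^sup>+z. indicator A (x, z) \<partial>circle_measure)"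
      proof (rule nn_integral_cong)
        fix z assume "z \<in> space circle_measure"
        then have "(x, z) \<in> space skew_space" using x by simp
        then have "(rotation \<alpha> x, z * \<gamma> x) \<in> A \<longleftrightarrow> (x, z) \<in> A"
          using inv by (auto simp: skew_product_def)
        then show "indicator A (rotation \<alpha> x, z * \<gamma> x) = (indicator A (x, z) :: ennreal)" by (simp add: indicator_def)
      qed
      finally show ?thesis using nn[OF x] nn[of "rotation \<alpha> x"] by simp
    qed
    have f0_const: "AE x in torus. f0 x = (\<integral>y. f0 y \<partial>torus)"
      by (rule irrational_rotation_invariant_const[OF irr f0m, of 1])
         (use f0_bound in \<open>auto intro!: AE_I2 f0_inv\<close>)
    define g :: "real \<times> complex \<Rightarrow> complex" where "g w = of_real (indicator A w - f0 (fst w))" for w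
    have gm[measurable]: "g \<in> borel_measurable skew_space" unfolding g_def by measurable
    have gL: "g \<in> L2_fun skew_space"
    proof (rule L2_fun_bounded[OF P.finite_measure_axioms gm, where K=2])
      fix w
      have "\<bar>indicat_real A w - f0 (fst w)\<bar> \<le> 2"
        using f0_bound[of "fst w"] by (auto simp: indicator_def abs_le_iff)
      then show "cmod (g w) \<le> 2" unfolding g_def norm_of_real .
    qed
    have "L2_inner skew_space g h = 0" if h: "h \<in> first_variable_functions" for h
    proof -
      obtain h0 where hL: "h \<in> L2_fun skew_space" and h0[measurable]: "h0 \<in> borel_measurable torus"
        and hh: "AE w in skew_space. h w = h0 (fst w)"
        using h by (auto simp: first_variable_functions_def)
      note [measurable] = L2_funD(1)[OF hL]
      have cm: "(\<lambda>w. cnj (h w)) \<in> borel_measurable skew_space" "(\<lambda>x. cnj (h0 x)) \<in> borel_measurable torus"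
        by (intro borel_measurable_cnj; measurable)+
      have m2: "(\<lambda>w. g w * cnj (h0 (fst w))) \<in> borel_measurable skew_space"
        by (intro borel_measurable_times gm measurable_compose[OF fst_skew cm(2)])
      have m1: "(\<lambda>w. g w * cnj (h w)) \<in> borel_measurable skew_space"
        by (intro borel_measurable_times gm cm)
      have AEq: "AE w in skew_space. g w * cnj (h w) = g w * cnj (h0 (fst w))" using hh by eventually_elim simp
      have "integrable skew_space (\<lambda>w. g w * cnj (h w))"
        by (intro L2_fun_mult_integrable gL L2_fun_cnj hL)
      then have int: "integrable skew_space (\<lambda>w. g w * cnj (h0 (fst w)))"
        by (subst (asm) integrable_cong_AE[OF m1 m2 AEq])
      have "L2_inner skew_space g h = (\<integral>w. g w * cnj (h0 (fst w)) \<partial>skew_space)"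
        unfolding L2_inner_def by (rule integral_cong_AE[OF m1 m2 AEq])
      also have "\<dots> = (\<integral>x. \<integral>z. g (x, z) * cnj (h0 x) \<partial>circle_measure \<partial>torus)"
        using TC.integral_fst'[of "\<lambda>w. g w * cnj (h0 (fst w))"] int by (simp add: skew_space_def)
      also have "\<dots> = (\<integral>x. 0 \<partial>torus)"
      proof (rule Bochner_Integration.integral_cong[OF refl])
        fix x assume "x \<in> space torus"
        then have x: "x \<in> {0..<1}" by simp
        have "integrable circle_measure (\<lambda>z. indicat_real A (x, z))"
          by (rule C.integrable_const_bound[where B=1]) (use slice[OF x] in \<open>auto simp: indicator_def\<close>)
        then have "(\<integral>z. indicat_real A (x, z) - f0 x \<partial>circle_measure) = 0"
          using C.prob_space by (simp add: f0_def)
        then have "(\<integral>z. g (x, z) \<partial>circle_measure) = 0"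
          unfolding g_def fst_conv integral_complex_of_real by simp
        then show "(\<integral>z. g (x, z) * cnj (h0 x) \<partial>circle_measure) = 0" by simp
      qed
      finally show ?thesis by simp
    qed
    with gL have gV: "g \<in> V" by (simp add: L2_orthocomplement_def)
    have g_inv: "g ((S ^^ n) w) = g w" if "w \<in> space skew_space" for n w
      using that
    proof (induction n arbitrary: w)
      case (Suc n)
      have "S w \<in> space skew_space" using measurable_space[OF skew_measurable Suc.prems] .
      then have "g ((S ^^ n) (S w)) = g (S w)" by (rule Suc.IH)
      also have "\<dots> = g w"
      proof -
        have "fst (S w) = rotation \<alpha> (fst w)" by (simp add: skew_product_def case_prod_beta)
        moreover have "fst w \<in> {0..<1}" using Suc.prems by (cases w) auto
        ultimately show ?thesis using indA[OF Suc.prems] f0_inv by (simp add: g_def)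
      qed
      finally show ?case by (simp add: funpow_swap1)
    qed simp
    \<comment> \<open>An invariant vector has constant correlations, equal to its squared norm;
      mixing forces them to 0.\<close>
    have "L2_inner skew_space (g \<circ> (S ^^ n)) g = of_real (\<integral>w. (cmod (g w))\<^sup>2 \<partial>skew_space)" for n
    proof -
      have "L2_inner skew_space (g \<circ> (S ^^ n)) g = (\<integral>w. of_real ((cmod (g w))\<^sup>2) \<partial>skew_space)"
        unfolding L2_inner_def
        by (rule Bochner_Integration.integral_cong[OF refl]) (simp only: comp_def g_inv complex_norm_square)
      then show ?thesis by (simp only: integral_complex_of_real)
    qed
    moreover have "(\<lambda>n. L2_inner skew_space (g \<circ> (S ^^ n)) g) \<longlonglongrightarrow> 0"
      using mixing gV by (simp add: mixing_on_def)
    ultimately have "complex_of_real (\<integral>w. (cmod (g w))\<^sup>2 \<partial>skew_space) = 0"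
      by (simp only: LIMSEQ_const_iff)
    then have "AE w in skew_space. (cmod (g w))\<^sup>2 = 0"
      using L2_funD(2)[OF gL] by (subst (asm) of_real_eq_0_iff, subst (asm) integral_nonneg_eq_0_iff_AE) auto
    then have "AE w in skew_space. indicator A w = f0 (fst w)"
      by eventually_elim (simp add: g_def)
    moreover have "AE w in skew_space. f0 (fst w) = (\<integral>y. f0 y \<partial>torus)"
    proof -
      have D: "distr skew_space torus fst = torus"
        unfolding skew_space_def by (rule C.distr_pair_fst)
      show ?thesis
      proof (rule AE_distrD[OF fst_skew, where P="\<lambda>x. f0 x = (\<integral>y. f0 y \<partial>torus)"])
        show "AE x in distr skew_space torus fst. f0 x = (\<integral>y. f0 y \<partial>torus)"
          by (subst D) (rule f0_const)
      qed
    qed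
    ultimately have const: "AE w in skew_space. indicat_real A w = (\<integral>y. f0 y \<partial>torus)"
      by eventually_elim simp
    show ?thesis
    \<comment> \<open>An indicator takes the value 1 on \<open>A\<close>; if the constant differs
      from 1, then \<open>A\<close> is null, and if it equals 1, then the complement is.\<close>
    proof (cases "(\<integral>y. f0 y \<partial>torus) = 1")
      case True
      have "AE w in skew_space. w \<notin> space skew_space - A"
        using const by eventually_elim (auto simp: True indicator_def split: if_splits)
      then have "emeasure skew_space (space skew_space - A) = 0"
        by (subst (asm) AE_iff_measurable[OF sets.compl_sets[OF A]]) auto
      then show ?thesis ..
    next
      case False
      have "AE w in skew_space. w \<notin> A"
        using const by eventually_elim (use False in \<open>auto simp: indicator_def split: if_splits\<close>)
      then have "emeasure skew_space A = 0"
        by (subst (asm) AE_iff_measurable[where N=A]) (use sets.sets_into_space[OF A] in auto)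
      then show ?thesis ..
    qed
  qed
  then show ?thesis using distr_skew skew_measurable by (simp add: ergodic_def)
qed

end

theorem theorem5p3:
  fixes \<alpha> :: real and \<phi> :: "real \<Rightarrow> complex^2^2" and \<gamma> :: "real \<Rightarrow> complex"
  assumes "\<alpha> \<notin> \<rat>"
    and "C1_cocycle \<phi>"
    and "degree_cocycle \<alpha> \<phi> \<noteq> 0"
    and "measurable_cocycle (sphere 0 1) \<gamma>"
    and "cohomologous \<alpha> \<phi> (diag_cocycle \<gamma>)"
  shows "ergodic skew_space (skew_product \<alpha> \<gamma>)
    \<and> mixing_on skew_space (skew_product \<alpha> \<gamma>)
        (L2_orthocomplement skew_space first_variable_functions)"
proof -
  have \<phi>: "periodic_fun_simple' \<phi>" "\<And>x. \<phi> x \<in> SU2" "\<phi> C1_differentiable_on UNIV"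
    using assms(2) unfolding C1_cocycle_def by blast+
  obtain \<phi>' where \<phi>': "\<And>x. (\<phi> has_vector_derivative \<phi>' x) (at x)" "continuous_on UNIV \<phi>'"
    using \<phi>(3) unfolding C1_differentiable_on_def by auto
  obtain p where p: "measurable_cocycle SU2 p"
    "AE x in torus. \<phi> x = matrix_inv (p x) ** diag_cocycle \<gamma> x ** p (x + \<alpha>)"
    using assms(5) unfolding cohomologous_def by blast
  \<comment> \<open>The default value of \<open>degree_cocycle\<close> is 0, so a nonzero value
    guarantees that a degree exists.\<close>
  obtain d where d: "has_degree \<alpha> \<phi> d" "d \<noteq> 0"
    using assms(3) degree_cocycle_eq unfolding degree_cocycle_def by (metis (no_types))
  obtain \<psi> where \<psi>: "\<psi> \<in> borel_measurable torus" "\<And>x. \<psi> x \<in> su2"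
    "AE x in torus. (\<lambda>n. log_deriv_avg \<alpha> \<phi> n x) \<longlonglongrightarrow> \<psi> x" "AE x in torus. su2_norm (\<psi> x) = d"
    using d(1) unfolding has_degree_def by blast
  interpret T: prob_space torus by (rule prob_space_torus)
  have "0 \<le> d"
  proof -
    have "AE x in torus. 0 \<le> d"
      using \<psi>(4)
    proof eventually_elim
      case (elim x)
      \<comment> \<open>The sign has to be checked because \<open>sqrt\<close> takes negative values
        at negative arguments.\<close>
      have "0 \<le> Re (det (\<psi> x))" using su2_entries(4)[OF \<psi>(2)[of x]] by simp
      then have "0 \<le> su2_norm (\<psi> x)" by (simp add: su2_norm_def)
      then show ?case using elim by simp
    qed
    then show ?thesis by simp
  qed
  interpret C1_cocycle_deriv \<alpha> \<phi> \<phi>'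
    by (rule C1_cocycle_deriv.intro) (rule \<phi> \<phi>')+
  interpret diagonalized_cocycle \<alpha> \<phi> \<phi>' \<gamma> p \<psi> d
    by unfold_locales (use p d \<psi> assms(4) \<open>0 \<le> d\<close> in auto)
  interpret oscillating_extension \<alpha> \<gamma>
    by unfold_locales (rule assms(4), rule scalar_iter_oscillation)
  show ?thesis using ergodic_skew[OF assms(1)] mixing by blast
qed

end
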